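(* Every quitting game $\Gamma((r^S)_{S\subseteq I})$ admits a sunspot $\varepsilon$-equilibrium, for every $\varepsilon>0$.
   Context: A quitting game $\Gamma((r^S)_{S\subseteq I})$ consists of a finite set of players $I=[N]=\{1,\dots,N\}$ and, for every subset $S\subseteq I$ (including $S=\emptyset$), a vector $r^S\in[-1,1]^N$. At every stage $t\in\mathbb N$ each player decides whether to continue or to quit. Let $t^*$ be the first stage at which at least one player quits and $S^*$ the set of players who quit at stage $t^*$; if no player ever quits, $t^*=\infty$ and $S^*=\emptyset$. The payoff vector is $r^{S^*}$. Write $r^i:=r^{\{i\}}$. Sunspot version: at the beginning of every stage $t$ the players publicly observe a signal $s^t\in[0,1]$, drawn from the uniform distribution independently of past signals and play. A strategy of player $i$ is a sequence $\xi_i=(\xi_i^t)_{t\in\mathbb N}$ of measurable functions $\xi_i^t:[0,1]^t\to[0,1]$, where $\xi_i^t(s^1,\dots,s^t)$ is the probability that player $i$ quits at stage $t$ if no player quit before stage $t$ (players randomize independently given the signals). For a profile $\xi$, $\gamma(\xi):=\mathbb E_\xi[r^{S^*}]$. A profile $\xi$ is a sunspot $\varepsilon$-equilibrium if $\gamma_i(\xi)\ge\gamma_i(\xi_i',\xi_{-i})-\varepsilon$ for every player $i$ and every strategy $\xi_i'$ of player $i$ in this extended game. *)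

theory Defs
  imports "HOL-Probability.Probability"
begin

text \<open>Quitting games with public sunspot signals. Players form a finite type 'i.
Stages are indexed by nat starting at 0; at stage t the public signal history is
(s 0, ..., s t), i.e. the restriction of the signal sequence to {..t}.\<close>

definition unif01 :: "real measure" where
  "unif01 = restrict_space lborel {0..1}"

definition signal_space :: "(nat \<Rightarrow> real) measure" where
  "signal_space = PiM UNIV (\<lambda>_. unif01)"

definition history_space :: "nat \<Rightarrow> (nat \<Rightarrow> real) measure" where
  "history_space t = PiM {..t} (\<lambda>_. unif01)"

text \<open>A strategy of a single player: for every stage t a measurable function of the
signal history with values in [0,1] (probability of quitting at stage t).\<close>
definition is_strategy :: "(nat \<Rightarrow> (nat \<Rightarrow> real) \<Rightarrow> real) \<Rightarrow> bool" where
  "is_strategy f \<longleftrightarrow>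
     (\<forall>t. f t \<in> borel_measurable (history_space t) \<and>
          (\<forall>h\<in>space (history_space t). 0 \<le> f t h \<and> f t h \<le> 1))"

type_synonym 'i profile = "'i \<Rightarrow> nat \<Rightarrow> (nat \<Rightarrow> real) \<Rightarrow> real"

definition qprob :: "'i profile \<Rightarrow> nat \<Rightarrow> (nat \<Rightarrow> real) \<Rightarrow> 'i \<Rightarrow> real" where
  "qprob \<xi> t s i = \<xi> i t (restrict s {..t})"

definition cont_prob :: "'i::finite profile \<Rightarrow> nat \<Rightarrow> (nat \<Rightarrow> real) \<Rightarrow> real" where
  "cont_prob \<xi> t s = (\<Prod>k<t. \<Prod>i\<in>UNIV. 1 - qprob \<xi> k s i)"

definition quit_set_prob :: "'i::finite profile \<Rightarrow> nat \<Rightarrow> (nat \<Rightarrow> real) \<Rightarrow> 'i set \<Rightarrow> real" where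
  "quit_set_prob \<xi> t s S =
     (\<Prod>i\<in>S. qprob \<xi> t s i) * (\<Prod>i\<in>UNIV - S. 1 - qprob \<xi> t s i)"

definition cond_payoff ::
  "('i set \<Rightarrow> 'i \<Rightarrow> real) \<Rightarrow> 'i::finite profile \<Rightarrow> (nat \<Rightarrow> real) \<Rightarrow> 'i \<Rightarrow> real" where
  "cond_payoff r \<xi> s j =
     (\<Sum>t. cont_prob \<xi> t s *
            (\<Sum>S\<in>{S. S \<noteq> {}}. quit_set_prob \<xi> t s S * r S j))
     + lim (\<lambda>t. cont_prob \<xi> t s) * r {} j"

definition exp_payoff :: "('i set \<Rightarrow> 'i \<Rightarrow> real) \<Rightarrow> 'i::finite profile \<Rightarrow> 'i \<Rightarrow> real" where
  "exp_payoff r \<xi> j = integral\<^sup>L signal_space (\<lambda>s. cond_payoff r \<xi> s j)"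

definition sunspot_eps_equilibrium ::
  "('i set \<Rightarrow> 'i \<Rightarrow> real) \<Rightarrow> real \<Rightarrow> 'i::finite profile \<Rightarrow> bool" where
  "sunspot_eps_equilibrium r \<epsilon> \<xi> \<longleftrightarrow>
     (\<forall>i. is_strategy (\<xi> i)) \<and>
     (\<forall>i \<xi>'. is_strategy \<xi>' \<longrightarrow> exp_payoff r \<xi> i \<ge> exp_payoff r (\<xi>(i := \<xi>')) i - \<epsilon>)"

end

(* After the normalisation r {i} i = 0 let R be the matrix whose columns are the payoff vectors of solo
   quitting, restricted to the players i who can be held to their own solo payoff 0.

   Stop the quitting game with a small probability l before every stage, with payoff q, and let l tend to 0
   in a stationary equilibrium. If the limit still quits, it is an equilibrium of the quitting game, up to a
   punishment of the only quitter. Otherwise quitting probabilities and l, divided by their sum, converge to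
   a solution of the linear complementarity problem for R and q. So unless an equilibrium exists, R is a
   Q-matrix.

   For a Q-matrix, consider plans in which at each stage one player, whose continuation payoff is about 0,
   quits with small probability, while the sunspot may randomise freely over how to go on and everybody's
   payoff stays nonnegative. Among the payoff vectors u of plans take one for which the probability c that
   the plan ends without quitting is minimal. If c > 0, solve the problem for q near u that differ from u only
   on the zero set of u. A solution that does not shrink to 0 prolongs the plan. Otherwise the submatrix on the zero set
   is a Q-matrix, and a plan for these fewer players, obtained by induction, can be run before u. Both
   contradict minimality. To keep u away from 0 one minimises over a half-space that contains the columns
   of R; if there is none, 0 is a convex combination of the columns, which is a plan by itself.

   A plan with small c and small steps is an approximate equilibrium: at its end, the players punish the one
   whose continuing would explain best that nobody has quit. *)

theory Submission
  imports Defs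
begin

section \<open>Payoffs of quitting sequences\<close>

text \<open>The main obstacle is the accumulation of small errors. An actor who is indifferent only
  up to \<open>e\<close> can gain about \<open>e * \<delta>\<close> at each own stage by continuing,
  in total \<open>e\<close> times the length of the plan, and the limit arguments give no control of
  this length as \<open>e\<close> tends to 0. Plans are therefore cut at a length that is fixed
  before \<open>e\<close>; the cut costs an exponentially small probability. The sunspot makes the
  set of outcomes of plans convex. A solution of the complementarity problem may have several active
  players and a positive weight on \<open>q\<close>; a lottery selects a single actor, or a jump to
  another plan, at each stage. During a plan two players can thus quit together only after a
  deviation, and then with probability at most \<open>e\<close>. A player who cannot be held to 0
  gets a positive payoff whenever another player quits alone and also if nobody ever quits. Waiting
  is always good for such a player, who can therefore be left out of the matrix.\<close>

definition outcome_mean :: "('i::finite set \<Rightarrow> real) \<Rightarrow> ('i \<Rightarrow> real) \<Rightarrow> real" where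
  "outcome_mean \<rho> x = (\<Sum>S\<in>UNIV. (\<Prod>i\<in>UNIV. if i \<in> S then x i else 1 - x i) * \<rho> S)"

definition probs :: "('i \<Rightarrow> real) \<Rightarrow> bool" where
  "probs x \<longleftrightarrow> (\<forall>i. 0 \<le> x i \<and> x i \<le> 1)"

lemma prod_if_eq:
  fixes x :: "'i::finite \<Rightarrow> real"
  shows "(\<Prod>i\<in>UNIV. if i \<in> S then x i else 1 - x i) = (\<Prod>i\<in>S. x i) * (\<Prod>i\<in>UNIV - S. 1 - x i)"
  by (simp add: prod.If_cases Compl_eq_Diff_UNIV)

lemma outcome_mean_1 [simp]: "outcome_mean (\<lambda>_. 1) x = 1"
proof -
  have "(\<Prod>i\<in>UNIV. x i + (1 - x i)) = (\<Sum>S\<in>Pow UNIV. (\<Prod>i\<in>S. x i) * (\<Prod>i\<in>UNIV - S. 1 - x i))"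
    by (rule prod_add) simp
  then show ?thesis by (simp add: outcome_mean_def prod_if_eq)
qed

lemma outcome_mean_linear:
  "outcome_mean (\<lambda>S. a * \<rho> S + b * \<sigma> S) x = a * outcome_mean \<rho> x + b * outcome_mean \<sigma> x"
  unfolding outcome_mean_def sum_distrib_left sum.distrib[symmetric]
  by (intro sum.cong) (auto simp: algebra_simps)

lemma outcome_mean_mono:
  assumes "probs x" "\<And>S. \<rho> S \<le> \<sigma> S"
  shows "outcome_mean \<rho> x \<le> outcome_mean \<sigma> x"
  unfolding outcome_mean_def
  using assms by (intro sum_mono mult_left_mono prod_nonneg) (auto simp: probs_def)

text \<open>\<open>outcome_mean\<close> is the multilinear extension of the set function
  \<open>\<rho>\<close>, hence affine in each single quitting probability: only the two pure actions
  of a player have to be compared.\<close>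

lemma outcome_mean_affine:
  "outcome_mean \<rho> (x(j := d)) = d * outcome_mean \<rho> (x(j := 1)) + (1 - d) * outcome_mean \<rho> (x(j := 0))"
proof -
  have *: "(\<Prod>i\<in>UNIV. if i \<in> S then (x(j := c)) i else 1 - (x(j := c)) i) =
     (if j \<in> S then c else 1 - c) * (\<Prod>i\<in>UNIV - {j}. if i \<in> S then x i else 1 - x i)" for S c
  proof -
    have "(\<Prod>i\<in>UNIV - {j}. if i \<in> S then (x(j := c)) i else 1 - (x(j := c)) i) =
      (\<Prod>i\<in>UNIV - {j}. if i \<in> S then x i else 1 - x i)" by (rule prod.cong) auto
    then show ?thesis by (subst prod.remove[of _ j]) auto
  qed
  show ?thesis
    unfolding outcome_mean_def * sum_distrib_left sum.distrib[symmetric]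
    by (intro sum.cong) (auto simp: algebra_simps)
qed

lemma outcome_mean_pure: "outcome_mean \<rho> (\<lambda>i. if i \<in> S then 1 else 0) = \<rho> S"
proof -
  have "(\<Prod>i\<in>UNIV. if i \<in> T then (if i \<in> S then 1 else 0) else 1 - (if i \<in> S then 1 else (0::real))) = (if T = S then 1 else 0)"
    for T :: "'a set"
  proof (cases "T = S")
    case False
    then obtain i where "i \<in> T \<longleftrightarrow> i \<notin> S" by blast
    then show ?thesis using False by (intro prod_zero[THEN trans]) (auto intro!: exI[of _ i] bexI[of _ i])
  qed (auto intro: prod.neutral)
  then show ?thesis by (simp add: outcome_mean_def if_distrib[of "\<lambda>c. c * _"] cong: if_cong)
qed

lemma outcome_mean_none: "outcome_mean \<rho> (\<lambda>_. 0) = \<rho> {}"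
  using outcome_mean_pure[of \<rho> "{}"] by simp

lemma outcome_mean_one: "outcome_mean \<rho> ((\<lambda>_. 0)(k := d)) = d * \<rho> {k} + (1 - d) * \<rho> {}"
proof -
  have "(\<lambda>_. 0)(k := 1) = (\<lambda>i. if i \<in> {k} then 1 else (0::real))" by auto
  moreover have "(\<lambda>_. 0)(k := 0) = (\<lambda>i. 0::real)" by auto
  ultimately show ?thesis
    using outcome_mean_affine[of \<rho> "\<lambda>_. 0" k d] by (simp only: outcome_mean_pure outcome_mean_none)
qed

lemma outcome_mean_two:
  assumes "j \<noteq> k"
  shows "outcome_mean \<rho> ((\<lambda>_. 0)(k := \<delta>, j := d)) =
     d * (\<delta> * \<rho> {j, k} + (1 - \<delta>) * \<rho> {j}) + (1 - d) * (\<delta> * \<rho> {k} + (1 - \<delta>) * \<rho> {})"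
proof -
  have e: "(\<lambda>_. 0)(k := \<delta>, j := 0) = (\<lambda>_. 0::real)(k := \<delta>)" using assms by auto
  have "(\<lambda>_. 0)(k := \<delta>, j := 1) = (\<lambda>_. 0::real)(j := 1, k := \<delta>)" using assms by auto
  moreover have "(\<lambda>_. 0)(j := 1, k := 1) = (\<lambda>i. if i \<in> {j, k} then 1 else (0::real))" by auto
  moreover have "(\<lambda>_. 0)(j := 1, k := 0) = (\<lambda>i. if i \<in> {j} then 1 else (0::real))" using assms by auto
  ultimately have "outcome_mean \<rho> ((\<lambda>_. 0)(k := \<delta>, j := 1)) = \<delta> * \<rho> {j, k} + (1 - \<delta>) * \<rho> {j}"
    using outcome_mean_affine[of \<rho> "(\<lambda>_. 0)(j := 1)" k \<delta>] by (simp only: outcome_mean_pure)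
  then show ?thesis
    using outcome_mean_affine[of \<rho> "(\<lambda>_. 0)(k := \<delta>)" j d] by (simp only: e outcome_mean_one)
qed

lemma tendsto_outcome_mean:
  assumes "\<And>i. ((\<lambda>n. x n i) \<longlongrightarrow> y i) F" "\<And>S. ((\<lambda>n. \<rho> n S) \<longlongrightarrow> \<sigma> S) F"
  shows "((\<lambda>n. outcome_mean (\<rho> n) (x n)) \<longlongrightarrow> outcome_mean \<sigma> y) F"
proof -
  have "((\<lambda>n. if i \<in> S then x n i else 1 - x n i) \<longlongrightarrow> (if i \<in> S then y i else 1 - y i)) F" for S i
    by (cases "i \<in> S") (auto intro!: tendsto_intros assms)
  then show ?thesis unfolding outcome_mean_def by (intro tendsto_intros assms)
qed

text \<open>Two or more given players quit together with probability at most the square of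
  \<open>sum x UNIV\<close>, and a factor for the others continuing differs from 1 by at most this
  sum. Each of the \<open>2 ^ CARD('i)\<close> sets contributes one such error;
  \<open>\<rho> {} = 0\<close> removes the empty set, whose probability is close to 1.\<close>

lemma outcome_mean_first_order:
  fixes x :: "'i::finite \<Rightarrow> real"
  assumes x: "probs x" and \<rho>: "\<And>S. \<bar>\<rho> S\<bar> \<le> B" "\<rho> {} = 0"
  shows "\<bar>outcome_mean \<rho> x - (\<Sum>i\<in>UNIV. x i * \<rho> {i})\<bar> \<le> 2 ^ CARD('i) * B * (sum x UNIV)\<^sup>2"
proof -
  define p where "p S = (\<Prod>i\<in>S. x i) * (\<Prod>i\<in>UNIV - S. 1 - x i)" for S
  \<comment> \<open>First-order approximation of \<open>p\<close>: weight \<open>x i\<close> on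
    \<open>{i}\<close> and 0 on all other sets.\<close>
  define q where "q S = (if is_singleton S then x (the_elem S) else 0)" for S :: "'i set"
  define \<sigma> where "\<sigma> = sum x UNIV"
  have x01: "0 \<le> x i" "x i \<le> 1" for i using x by (auto simp: probs_def)
  have x\<sigma>: "x i \<le> \<sigma>" for i unfolding \<sigma>_def using x01 by (intro member_le_sum) auto
  have \<sigma>0: "0 \<le> \<sigma>" unfolding \<sigma>_def using x01 by (intro sum_nonneg) auto
  have qsum: "(\<Sum>i\<in>UNIV. x i * \<rho> {i}) = (\<Sum>S\<in>UNIV. q S * \<rho> S)"
  proof -
    have "(\<Sum>S\<in>UNIV. q S * \<rho> S) = (\<Sum>S\<in>(\<lambda>i. {i}) ` UNIV. q S * \<rho> S)"
      by (rule sum.mono_neutral_right) (auto simp: q_def is_singleton_def)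
    also have "\<dots> = (\<Sum>i\<in>UNIV. q {i} * \<rho> {i})" by (subst sum.reindex) (auto simp: inj_on_def)
    finally show ?thesis by (simp add: q_def)
  qed
  have bound: "\<bar>p S - q S\<bar> \<le> \<sigma>\<^sup>2" if ne: "S \<noteq> {}" for S
  proof (cases "is_singleton S")
    case True
    then obtain i where S: "S = {i}" by (auto simp: is_singleton_def)
    define t where "t = (\<Prod>k\<in>UNIV - {i}. 1 - x k)"
    have "1 - sum x (UNIV - {i}) \<le> t" unfolding t_def using x01 by (intro Weierstrass_prod_ineq) auto
    moreover have "sum x (UNIV - {i}) \<le> \<sigma>" unfolding \<sigma>_def using x01 by (intro sum_mono2) auto
    moreover have "t \<le> 1" unfolding t_def using x01 by (intro prod_le_1) auto
    ultimately have "0 \<le> 1 - t" "1 - t \<le> \<sigma>" by linarith+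
    then have "x i * (1 - t) \<le> \<sigma> * \<sigma>" "0 \<le> x i * (1 - t)" using x01 x\<sigma>[of i] \<sigma>0 by (auto intro: mult_mono)
    moreover have "p S - q S = - (x i * (1 - t))" by (simp add: p_def q_def S t_def algebra_simps)
    ultimately show ?thesis by (simp add: power2_eq_square)
  next
    case False
    obtain a where a: "a \<in> S" using ne by blast
    moreover have "S \<noteq> {a}" using False by (auto simp: is_singleton_def)
    ultimately obtain b where ab: "a \<in> S" "b \<in> S" "a \<noteq> b" by blast
    have "(\<Prod>i\<in>S. x i) = x a * (x b * (\<Prod>i\<in>S - {a} - {b}. x i))"
      using ab by (simp add: prod.remove[of S a] prod.remove[of "S - {a}" b])
    also have "\<dots> \<le> \<sigma> * (\<sigma> * 1)"
      using x01 x\<sigma> \<sigma>0 by (intro mult_mono mult_nonneg_nonneg prod_le_1 prod_nonneg) auto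
    finally have "(\<Prod>i\<in>S. x i) * (\<Prod>i\<in>UNIV - S. 1 - x i) \<le> \<sigma>\<^sup>2 * 1"
      using x01 by (intro mult_mono prod_le_1 prod_nonneg) (auto simp: power2_eq_square)
    moreover have "0 \<le> p S" unfolding p_def using x01 by (intro mult_nonneg_nonneg prod_nonneg) auto
    ultimately show ?thesis using False by (simp add: p_def q_def)
  qed
  have "outcome_mean \<rho> x - (\<Sum>i\<in>UNIV. x i * \<rho> {i}) = (\<Sum>S\<in>UNIV. (p S - q S) * \<rho> S)"
    unfolding qsum by (simp add: outcome_mean_def prod_if_eq p_def left_diff_distrib sum_subtractf)
  also have "\<bar>\<dots>\<bar> \<le> (\<Sum>S\<in>(UNIV :: 'i set set). \<sigma>\<^sup>2 * B)"
  proof (rule order_trans[OF sum_abs sum_mono])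
    fix S show "\<bar>(p S - q S) * \<rho> S\<bar> \<le> \<sigma>\<^sup>2 * B"
    proof (cases "S = {}")
      case False
      then show ?thesis unfolding abs_mult using bound \<rho> by (intro mult_mono) auto
    next
      case True
      have "0 \<le> B" using \<rho>(1)[of "{}"] by simp
      then show ?thesis using True \<rho>(2) by simp
    qed
  qed
  also have "\<dots> = 2 ^ CARD('i) * B * \<sigma>\<^sup>2" by (simp add: card_UNIV_set)
  finally show ?thesis unfolding \<sigma>_def .
qed

section \<open>The event that somebody quits in a given stage\<close>

definition quits :: "('i::finite \<Rightarrow> real) \<Rightarrow> real" where
  "quits x = outcome_mean (\<lambda>S. if S = {} then 0 else 1) x"

text \<open>Integrated over the event that somebody quits, not conditioned on it; bounds therefore
  take the form \<open>B * quits x\<close>.\<close>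

definition stage_payoff :: "('i::finite set \<Rightarrow> 'i \<Rightarrow> real) \<Rightarrow> ('i \<Rightarrow> real) \<Rightarrow> 'i \<Rightarrow> real" where
  "stage_payoff r x j = outcome_mean (\<lambda>S. if S = {} then 0 else r S j) x"

lemma outcome_mean_empty: "outcome_mean (\<lambda>S. if S = {} then 1 else 0) x = (\<Prod>i\<in>UNIV. 1 - x i)"
proof -
  have "outcome_mean (\<lambda>S. if S = {} then 1 else 0) x =
    (\<Sum>S\<in>{{}}. (\<Prod>i\<in>UNIV. if i \<in> S then x i else 1 - x i) * (if S = {} then 1 else 0))"
    unfolding outcome_mean_def by (rule sum.mono_neutral_right) auto
  then show ?thesis by simp
qed

lemma prod_one_minus: "(\<Prod>i\<in>UNIV. 1 - x i) = 1 - quits x"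
proof -
  have "1 - quits x = outcome_mean (\<lambda>S. 1 * 1 + (-1) * (if S = {} then 0 else 1)) x"
    unfolding outcome_mean_linear by (simp add: quits_def)
  also have "\<dots> = outcome_mean (\<lambda>S. if S = {} then 1 else 0) x" by (rule arg_cong[of _ _ "\<lambda>f. outcome_mean f x"]) auto
  also have "\<dots> = (\<Prod>i\<in>UNIV. 1 - x i)" by (rule outcome_mean_empty)
  finally show ?thesis by simp
qed

lemma quits_bounds: "probs x \<Longrightarrow> 0 \<le> quits x \<and> quits x \<le> 1"
  using prod_one_minus[of x] prod_nonneg[of UNIV "\<lambda>i. 1 - x i"] prod_le_1[of UNIV "\<lambda>i. 1 - x i"]
  by (auto simp: probs_def)

lemma quits_upd: "1 - quits (x(j := d)) = (1 - d) * (1 - quits (x(j := 0)))"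
proof -
  have "(\<Prod>i\<in>UNIV - {j}. 1 - (x(j := d)) i) = (\<Prod>i\<in>UNIV - {j}. 1 - (x(j := 0)) i)"
    by (rule prod.cong) auto
  then show ?thesis unfolding prod_one_minus[symmetric] by (simp add: prod.remove[of UNIV j])
qed

text \<open>A continuation payoff \<open>w\<close> acts as the payoff of the empty set. This turns
  one-stage comparisons into statements about \<open>outcome_mean\<close>.\<close>

lemma one_shot: "stage_payoff r x j + (1 - quits x) * w = outcome_mean (\<lambda>S. if S = {} then w else r S j) x"
proof -
  have "outcome_mean (\<lambda>S. if S = {} then w else r S j) x =
     outcome_mean (\<lambda>S. 1 * (if S = {} then 0 else r S j) + w * (if S = {} then 1 else 0)) x"
    by (rule arg_cong[of _ _ "\<lambda>f. outcome_mean f x"]) auto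
  also have "outcome_mean (\<lambda>S. if S = {} then 1 else 0) x = 1 - quits x"
    by (simp add: outcome_mean_empty prod_one_minus)
  then have "outcome_mean (\<lambda>S. 1 * (if S = {} then 0 else r S j) + w * (if S = {} then 1 else 0)) x = stage_payoff r x j + (1 - quits x) * w"
    unfolding outcome_mean_linear by (simp add: stage_payoff_def)
  finally show ?thesis by simp
qed

lemma stage_payoff_le:
  assumes "probs x" "\<And>S. r S j \<le> B" shows "stage_payoff r x j \<le> B * quits x"
proof -
  have "stage_payoff r x j \<le> outcome_mean (\<lambda>S. B * (if S = {} then 0 else 1) + 0 * 0) x"
    unfolding stage_payoff_def using assms by (intro outcome_mean_mono) auto
  then show ?thesis unfolding outcome_mean_linear by (simp add: quits_def)
qed

lemma stage_payoff_ge: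
  assumes "probs x" "\<And>S. B \<le> r S j" shows "B * quits x \<le> stage_payoff r x j"
proof -
  have "outcome_mean (\<lambda>S. B * (if S = {} then 0 else 1) + 0 * 0) x \<le> stage_payoff r x j"
    unfolding stage_payoff_def using assms by (intro outcome_mean_mono) auto
  then show ?thesis unfolding outcome_mean_linear by (simp add: quits_def)
qed

section \<open>Payoff of a fixed sequence of quitting probabilities\<close>

definition survival :: "(nat \<Rightarrow> 'i::finite \<Rightarrow> real) \<Rightarrow> nat \<Rightarrow> real" where
  "survival Q t = (\<Prod>k<t. 1 - quits (Q k))"

definition payoff :: "('i::finite set \<Rightarrow> 'i \<Rightarrow> real) \<Rightarrow> (nat \<Rightarrow> 'i \<Rightarrow> real) \<Rightarrow> 'i \<Rightarrow> real" where
  "payoff r Q j = (\<Sum>t. survival Q t * stage_payoff r (Q t) j) + lim (survival Q) * r {} j"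

lemma cond_payoff_eq_payoff: "cond_payoff r \<xi> s j = payoff r (\<lambda>t. qprob \<xi> t s) j"
proof -
  have "(\<Sum>S\<in>{S. S \<noteq> {}}. quit_set_prob \<xi> t s S * r S j) = stage_payoff r (qprob \<xi> t s) j" for t
    unfolding stage_payoff_def outcome_mean_def quit_set_prob_def prod_if_eq
    by (intro sum.mono_neutral_cong_left) auto
  moreover have "cont_prob \<xi> t s = survival (\<lambda>t. qprob \<xi> t s) t" for t
    by (simp add: survival_def cont_prob_def prod_one_minus)
  ultimately show ?thesis by (simp add: cond_payoff_def payoff_def cong: if_cong)
qed

context
  fixes Q :: "nat \<Rightarrow> 'i::finite \<Rightarrow> real"
  assumes Q: "\<And>t. probs (Q t)"
begin

lemma survival_0: "survival Q 0 = 1" by (simp add: survival_def)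

lemma survival_Suc: "survival Q (Suc t) = survival Q t * (1 - quits (Q t))"
  by (simp add: survival_def)

lemma survival_bounds: "0 \<le> survival Q t" "survival Q t \<le> 1"
  unfolding survival_def using quits_bounds[OF Q] by (auto intro!: prod_nonneg prod_le_1)

lemma survival_decseq: "decseq (survival Q)"
  unfolding decseq_Suc_iff survival_Suc
  using survival_bounds quits_bounds[OF Q] by (auto intro: mult_left_le)

lemma survival_convergent: "convergent (survival Q)"
  using survival_decseq decseq_bounded survival_bounds by (metis Bseq_monoseq_convergent decseq_imp_monoseq decseq_bounded)

lemma survival_LIMSEQ: "survival Q \<longlonglongrightarrow> lim (survival Q)"
  using survival_convergent by (simp add: convergent_LIMSEQ_iff)

lemma lim_survival_bounds: "0 \<le> lim (survival Q)" "lim (survival Q) \<le> 1"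
  using LIMSEQ_le_const[OF survival_LIMSEQ, of 0] LIMSEQ_le_const2[OF survival_LIMSEQ, of 1] survival_bounds by auto

lemma quit_prob_sums: "(\<lambda>t. survival Q t * quits (Q t)) sums (1 - lim (survival Q))"
proof -
  have "survival Q t * quits (Q t) = survival Q t - survival Q (Suc t)" for t
    by (simp add: survival_Suc algebra_simps)
  then show ?thesis
    using telescope_sums'[OF survival_LIMSEQ] by (simp add: survival_0)
qed

lemma payoff_summable:
  assumes "\<And>S. \<bar>r S j\<bar> \<le> B"
  shows "summable (\<lambda>t. survival Q t * stage_payoff r (Q t) j)"
proof (rule summable_comparison_test')
  show "summable (\<lambda>t. B * (survival Q t * quits (Q t)))"
    using quit_prob_sums by (intro summable_mult) (rule sums_summable)
  fix t
  have "\<bar>stage_payoff r (Q t) j\<bar> \<le> B * quits (Q t)"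
    using stage_payoff_le[OF Q, of r j B t] stage_payoff_ge[OF Q, of "-B" r j t] assms
    by (auto simp: abs_le_iff minus_le_iff)
  then show "norm (survival Q t * stage_payoff r (Q t) j) \<le> B * (survival Q t * quits (Q t))"
    using survival_bounds(1)[of t] mult_left_mono[of "\<bar>stage_payoff r (Q t) j\<bar>" "B * quits (Q t)" "survival Q t"]
    by (simp add: abs_mult ac_simps)
qed

text \<open>The probabilities of quitting first at stage \<open>t\<close> add up to 1 minus the
  limit of the survival probability, so a bound on the payoff given quitting at each stage bounds
  the total. The event that nobody ever quits must be null or be covered by
  \<open>r {} j \<le> B\<close>.\<close>

lemma payoff_le:
  assumes r: "\<And>S. \<bar>r S j\<bar> \<le> C" and B: "\<And>t. stage_payoff r (Q t) j \<le> B * quits (Q t)"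
    and l: "lim (survival Q) = 0 \<or> r {} j \<le> B"
  shows "payoff r Q j \<le> B"
proof -
  have "(\<Sum>t. survival Q t * stage_payoff r (Q t) j) \<le> (\<Sum>t. B * (survival Q t * quits (Q t)))"
  proof (rule suminf_le)
    fix t show "survival Q t * stage_payoff r (Q t) j \<le> B * (survival Q t * quits (Q t))"
      using mult_left_mono[OF B survival_bounds(1)] by (simp add: ac_simps)
  qed (use payoff_summable[of r j C, OF r] quit_prob_sums in \<open>auto intro!: summable_mult sums_summable\<close>)
  also have "\<dots> = B * (1 - lim (survival Q))"
    using quit_prob_sums by (metis sums_mult sums_unique)
  finally have "payoff r Q j \<le> B * (1 - lim (survival Q)) + lim (survival Q) * r {} j" by (simp add: payoff_def)
  also have "lim (survival Q) * r {} j \<le> lim (survival Q) * B" using l lim_survival_bounds(1) by (auto intro: mult_left_mono)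
  finally show ?thesis by (simp add: algebra_simps)
qed

lemma payoff_shift:
  assumes r: "\<And>S. \<bar>r S j\<bar> \<le> C"
  shows "payoff (\<lambda>S i. r S i - k i) Q j = payoff r Q j - k j"
proof -
  have "stage_payoff (\<lambda>S i. r S i - k i) x j = stage_payoff r x j - k j * quits x" for x
  proof -
    have "stage_payoff (\<lambda>S i. r S i - k i) x j =
      outcome_mean (\<lambda>S. 1 * (if S = {} then 0 else r S j) + (- k j) * (if S = {} then 0 else 1)) x"
      unfolding stage_payoff_def by (rule arg_cong[of _ _ "\<lambda>f. outcome_mean f x"]) auto
    then show ?thesis unfolding outcome_mean_linear by (simp add: stage_payoff_def quits_def)
  qed
  note shift = this
  have "survival Q t * stage_payoff (\<lambda>S i. r S i - k i) (Q t) j =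
     survival Q t * stage_payoff r (Q t) j - k j * (survival Q t * quits (Q t))" for t
    by (simp add: shift right_diff_distrib)
  then have "(\<Sum>t. survival Q t * stage_payoff (\<lambda>S i. r S i - k i) (Q t) j) =
     (\<Sum>t. survival Q t * stage_payoff r (Q t) j - k j * (survival Q t * quits (Q t)))"
    by (simp only:)
  also have "\<dots> = (\<Sum>t. survival Q t * stage_payoff r (Q t) j) - k j * (1 - lim (survival Q))"
    using payoff_summable[of r j C, OF r] quit_prob_sums
    by (subst suminf_diff[symmetric]) (auto intro!: summable_mult sums_summable, metis sums_mult sums_unique)
  finally show ?thesis by (simp add: payoff_def algebra_simps)
qed

end

lemma payoff_ge:
  assumes Q: "\<And>t. probs (Q t)" and r: "\<And>S. \<bar>r S j\<bar> \<le> C" and B: "\<And>t. B * quits (Q t) \<le> stage_payoff r (Q t) j"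
    and l: "lim (survival Q) = 0 \<or> B \<le> r {} j"
  shows "B \<le> payoff r Q j"
proof -
  have neg: "stage_payoff (\<lambda>S i. - r S i) x j = - stage_payoff r x j" for x
  proof -
    have "stage_payoff (\<lambda>S i. - r S i) x j = outcome_mean (\<lambda>S. (-1) * (if S = {} then 0 else r S j) + 0 * 0) x"
      unfolding stage_payoff_def by (rule arg_cong[of _ _ "\<lambda>f. outcome_mean f x"]) auto
    then show ?thesis unfolding outcome_mean_linear by (simp add: stage_payoff_def)
  qed
  have "payoff (\<lambda>S i. - r S i) Q j \<le> - B"
    using B l r by (intro payoff_le[of Q _ j C, OF Q]) (auto simp: neg)
  moreover have "payoff (\<lambda>S i. - r S i) Q j = - payoff r Q j"
    unfolding payoff_def neg using suminf_minus[OF payoff_summable[of Q r j C, OF Q r]] by simp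
  ultimately show ?thesis by simp
qed

lemma payoff_bound:
  assumes Q: "\<And>t. probs (Q t)" and r: "\<And>S. \<bar>r S j\<bar> \<le> C"
  shows "\<bar>payoff r Q j\<bar> \<le> C"
proof -
  have r': "r S j \<le> C" "- C \<le> r S j" for S using r[of S] by auto
  have "payoff r Q j \<le> C"
    by (rule payoff_le[of Q r j C, OF Q r stage_payoff_le[of _ r j C, OF Q r'(1)]]) (use r' in auto)
  moreover have "- C \<le> payoff r Q j"
    by (rule payoff_ge[of Q r j C, OF Q r stage_payoff_ge[of _ "-C" r j, OF Q r'(2)]]) (use r' in auto)
  ultimately show ?thesis by linarith
qed

lemma payoff_Suc:
  assumes Q: "\<And>t. probs (Q t)" and r: "\<And>S. \<bar>r S j\<bar> \<le> C"
  shows "payoff r Q j = stage_payoff r (Q 0) j + (1 - quits (Q 0)) * payoff r (\<lambda>t. Q (Suc t)) j"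
proof -
  let ?Q = "\<lambda>t. Q (Suc t)"
  have Q': "probs (?Q t)" for t using Q .
  have s: "survival Q (Suc t) = (1 - quits (Q 0)) * survival ?Q t" for t
    unfolding survival_def by (rule prod.lessThan_Suc_shift)
  have "(\<Sum>t. survival Q t * stage_payoff r (Q t) j) =
     (\<Sum>t. survival Q (Suc t) * stage_payoff r (?Q t) j) + survival Q 0 * stage_payoff r (Q 0) j"
    using suminf_split_head[OF payoff_summable[of Q r j C, OF Q r]] by simp
  also have "(\<Sum>t. survival Q (Suc t) * stage_payoff r (?Q t) j) =
      (1 - quits (Q 0)) * (\<Sum>t. survival ?Q t * stage_payoff r (?Q t) j)"
    unfolding s mult.assoc by (rule suminf_mult[OF payoff_summable[of ?Q r j C, OF Q' r]])
  finally have 1: "(\<Sum>t. survival Q t * stage_payoff r (Q t) j) =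
      (1 - quits (Q 0)) * (\<Sum>t. survival ?Q t * stage_payoff r (?Q t) j) + stage_payoff r (Q 0) j"
    by (simp add: survival_def)
  have "(\<lambda>t. survival Q (Suc t)) \<longlonglongrightarrow> (1 - quits (Q 0)) * lim (survival ?Q)"
    unfolding s by (intro tendsto_intros survival_LIMSEQ[OF Q'])
  then have "lim (survival Q) = (1 - quits (Q 0)) * lim (survival ?Q)"
    by (metis LIMSEQ_imp_Suc limI)
  then show ?thesis using 1 by (simp add: payoff_def distrib_left mult.assoc)
qed

lemma payoff_measurable:
  assumes "\<And>t i. (\<lambda>\<omega>. Q \<omega> t i) \<in> borel_measurable N"
  shows "(\<lambda>\<omega>. payoff r (Q \<omega>) j) \<in> borel_measurable N"
proof -
  have m: "(\<lambda>\<omega>. outcome_mean \<rho> (Q \<omega> t)) \<in> borel_measurable N" for \<rho> t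
    unfolding outcome_mean_def using assms by (intro borel_measurable_sum borel_measurable_times borel_measurable_prod) auto
  have s: "(\<lambda>\<omega>. survival (Q \<omega>) t) \<in> borel_measurable N" for t
    unfolding survival_def quits_def using m by (intro borel_measurable_prod borel_measurable_diff) auto
  show ?thesis
    unfolding payoff_def stage_payoff_def
    by (intro borel_measurable_add borel_measurable_suminf borel_measurable_times borel_measurable_lim_metric s m) auto
qed

lemma survival_le_power:
  assumes "\<And>t. probs (Q t)" "\<And>t. e \<le> quits (Q t)" "e \<le> 1"
  shows "survival Q t \<le> (1 - e) ^ t"
proof (induction t)
  case (Suc t)
  have "survival Q t * (1 - quits (Q t)) \<le> (1 - e) ^ t * (1 - e)"
    using Suc assms quits_bounds[OF assms(1)] survival_bounds(1)[of Q t] by (intro mult_mono) auto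
  then show ?case by (simp add: survival_Suc[OF assms(1)] mult.commute)
qed (simp add: survival_def)

lemma lim_survival_0:
  assumes Q: "\<And>t. probs (Q t)" and e: "\<And>t. e \<le> quits (Q t)" "0 < e"
  shows "lim (survival Q) = 0"
proof -
  have e1: "e \<le> 1" using e(1)[of 0] quits_bounds[OF Q, of 0] by linarith
  have "(\<lambda>t. (1 - e) ^ t) \<longlonglongrightarrow> 0" using e e1 by (intro LIMSEQ_power_zero) auto
  then have "survival Q \<longlonglongrightarrow> 0"
    by (rule tendsto_sandwich[OF _ _ tendsto_const, rotated 2])
       (use survival_bounds[OF Q] survival_le_power[OF Q e(1) e1] in auto)
  then show ?thesis by (rule limI)
qed

lemma quits_ge: assumes "probs x" shows "x k \<le> quits x"
proof -
  have "1 - quits x = (1 - x k) * (1 - quits (x(k := 0)))" using quits_upd[of x k "x k"] by simp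
  also have "\<dots> \<le> (1 - x k) * 1"
    using assms quits_bounds[of "x(k := 0)"] by (intro mult_left_mono) (auto simp: probs_def)
  finally show ?thesis by simp
qed

lemma continuous_on_outcome_mean:
  assumes "\<And>i. continuous_on A (\<lambda>p. x p i)" "\<And>S. continuous_on A (\<lambda>p. \<rho> p S)"
  shows "continuous_on A (\<lambda>p. outcome_mean (\<rho> p) (x p))"
  using assms unfolding continuous_on_def by (auto intro: tendsto_outcome_mean)

section \<open>Plans and the linear complementarity problem\<close>

text \<open>A plan: in \<open>Act i \<delta> t\<close> player \<open>i\<close> quits with probability \<open>\<delta>\<close> and otherwise \<open>t\<close> is followed; \<open>Mix p t u\<close> is a
  public lottery, resolved by the signal of the current stage without consuming a stage. The vector in \<open>Stop w\<close>
  is only promised: whether play after the end of the plan delivers it is irrelevant if \<open>mass\<close> is small.\<close>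
datatype ('i::finite) tree =
    Stop "real^'i"
  | Act 'i real "'i tree"
  | Mix real "'i tree" "'i tree"

primrec mass :: "('i::finite) tree \<Rightarrow> real" where
  "mass (Stop w) = 1"
| "mass (Act i \<delta> t) = (1 - \<delta>) * mass t"
| "mass (Mix p t u) = p * mass t + (1 - p) * mass u"

text \<open>Time measured in quitting probability, along the longest branch. Along a branch the
  product of the \<open>1 - \<delta>\<close> is at most the exponential of minus the sum of the
  \<open>\<delta>\<close>, which links length and survival.\<close>

primrec duration :: "('i::finite) tree \<Rightarrow> real" where
  "duration (Stop w) = 0"
| "duration (Act i \<delta> t) = \<delta> + duration t"
| "duration (Mix p t u) = max (duration t) (duration u)"

locale solo_payoffs =
  fixes R :: "'i::finite \<Rightarrow> real^'i"
  assumes R_bound: "\<bar>R i $ j\<bar> \<le> 2"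
    and R_diag: "R i $ i = 0"
begin

primrec val :: "'i tree \<Rightarrow> real^'i" where
  "val (Stop w) = w"
| "val (Act i \<delta> t) = \<delta> *\<^sub>R R i + (1 - \<delta>) *\<^sub>R val t"
| "val (Mix p t u) = p *\<^sub>R val t + (1 - p) *\<^sub>R val u"

text \<open>Own solo payoffs are 0, so an actor with value about 0 is nearly indifferent, and a
  value of at least \<open>- e\<close> keeps the players in \<open>Z\<close> from quitting out of
  turn. \<open>\<delta> \<le> e\<close> makes quitting together with the actor worth only order
  \<open>e\<close>, and \<open>\<delta> \<le> 1/2\<close> permits division by
  \<open>1 - \<delta>\<close>. \<open>Mix\<close> has no condition on values, because nobody moves
  before its result is known.\<close>

primrec valid :: "'i set \<Rightarrow> real \<Rightarrow> 'i tree \<Rightarrow> bool" where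
  "valid Z e (Stop w) \<longleftrightarrow> (\<forall>j. \<bar>w $ j\<bar> \<le> 2) \<and> (\<forall>j\<in>Z. - e \<le> w $ j)"
| "valid Z e (Act i \<delta> t) \<longleftrightarrow> i \<in> Z \<and> 0 < \<delta> \<and> \<delta> \<le> e \<and> \<delta> \<le> 1/2 \<and>
     \<bar>val (Act i \<delta> t) $ i\<bar> \<le> e \<and> (\<forall>j\<in>Z. - e \<le> val (Act i \<delta> t) $ j) \<and> valid Z e t"
| "valid Z e (Mix p t u) \<longleftrightarrow> 0 < p \<and> p < 1 \<and> valid Z e t \<and> valid Z e u"

lemma convex_abs_le:
  fixes x y c p :: real
  assumes "\<bar>x\<bar> \<le> c" "\<bar>y\<bar> \<le> c" "0 \<le> p" "p \<le> 1"
  shows "\<bar>p * x + (1 - p) * y\<bar> \<le> c"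
proof -
  have "\<bar>p * x + (1 - p) * y\<bar> \<le> \<bar>p * x\<bar> + \<bar>(1 - p) * y\<bar>" by (rule abs_triangle_ineq)
  also have "\<dots> = p * \<bar>x\<bar> + (1 - p) * \<bar>y\<bar>" using assms by (simp add: abs_mult)
  also have "\<dots> \<le> p * c + (1 - p) * c"
    using assms by (intro add_mono mult_left_mono) auto
  finally show ?thesis by (simp add: algebra_simps)
qed

lemma val_bound: "valid Z e t \<Longrightarrow> \<bar>val t $ j\<bar> \<le> 2"
proof (induction t)
  case (Act i \<delta> t)
  then show ?case using convex_abs_le[OF R_bound, of "val t $ j" \<delta> i j] by simp
next
  case (Mix p t u)
  then show ?case using convex_abs_le[of "val t $ j" 2 "val u $ j" p] by simp
qed simp

lemma mass_nonneg: "valid Z e t \<Longrightarrow> 0 \<le> mass t"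
  by (induction t) auto

lemma valid_mono: "valid Z e t \<Longrightarrow> e \<le> e' \<Longrightarrow> valid Z e' t"
proof (induction t)
  case (Stop w)
  then show ?case by (auto intro: order_trans[of "- e'" "- e"])
next
  case (Act i \<delta> t)
  then have "- e' \<le> - e" by simp
  with Act show ?case by (auto simp del: val.simps intro: order_trans)
qed auto

text \<open>\<open>Mix\<close> averages value and mass with the same weights. Weights 0 and 1, which
  \<open>Mix\<close> excludes, are handled by taking one of the two plans.\<close>

lemma convex_outcomes: "convex ((\<lambda>t. (val t, mass t)) ` {t. valid Z e t})"
proof (rule convexI)
  fix x y :: "(real^'i) \<times> real" and u v :: real
  assume x: "x \<in> (\<lambda>t. (val t, mass t)) ` {t. valid Z e t}"
    and y: "y \<in> (\<lambda>t. (val t, mass t)) ` {t. valid Z e t}"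
    and uv: "0 \<le> u" "0 \<le> v" "u + v = 1"
  obtain t s where ts: "valid Z e t" "x = (val t, mass t)" "valid Z e s" "y = (val s, mass s)"
    using x y by auto
  consider "u = 0" | "v = 0" | "0 < u" "0 < v" using uv by linarith
  then show "u *\<^sub>R x + v *\<^sub>R y \<in> (\<lambda>t. (val t, mass t)) ` {t. valid Z e t}"
  proof cases
    case 1 then show ?thesis using uv y by simp
  next
    case 2 then show ?thesis using uv x by simp
  next
    case 3
    then have "valid Z e (Mix u t s)" using ts uv by simp
    moreover have "u *\<^sub>R x + v *\<^sub>R y = (val (Mix u t s), mass (Mix u t s))"
      using ts uv by (simp add: eq_diff_eq[THEN iffD2, OF uv(3)[unfolded add.commute[of u]]])
    ultimately show ?thesis by (intro image_eqI[of _ _ "Mix u t s"]) auto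
  qed
qed

lemma mix_family:
  assumes "finite S" "\<And>i. i \<in> S \<Longrightarrow> 0 \<le> \<zeta> i" "sum \<zeta> S = 1" "\<And>i. i \<in> S \<Longrightarrow> valid Z e (T i)"
  obtains t where "valid Z e t" "val t = (\<Sum>i\<in>S. \<zeta> i *\<^sub>R val (T i))"
    "mass t = (\<Sum>i\<in>S. \<zeta> i * mass (T i))"
proof -
  have "(\<Sum>i\<in>S. \<zeta> i *\<^sub>R (val (T i), mass (T i))) \<in> (\<lambda>t. (val t, mass t)) ` {t. valid Z e t}"
    using assms by (intro convex_sum convex_outcomes) auto
  moreover have "(\<Sum>i\<in>S. \<zeta> i *\<^sub>R (val (T i), mass (T i))) =
    (\<Sum>i\<in>S. \<zeta> i *\<^sub>R val (T i), \<Sum>i\<in>S. \<zeta> i * mass (T i))"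
    by (simp add: sum_prod)
  ultimately show thesis using that by auto
qed

lemma mix_two:
  assumes "0 \<le> p" "p \<le> 1" "valid Z e t" "valid Z e s"
  obtains T where "valid Z e T" "val T = p *\<^sub>R val t + (1 - p) *\<^sub>R val s"
    "mass T = p * mass t + (1 - p) * mass s"
proof -
  have "p *\<^sub>R (val t, mass t) + (1 - p) *\<^sub>R (val s, mass s) \<in> (\<lambda>t. (val t, mass t)) ` {t. valid Z e t}"
    using assms by (intro convexD[OF convex_outcomes]) auto
  then show thesis using that by auto
qed

text \<open>Asking for plans for every \<open>e\<close> makes this set closed, so that a minimum of
  the mass is attained. Only an upper bound on the mass is recorded, since small mass is the
  aim.\<close>

definition reachable :: "'i set \<Rightarrow> ((real^'i) \<times> real) set" where
  "reachable Z = {(w, a). \<forall>e>0. \<exists>t. valid Z e t \<and> (\<forall>j. \<bar>val t $ j - w $ j\<bar> \<le> e) \<and> mass t \<le> a + e}"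

lemma reachableD:
  assumes "(w, a) \<in> reachable Z" "e > 0"
  obtains t where "valid Z e t" "\<And>j. \<bar>val t $ j - w $ j\<bar> \<le> e" "mass t \<le> a + e"
  using assms unfolding reachable_def by blast

lemma reachable_bound:
  assumes "(w, a) \<in> reachable Z" shows "\<bar>w $ j\<bar> \<le> 2"
proof (rule field_le_epsilon)
  fix e :: real assume "e > 0"
  from reachableD[OF assms this] obtain t where "valid Z e t" "\<bar>val t $ j - w $ j\<bar> \<le> e" by metis
  with val_bound[of Z e t j] show "\<bar>w $ j\<bar> \<le> 2 + e" by linarith
qed

lemma reachable_mass_nonneg:
  assumes "(w, a) \<in> reachable Z" shows "0 \<le> a"
proof (rule field_le_epsilon)
  fix e :: real assume "e > 0"
  from reachableD[OF assms this] obtain t where "valid Z e t" "mass t \<le> a + e" by metis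
  with mass_nonneg[of Z e t] show "0 \<le> a + e" by linarith
qed

lemma closed_reachable: "closed (reachable Z)"
  unfolding closed_sequential_limits
proof (intro allI impI)
  fix X :: "nat \<Rightarrow> (real^'i) \<times> real" and l
  assume X: "(\<forall>n. X n \<in> reachable Z) \<and> X \<longlonglongrightarrow> l"
  obtain w a where l: "l = (w, a)" by force
  show "l \<in> reachable Z" unfolding l reachable_def
  proof (clarify)
    fix e :: real assume e: "e > 0"
    have "\<forall>\<^sub>F n in sequentially. dist (X n) l < e/2"
      using X e by (intro tendstoD) auto
    then obtain n where n: "dist (X n) l < e/2" by (auto simp: eventually_sequentially)
    obtain w' a' where X': "X n = (w', a')" by force
    have d: "dist w' w < e/2" "dist a' a < e/2"
      using n dist_fst_le[of "X n" l] dist_snd_le[of "X n" l] by (auto simp: X' l)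
    obtain t where t: "valid Z (e/2) t" "\<And>j. \<bar>val t $ j - w' $ j\<bar> \<le> e/2" "mass t \<le> a' + e/2"
      using reachableD[of w' a' Z "e/2"] X e X' by (metis half_gt_zero)
    have "\<bar>val t $ j - w $ j\<bar> \<le> e" for j
    proof -
      have "\<bar>w' $ j - w $ j\<bar> < e/2"
        using d(1) component_le_norm_cart[of "w' - w" j] by (simp add: dist_norm)
      then show ?thesis using t(2)[of j] by linarith
    qed
    moreover have "mass t \<le> a + e" using t(3) d(2) unfolding dist_real_def by linarith
    ultimately show "\<exists>t. valid Z e t \<and> (\<forall>j. \<bar>val t $ j - w $ j\<bar> \<le> e) \<and> mass t \<le> a + e"
      using valid_mono[OF t(1), of e] e by auto
  qed
qed

lemma reachable_stop:
  assumes "\<And>j. \<bar>w $ j\<bar> \<le> 2" "\<And>j. j \<in> Z \<Longrightarrow> 0 \<le> w $ j"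
  shows "(w, 1) \<in> reachable Z"
  unfolding reachable_def using assms
  by (clarify, intro exI[of _ "Stop w"]) (force simp: order_trans[of "- _" 0])

section \<open>Moves along solutions of the complementarity problem\<close>

definition lcp_value :: "real^'i \<Rightarrow> real \<Rightarrow> ('i \<Rightarrow> real) \<Rightarrow> real^'i" where
  "lcp_value q z0 z = z0 *\<^sub>R q + (\<Sum>i\<in>UNIV. z i *\<^sub>R R i)"

text \<open>The linear complementarity problem \<open>w = q + R z\<close> restricted to \<open>Z\<close>, in projective form: \<open>q\<close> and the
  columns of \<open>R\<close> receive weights with sum 1, and weight 0 for \<open>q\<close> (the homogeneous problem) is allowed.\<close>
definition lcp_solution :: "'i set \<Rightarrow> real^'i \<Rightarrow> real \<Rightarrow> ('i \<Rightarrow> real) \<Rightarrow> bool" where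
  "lcp_solution Z q z0 z \<longleftrightarrow> 0 \<le> z0 \<and> (\<forall>i. 0 \<le> z i) \<and> (\<forall>i. i \<notin> Z \<longrightarrow> z i = 0) \<and> z0 + sum z UNIV = 1 \<and>
     (\<forall>j\<in>Z. 0 \<le> lcp_value q z0 z $ j \<and> z j * lcp_value q z0 z $ j = 0)"

definition lcp_solvable :: "'i set \<Rightarrow> real^'i \<Rightarrow> bool" where
  "lcp_solvable Z q \<longleftrightarrow> (\<exists>z0 z. lcp_solution Z q z0 z)"

text \<open>The conditions are homogeneous in \<open>(z0, z)\<close>, so every nonzero solution can
  be scaled to total weight 1.\<close>

lemma lcp_solvableI:
  assumes z: "0 \<le> z0" "\<And>i. 0 \<le> z i" "\<And>i. i \<notin> Z \<Longrightarrow> z i = 0" "0 < z0 + sum z UNIV"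
    and w: "\<And>j. j \<in> Z \<Longrightarrow> 0 \<le> lcp_value q z0 z $ j" "\<And>j. j \<in> Z \<Longrightarrow> z j * lcp_value q z0 z $ j = 0"
  shows "lcp_solvable Z q"
proof -
  define T where "T = z0 + sum z UNIV"
  have T: "0 < T" using z by (simp add: T_def)
  have *: "lcp_value q (z0 / T) (\<lambda>i. z i / T) $ j = lcp_value q z0 z $ j / T" for j
    by (simp add: lcp_value_def sum_divide_distrib add_divide_distrib)
  have "z0 / T + (\<Sum>i\<in>UNIV. z i / T) = 1"
    using T by (simp add: T_def flip: sum_divide_distrib add_divide_distrib)
  then have "lcp_solution Z q (z0 / T) (\<lambda>i. z i / T)"
    unfolding lcp_solution_def * using z w T by auto
  then show ?thesis unfolding lcp_solvable_def by blast
qed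

text \<open>Staying at \<open>w\<close> while the players in the support of \<open>z\<close> quit at small rates, and jumping to
  \<open>u\<close> at a matching rate, keeps the value at \<open>w\<close>; the sunspot randomises the jump time.\<close>
lemma reachable_move:
  assumes ua: "(u, a) \<in> reachable Z" and sol: "lcp_solution Z u z0 z" and z01: "z0 < 1"
  shows "(lcp_value u z0 z, z0 * a) \<in> reachable Z"
  unfolding reachable_def
proof clarify
  fix e :: real assume e: "e > 0"
  define w where "w = lcp_value u z0 z"
  have z: "\<And>i. 0 \<le> z i" "\<And>i. i \<notin> Z \<Longrightarrow> z i = 0" "z0 + sum z UNIV = 1"
    and z0: "0 \<le> z0" "z0 < 1"
    and compl: "\<And>j. j \<in> Z \<Longrightarrow> 0 \<le> w $ j" "\<And>j. j \<in> Z \<Longrightarrow> z j * w $ j = 0"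
    using sol z01 unfolding lcp_solution_def w_def by blast+
  have w: "w = z0 *\<^sub>R u + (\<Sum>i\<in>UNIV. z i *\<^sub>R R i)" by (simp add: w_def lcp_value_def)
  \<comment> \<open>Law of the acting player: \<open>z\<close> conditioned on activity instead of
    the jump to \<open>u\<close>.\<close>
  define \<zeta> where "\<zeta> = (\<lambda>i. z i / (1 - z0))"
  define S where "S = {i. 0 < z i}"
  have zS: "z i = 0" if "i \<notin> S" for i using z(1)[of i] that by (auto simp: S_def)
  have SZ: "S \<subseteq> Z" using z(2) by (force simp: S_def)
  have sumS: "sum \<zeta> S = 1"
  proof -
    have "sum z UNIV = sum z S" by (rule sum.mono_neutral_right) (auto simp: zS)
    then show ?thesis using z(3) z0 by (simp add: \<zeta>_def flip: sum_divide_distrib)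
  qed
  have wS: "w = z0 *\<^sub>R u + (\<Sum>i\<in>S. z i *\<^sub>R R i)"
    unfolding w by (simp, rule sum.mono_neutral_right) (auto simp: zS)
  have a0: "0 \<le> a" using reachable_mass_nonneg[OF ua] .
  have wb: "\<bar>w $ j\<bar> \<le> 2" for j
  proof -
    have "\<bar>w $ j\<bar> \<le> \<bar>z0 * u $ j\<bar> + (\<Sum>i\<in>UNIV. \<bar>z i * R i $ j\<bar>)"
      unfolding w by (simp, rule order_trans[OF abs_triangle_ineq]) (simp add: sum_abs)
    also have "\<dots> \<le> z0 * 2 + (\<Sum>i\<in>UNIV. z i * 2)"
      using z z0 reachable_bound[OF ua, of j] R_bound
      by (intro add_mono sum_mono) (auto simp: abs_mult intro: mult_left_mono)
    also have "\<dots> = 2" using z(3) by (simp flip: sum_distrib_right)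
    finally show ?thesis .
  qed
  define e' where "e' = e/2"
  obtain tu where tu: "valid Z e' tu" "\<And>j. \<bar>val tu $ j - u $ j\<bar> \<le> e'" "mass tu \<le> a + e'"
    using reachableD[OF ua, of e'] e by (auto simp: e'_def)
  have tuv: "valid Z e tu" using tu(1) e by (auto simp: e'_def intro: valid_mono)
  \<comment> \<open>The errors \<open>2 * \<beta>\<close> and \<open>4 * \<beta>\<close> in
    \<open>near\<close> have to fit into \<open>e/2\<close>.\<close>
  define \<beta> where "\<beta> = min (1/2) (e/32)"
  have \<beta>: "0 < \<beta>" "\<beta> \<le> 1/2" "\<beta> \<le> e/32" using e by (auto simp: \<beta>_def)
  \<comment> \<open>With these \<open>\<delta>\<close> and \<open>\<alpha>\<close> a round ends in
    quitting with probability \<open>\<beta> * (1 - z0)\<close>, jumps to \<open>tu\<close> with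
    probability \<open>\<beta> * z0\<close> and is repeated with probability
    \<open>1 - \<beta>\<close>; the vector \<open>w\<close> is the fixed point of such a
    round.\<close>
  define \<delta> where "\<delta> = \<beta> * (1 - z0)"
  have \<delta>: "0 < \<delta>" "\<delta> \<le> \<beta>" using \<beta> z0 by (auto simp: \<delta>_def mult_le_cancel_left1)
  define \<alpha> where "\<alpha> = (1 - \<beta>) / (1 - \<delta>)"
  have \<alpha>: "0 \<le> \<alpha>" "\<alpha> \<le> 1" "(1 - \<delta>) * \<alpha> = 1 - \<beta>" "(1 - \<delta>) * (1 - \<alpha>) = \<beta> * z0"
  proof -
    show "0 \<le> \<alpha>" "\<alpha> \<le> 1" using \<beta> \<delta> by (auto simp: \<alpha>_def)
    show *: "(1 - \<delta>) * \<alpha> = 1 - \<beta>" using \<beta> \<delta> by (auto simp: \<alpha>_def)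
    have "(1 - \<delta>) * (1 - \<alpha>) = (1 - \<delta>) - (1 - \<delta>) * \<alpha>" by (simp add: algebra_simps)
    also have "\<dots> = \<beta> * z0" unfolding * by (simp add: \<delta>_def algebra_simps)
    finally show "(1 - \<delta>) * (1 - \<alpha>) = \<beta> * z0" .
  qed
  \<comment> \<open>After \<open>n\<close> rounds the loop is cut off by \<open>Stop w\<close>, at
    the price of mass \<open>(1 - \<beta>) ^ n\<close>. The error \<open>e'\<close> does not grow
    with \<open>n\<close>, because each round forms a convex combination of the error at
    \<open>t\<close> and \<open>z0\<close> times the error at \<open>tu\<close>.\<close>
  have loop: "\<exists>t. valid Z e t \<and> (\<forall>j. \<bar>val t $ j - w $ j\<bar> \<le> e') \<and> mass t \<le> z0 * mass tu + (1 - \<beta>) ^ n" for n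
  proof (induction n)
    case 0
    have "valid Z e (Stop w)" using wb compl(1) e by (auto intro: order_trans[of "- e" 0])
    then show ?case using e z0 mass_nonneg[OF tu(1)] by (intro exI[of _ "Stop w"]) (auto simp: e'_def)
  next
    case (Suc n)
    then obtain t where t: "valid Z e t" "\<And>j. \<bar>val t $ j - w $ j\<bar> \<le> e'" "mass t \<le> z0 * mass tu + (1 - \<beta>) ^ n"
      by blast
    obtain s where s: "valid Z e s" "val s = \<alpha> *\<^sub>R val t + (1 - \<alpha>) *\<^sub>R val tu"
        "mass s = \<alpha> * mass t + (1 - \<alpha>) * mass tu"
      using mix_two[OF \<alpha>(1,2) t(1) tuv] .
    have sv: "(1 - \<delta>) *\<^sub>R val s = (1 - \<beta>) *\<^sub>R val t + (\<beta> * z0) *\<^sub>R val tu"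
      by (simp only: s scaleR_right_distrib scaleR_scaleR \<alpha>)
    have sm: "(1 - \<delta>) * mass s = (1 - \<beta>) * mass t + (\<beta> * z0) * mass tu"
      by (simp only: s distrib_left mult.assoc[symmetric] \<alpha>)
    have near: "\<bar>val (Act i \<delta> s) $ j - w $ j\<bar> \<le> e" for i j
    proof -
      have "val (Act i \<delta> s) $ j - w $ j = \<delta> * R i $ j + (1 - \<beta>) * (val t $ j - w $ j) + \<beta> * (z0 * val tu $ j - w $ j)"
        by (simp only: val.simps sv) (simp add: algebra_simps)
      moreover have "\<bar>\<delta> * R i $ j\<bar> \<le> \<beta> * 2"
        using \<delta> R_bound[of i j] by (simp add: abs_mult mult_mono)
      moreover have "\<bar>(1 - \<beta>) * (val t $ j - w $ j)\<bar> \<le> 1 * e'"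
        using \<beta> t(2)[of j] unfolding abs_mult by (intro mult_mono) auto
      moreover have "\<bar>z0 * val tu $ j\<bar> \<le> 1 * 2"
        using z0 val_bound[OF tu(1), of j] unfolding abs_mult by (intro mult_mono) auto
      then have "\<bar>z0 * val tu $ j - w $ j\<bar> \<le> 4" using wb[of j] by linarith
      then have "\<bar>\<beta> * (z0 * val tu $ j - w $ j)\<bar> \<le> \<beta> * 4"
        using \<beta> unfolding abs_mult by (intro mult_mono) auto
      ultimately show ?thesis using \<beta> e unfolding e'_def by linarith
    qed
    have va: "valid Z e (Act i \<delta> s)" if "i \<in> S" for i
    proof -
      have "i \<in> Z" "w $ i = 0" using that SZ compl(2)[of i] by (auto simp: S_def)
      then have "\<bar>val (Act i \<delta> s) $ i\<bar> \<le> e" using near[of i i] by simp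
      moreover have "- e \<le> val (Act i \<delta> s) $ j" if "j \<in> Z" for j
        using near[of i j] compl(1)[OF that] by linarith
      ultimately show ?thesis using s(1) \<delta> \<beta> e \<open>i \<in> Z\<close> by auto
    qed
    obtain t' where t': "valid Z e t'" "val t' = (\<Sum>i\<in>S. \<zeta> i *\<^sub>R val (Act i \<delta> s))"
        "mass t' = (\<Sum>i\<in>S. \<zeta> i * mass (Act i \<delta> s))"
      using mix_family[of S \<zeta> Z e "\<lambda>i. Act i \<delta> s"] va sumS z(1) z0 by (auto simp: \<zeta>_def)
    have "val t' = (\<Sum>i\<in>S. (\<zeta> i * \<delta>) *\<^sub>R R i) + (1 - \<delta>) *\<^sub>R val s"
      by (simp add: t'(2) scaleR_right_distrib sum.distrib flip: scaleR_sum_left) (simp add: sumS flip: sum_distrib_right)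
    also have "(\<Sum>i\<in>S. (\<zeta> i * \<delta>) *\<^sub>R R i) = (\<Sum>i\<in>S. (\<beta> * z i) *\<^sub>R R i)"
      using z0 by (intro sum.cong) (auto simp: \<zeta>_def \<delta>_def)
    also have "\<dots> = \<beta> *\<^sub>R (w - z0 *\<^sub>R u)"
      by (simp add: wS scaleR_sum_right)
    finally have vt': "val t' = \<beta> *\<^sub>R (w - z0 *\<^sub>R u) + ((1 - \<beta>) *\<^sub>R val t + (\<beta> * z0) *\<^sub>R val tu)"
      by (simp only: sv)
    have "\<bar>val t' $ j - w $ j\<bar> \<le> e'" for j
    proof -
      have "val t' $ j - w $ j = (1 - \<beta>) * (val t $ j - w $ j) + (1 - (1 - \<beta>)) * (z0 * (val tu $ j - u $ j))"
        by (simp add: vt' algebra_simps)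
      moreover have "\<bar>z0 * (val tu $ j - u $ j)\<bar> \<le> 1 * e'"
        unfolding abs_mult using z0 tu(2)[of j] by (intro mult_mono) auto
      ultimately show ?thesis using t(2)[of j] \<beta>
        by (simp only:) (rule convex_abs_le, auto)
    qed
    moreover have "mass t' \<le> z0 * mass tu + (1 - \<beta>) ^ Suc n"
    proof -
      have "mass t' = (1 - \<beta>) * mass t + (\<beta> * z0) * mass tu"
        by (simp add: t'(3) sm flip: sum_distrib_right) (simp add: sumS)
      also have "\<dots> \<le> (1 - \<beta>) * (z0 * mass tu + (1 - \<beta>) ^ n) + (\<beta> * z0) * mass tu"
        using t(3) \<beta> by (intro add_right_mono mult_left_mono) auto
      finally show ?thesis by (simp add: algebra_simps)
    qed
    ultimately show ?case using t'(1) by blast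
  qed
  obtain n where n: "(1 - \<beta>) ^ n < e'"
    using real_arch_pow_inv[of e' "1 - \<beta>"] e \<beta> by (auto simp: e'_def)
  obtain t where t: "valid Z e t" "\<And>j. \<bar>val t $ j - w $ j\<bar> \<le> e'" "mass t \<le> z0 * mass tu + (1 - \<beta>) ^ n"
    using loop[of n] by blast
  have "z0 * mass tu \<le> z0 * a + 1 * e'"
    using mult_left_mono[OF tu(3) z0(1)] mult_right_mono[of z0 1 e'] z0 e
    unfolding distrib_left e'_def by linarith
  then have "mass t \<le> z0 * a + e" using t(3) n by (simp add: e'_def)
  moreover have "\<bar>val t $ j - w $ j\<bar> \<le> e" for j using t(2)[of j] e by (simp add: e'_def)
  ultimately show "\<exists>t. valid Z e t \<and> (\<forall>j. \<bar>val t $ j - lcp_value u z0 z $ j\<bar> \<le> e) \<and> mass t \<le> z0 * a + e"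
    using t(1) unfolding w_def by blast
qed

text \<open>Picture a hidden coin: with probability \<open>1 - \<mu>\<close> play is meant for
  \<open>u\<close>, with probability \<open>\<mu>\<close> for the plan \<open>t\<close>. Where
  \<open>t\<close>, given its lotteries, arrives without quitting with probability \<open>m\<close>,
  the two cases have weights \<open>1 - \<mu>\<close> and \<open>\<mu> * m\<close>, with sum
  \<open>D\<close>. At an end of \<open>t\<close> play goes on with \<open>tu\<close> if
  \<open>m \<le> \<kappa>\<close>. The ends with \<open>m > \<kappa>\<close> are given up with mass
  1: the mean of \<open>m\<close> over the ends is \<open>mass t\<close>, so by Markov's inequality
  they cost at most \<open>mass t / \<kappa>\<close>.\<close>

lemma graft_tree:
  assumes \<mu>: "0 < \<mu>" "\<mu> \<le> 1/2" and \<kappa>: "0 < \<kappa>" "\<kappa> \<le> 1"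
    and Z0: "Z0 \<subseteq> Z" and u0: "\<And>j. j \<in> Z0 \<Longrightarrow> u $ j = 0" and u1: "\<And>j. j \<in> Z - Z0 \<Longrightarrow> 8 * \<mu> \<le> u $ j"
    and ub: "\<And>j. \<bar>u $ j\<bar> \<le> 2"
    and tu: "valid Z e tu" "\<And>j. \<bar>val tu $ j - u $ j\<bar> \<le> e'" "mass tu \<le> c"
    and err: "err = e' + 4 * \<kappa>" "err \<le> \<mu>" "2 * (\<rho> + err) \<le> e" "0 < \<rho>" "0 \<le> c" "0 \<le> e'"
  shows "valid Z0 \<rho> t \<Longrightarrow> 0 < m \<Longrightarrow> m \<le> 1 \<Longrightarrow> \<exists>T. valid Z e T \<and>
     (\<forall>j. \<bar>(1 - \<mu> + \<mu> * m) * val T $ j - ((1 - \<mu>) * u $ j + \<mu> * m * val t $ j)\<bar> \<le> err) \<and>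
     (1 - \<mu> + \<mu> * m) * mass T \<le> (1 - \<mu> + \<mu> * \<kappa>) * c + m * mass t / \<kappa>"
proof (induction t arbitrary: m)
  case (Stop w)
  have err0: "0 \<le> err" "2 * \<rho> + 2 * err \<le> e" using err(1,3,4,6) \<kappa>(1) by simp_all
  then have e0: "0 \<le> e" using err(4) by linarith
  define D where "D = 1 - \<mu> + \<mu> * m"
  have wb: "\<bar>w $ j\<bar> \<le> 2" for j using Stop by simp
  have \<mu>m: "0 < \<mu> * m" "\<mu> * m \<le> \<mu>" using \<mu> Stop by (auto simp: mult_le_cancel_left1)
  have D: "1/2 \<le> D" "D \<le> 1" using \<mu> \<mu>m by (auto simp: D_def)
  show ?case
  proof (cases "m \<le> \<kappa>")
    case True
    have "\<bar>D * val tu $ j - ((1 - \<mu>) * u $ j + \<mu> * m * w $ j)\<bar> \<le> err" for j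
    proof -
      have "D * val tu $ j - ((1 - \<mu>) * u $ j + \<mu> * m * w $ j) =
          D * (val tu $ j - u $ j) + (\<mu> * m) * (u $ j - w $ j)" by (simp add: D_def algebra_simps)
      moreover have "\<bar>D * (val tu $ j - u $ j)\<bar> \<le> 1 * e'"
        unfolding abs_mult using tu(2)[of j] D by (intro mult_mono) auto
      moreover have "\<bar>u $ j - w $ j\<bar> \<le> 4" using ub[of j] wb[of j] by linarith
      then have "\<bar>(\<mu> * m) * (u $ j - w $ j)\<bar> \<le> (1 * \<kappa>) * 4"
        unfolding abs_mult using True \<mu> Stop by (intro mult_mono) auto
      ultimately show ?thesis unfolding err by linarith
    qed
    moreover have "D * mass tu \<le> (1 - \<mu> + \<mu> * \<kappa>) * c"
    proof -
      have "D \<le> 1 - \<mu> + \<mu> * \<kappa>" using True \<mu> by (simp add: D_def)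
      moreover have "0 \<le> 1 - \<mu> + \<mu> * \<kappa>" using calculation D by linarith
      ultimately show ?thesis using mass_nonneg[OF tu(1)] tu(3) by (intro mult_mono) auto
    qed
    moreover have "0 \<le> m * mass (Stop w) / \<kappa>" using Stop \<kappa> by simp
    ultimately have "D * mass tu \<le> (1 - \<mu> + \<mu> * \<kappa>) * c + m * mass (Stop w) / \<kappa>"
      "\<forall>j. \<bar>D * val tu $ j - ((1 - \<mu>) * u $ j + \<mu> * m * val (Stop w) $ j)\<bar> \<le> err" by (linarith, simp)
    with tu(1) show ?thesis unfolding D_def by blast
  next
    case False
    define v where "v = (1/D) *\<^sub>R ((1 - \<mu>) *\<^sub>R u + (\<mu> * m) *\<^sub>R w)"
    have Dv: "D * v $ j = (1 - \<mu>) * u $ j + \<mu> * m * w $ j" for j using D by (simp add: v_def)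
    have "\<bar>v $ j\<bar> \<le> 2" for j
    proof -
      have "\<bar>D * v $ j\<bar> \<le> \<bar>(1 - \<mu>) * u $ j\<bar> + \<bar>\<mu> * m * w $ j\<bar>" unfolding Dv by (rule abs_triangle_ineq)
      also have "\<dots> \<le> (1 - \<mu>) * 2 + \<mu> * m * 2"
        using ub[of j] wb[of j] \<mu> \<mu>m unfolding abs_mult[of "1 - \<mu>"] abs_mult[of "\<mu> * m"]
        by (intro add_mono mult_mono) auto
      finally have "D * \<bar>v $ j\<bar> \<le> D * 2" using D by (simp add: abs_mult D_def)
      then show ?thesis using D by (simp add: mult_le_cancel_left)
    qed
    moreover have "- e \<le> v $ j" if j: "j \<in> Z" for j
    proof (cases "j \<in> Z0")
      case True
      then have "D * v $ j = (\<mu> * m) * w $ j" unfolding Dv by (simp add: u0)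
      moreover have "- \<rho> \<le> w $ j" using Stop.prems(1) True by simp
      moreover have "(\<mu> * m) * (- \<rho>) \<le> (\<mu> * m) * w $ j" using \<mu>m calculation by (intro mult_left_mono) auto
      moreover have "(\<mu> * m) * \<rho> \<le> 1 * \<rho>" using \<mu> \<mu>m err by (intro mult_right_mono) auto
      ultimately have "- \<rho> \<le> D * v $ j" by linarith
      moreover have "D * e \<ge> 1/2 * e" using D err \<kappa> by (intro mult_right_mono) auto
      moreover have "\<rho> \<le> 1/2 * e" using err0 by linarith
      ultimately have "- (D * e) \<le> D * v $ j" by linarith
      then have "D * (- e) \<le> D * v $ j" by simp
      then show ?thesis by (rule mult_left_le_imp_le) (use D in simp)
    next
      case False
      then have "8 * \<mu> \<le> u $ j" using u1 j by auto
      then have "1/2 * (8 * \<mu>) \<le> (1 - \<mu>) * u $ j" using \<mu> by (intro mult_mono) auto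
      moreover have "\<bar>\<mu> * m * w $ j\<bar> \<le> \<mu> * 2"
        unfolding abs_mult[of "\<mu> * m"] using wb[of j] \<mu>m by (intro mult_mono) auto
      ultimately have "0 \<le> D * v $ j" unfolding Dv using \<mu> by linarith
      then have "0 \<le> v $ j" using D by (simp add: zero_le_mult_iff)
      then show ?thesis using e0 by linarith
    qed
    moreover have "D * 1 \<le> (1 - \<mu> + \<mu> * \<kappa>) * c + m * 1 / \<kappa>"
    proof -
      have "1 \<le> m / \<kappa>" using False \<kappa> by simp
      moreover have "0 \<le> (1 - \<mu> + \<mu> * \<kappa>) * c" using \<mu> \<kappa> err by (intro mult_nonneg_nonneg) auto
      ultimately show ?thesis using D by linarith
    qed
    ultimately have "valid Z e (Stop v)" "D * mass (Stop v) \<le> (1 - \<mu> + \<mu> * \<kappa>) * c + m * mass (Stop w) / \<kappa>"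
      "\<forall>j. \<bar>D * val (Stop v) $ j - ((1 - \<mu>) * u $ j + \<mu> * m * val (Stop w) $ j)\<bar> \<le> err"
      using Dv err0 by simp_all
    then show ?thesis unfolding D_def by blast
  qed
next
  case (Act i \<delta> t)
  have err0: "0 \<le> err" "2 * \<rho> + 2 * err \<le> e" using err(1,3,4,6) \<kappa>(1) by simp_all
  then have e0: "0 \<le> e" using err(4) by linarith
  define D where "D = 1 - \<mu> + \<mu> * m"
  have \<delta>: "0 < \<delta>" "\<delta> \<le> \<rho>" "\<delta> \<le> 1/2" and i: "i \<in> Z0" and t: "valid Z0 \<rho> t"
    using Act.prems by auto
  define m' where "m' = m * (1 - \<delta>)"
  have m': "0 < m'" "m' \<le> 1" using \<delta> Act.prems unfolding m'_def by (auto simp: mult_le_one)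
  have \<mu>m: "0 < \<mu> * m" "\<mu> * m \<le> \<mu>" using \<mu> Act.prems by (auto simp: mult_le_cancel_left1)
  have D: "1/2 \<le> D" "D \<le> 1" "\<mu> * m \<le> D" using \<mu> \<mu>m by (auto simp: D_def)
  \<comment> \<open>The actor quits with \<open>\<delta>\<close> times the posterior weight
    \<open>\<mu> * m / D\<close> of the case \<open>t\<close>.\<close>
  define \<delta>' where "\<delta>' = \<mu> * m * \<delta> / D"
  have \<delta>': "0 < \<delta>'" "\<delta>' \<le> \<delta>"
  proof -
    show "0 < \<delta>'" using \<mu>m \<delta> D by (simp add: \<delta>'_def)
    have "\<mu> * m * \<delta> \<le> \<delta> * D" using mult_left_mono[OF D(3), of \<delta>] \<delta> by (simp add: ac_simps)
    then show "\<delta>' \<le> \<delta>" using D unfolding \<delta>'_def by (subst pos_divide_le_eq) auto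
  qed
  have D\<delta>': "D * \<delta>' = \<mu> * m * \<delta>" using D by (simp add: \<delta>'_def)
  have D': "D * (1 - \<delta>') = 1 - \<mu> + \<mu> * m'"
    unfolding right_diff_distrib D\<delta>' by (simp add: D_def m'_def algebra_simps)
  obtain T where T: "valid Z e T"
    "\<And>j. \<bar>(1 - \<mu> + \<mu> * m') * val T $ j - ((1 - \<mu>) * u $ j + \<mu> * m' * val t $ j)\<bar> \<le> err"
    "(1 - \<mu> + \<mu> * m') * mass T \<le> (1 - \<mu> + \<mu> * \<kappa>) * c + m' * mass t / \<kappa>"
    using Act.IH[OF t m'] by blast
  let ?T = "Act i \<delta>' T" and ?t = "Act i \<delta> t"
  have *: "\<bar>D * val ?T $ j - ((1 - \<mu>) * u $ j + \<mu> * m * val ?t $ j)\<bar> \<le> err" for j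
  proof -
    have "D * val ?T $ j = (D * \<delta>') * R i $ j + (D * (1 - \<delta>')) * val T $ j"
      by (simp add: algebra_simps)
    then have "D * val ?T $ j - ((1 - \<mu>) * u $ j + \<mu> * m * val ?t $ j) =
       (1 - \<mu> + \<mu> * m') * val T $ j - ((1 - \<mu>) * u $ j + \<mu> * m' * val t $ j)"
      unfolding D\<delta>' D' by (simp add: m'_def algebra_simps)
    then show ?thesis using T(2)[of j] by simp
  qed
  have vt: "- \<rho> \<le> val ?t $ j" if "j \<in> Z0" for j using Act.prems that by simp
  have vtb: "\<bar>val ?t $ j\<bar> \<le> 2" for j using val_bound[OF Act.prems(1)] .
  have lower: "- e \<le> val ?T $ j" if j: "j \<in> Z" for j
  proof (cases "j \<in> Z0")
    \<comment> \<open>On \<open>Z0\<close> the vector \<open>u\<close> vanishes, so the lower bound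
      is inherited from \<open>t\<close>, up to \<open>err\<close> and a factor
      \<open>1 / D \<le> 2\<close>.\<close>
    case True
    have "(\<mu> * m) * (- \<rho>) \<le> (\<mu> * m) * val ?t $ j" using \<mu>m vt[OF True] by (intro mult_left_mono) auto
    moreover have "(\<mu> * m) * \<rho> \<le> 1 * \<rho>" using \<mu> \<mu>m err by (intro mult_right_mono) auto
    ultimately have "- \<rho> - err \<le> D * val ?T $ j" using *[of j] u0[OF True] by simp
    moreover have "D * e \<ge> 1/2 * e" using D err \<kappa> by (intro mult_right_mono) auto
    ultimately have "D * (- e) \<le> D * val ?T $ j" using err0 err(4) unfolding mult_minus_right by linarith
    then show ?thesis by (rule mult_left_le_imp_le) (use D in simp)
  next
    case False
    \<comment> \<open>This is the origin of the 8: \<open>(1 - \<mu>) * u $ j\<close> is at least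
      \<open>4 * \<mu>\<close> and outweighs the loss of at most \<open>2 * \<mu>\<close> through
      \<open>t\<close> together with the error \<open>err \<le> \<mu>\<close>.\<close>
    then have "8 * \<mu> \<le> u $ j" using u1 j by auto
    then have "1/2 * (8 * \<mu>) \<le> (1 - \<mu>) * u $ j" using \<mu> by (intro mult_mono) auto
    moreover have "\<bar>\<mu> * m * val ?t $ j\<bar> \<le> \<mu> * 2"
      unfolding abs_mult[of "\<mu> * m"] using vtb[of j] \<mu>m by (intro mult_mono) auto
    ultimately have "0 \<le> D * val ?T $ j" using \<mu> err *[of j] by linarith
    then have "0 \<le> val ?T $ j" using D by (simp add: zero_le_mult_iff)
    then show ?thesis using e0 by linarith
  qed
  have upper: "\<bar>val ?T $ i\<bar> \<le> e"
  proof -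
    have "\<bar>val ?t $ i\<bar> \<le> \<rho>" using Act.prems by simp
    then have "\<bar>\<mu> * m * val ?t $ i\<bar> \<le> 1 * \<rho>"
      unfolding abs_mult[of "\<mu> * m"] using \<mu> \<mu>m by (intro mult_mono) auto
    then have "\<bar>D * val ?T $ i\<bar> \<le> \<rho> + err" using *[of i] u0[OF i] by simp
    moreover have "1/2 * \<bar>val ?T $ i\<bar> \<le> \<bar>D * val ?T $ i\<bar>"
      unfolding abs_mult using D by (intro mult_right_mono) auto
    ultimately show ?thesis using err0 by linarith
  qed
  have \<rho>e: "\<rho> \<le> e" using err0 err(4) by linarith
  have "valid Z e ?T"
    using lower upper T(1) i Z0 \<delta> \<delta>' \<rho>e by (auto simp del: val.simps)
  moreover have "D * mass ?T \<le> (1 - \<mu> + \<mu> * \<kappa>) * c + m * mass ?t / \<kappa>"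
  proof -
    have "D * mass ?T = (D * (1 - \<delta>')) * mass T" by simp
    also have "\<dots> \<le> (1 - \<mu> + \<mu> * \<kappa>) * c + m' * mass t / \<kappa>" unfolding D' by (rule T(3))
    finally show ?thesis by (simp add: m'_def mult.assoc)
  qed
  ultimately show ?case using * unfolding D_def by blast
next
  case (Mix p t s)
  define D where "D = 1 - \<mu> + \<mu> * m"
  define K where "K = (1 - \<mu> + \<mu> * \<kappa>) * c"
  obtain T where T: "valid Z e T"
    "\<And>j. \<bar>D * val T $ j - ((1 - \<mu>) * u $ j + \<mu> * m * val t $ j)\<bar> \<le> err"
    "D * mass T \<le> K + m * mass t / \<kappa>"
    using Mix.IH(1)[OF _ Mix.prems(2,3)] Mix.prems(1) unfolding D_def K_def by auto
  obtain S where S: "valid Z e S"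
    "\<And>j. \<bar>D * val S $ j - ((1 - \<mu>) * u $ j + \<mu> * m * val s $ j)\<bar> \<le> err"
    "D * mass S \<le> K + m * mass s / \<kappa>"
    using Mix.IH(2)[OF _ Mix.prems(2,3)] Mix.prems(1) unfolding D_def K_def by auto
  have p: "0 < p" "p < 1" using Mix.prems by auto
  have "\<bar>D * val (Mix p T S) $ j - ((1 - \<mu>) * u $ j + \<mu> * m * val (Mix p t s) $ j)\<bar> \<le> err" for j
  proof -
    have "D * val (Mix p T S) $ j - ((1 - \<mu>) * u $ j + \<mu> * m * val (Mix p t s) $ j) =
      p * (D * val T $ j - ((1 - \<mu>) * u $ j + \<mu> * m * val t $ j)) +
      (1 - p) * (D * val S $ j - ((1 - \<mu>) * u $ j + \<mu> * m * val s $ j))" by (simp add: algebra_simps)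
    then show ?thesis using convex_abs_le[OF T(2)[of j] S(2)[of j], of p] p by simp
  qed
  moreover have "D * mass (Mix p T S) \<le> K + m * mass (Mix p t s) / \<kappa>"
  proof -
    have "D * mass (Mix p T S) = p * (D * mass T) + (1 - p) * (D * mass S)" by (simp add: algebra_simps)
    also have "\<dots> \<le> p * (K + m * mass t / \<kappa>) + (1 - p) * (K + m * mass s / \<kappa>)"
      using p T(3) S(3) by (intro add_mono mult_left_mono) auto
    also have "\<dots> = K + m * mass (Mix p t s) / \<kappa>"
      by (simp add: algebra_simps add_divide_distrib diff_divide_distrib)
    finally show ?thesis .
  qed
  ultimately show ?case using T(1) S(1) p unfolding D_def K_def by (intro exI[of _ "Mix p T S"]) auto
qed

text \<open>A plan for the players in \<open>Z0\<close>, scaled down by \<open>\<mu>\<close>, is run before a plan for \<open>Z\<close> whose value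
  vanishes exactly on \<open>Z0\<close>.\<close>
lemma reachable_graft:
  assumes d: "(d, 0) \<in> reachable Z0" and u: "(u, c) \<in> reachable Z"
    and Z0: "Z0 \<subseteq> Z" "\<And>j. j \<in> Z0 \<Longrightarrow> u $ j = 0" "\<And>j. j \<in> Z - Z0 \<Longrightarrow> 8 * \<mu> \<le> u $ j"
    and \<mu>: "0 < \<mu>" "\<mu> \<le> 1/2"
  shows "((1 - \<mu>) *\<^sub>R u + \<mu> *\<^sub>R d, (1 - \<mu>) * c) \<in> reachable Z"
  unfolding reachable_def
proof clarify
  fix e :: real assume e: "e > 0"
  have c0: "0 \<le> c" using reachable_mass_nonneg[OF u] .
  define \<eta> where "\<eta> = min e \<mu>"
  have \<eta>: "0 < \<eta>" "\<eta> \<le> e" "\<eta> \<le> \<mu>" using e \<mu> by (auto simp: \<eta>_def)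
  \<comment> \<open>Keeps small both \<open>4 * \<kappa>\<close>, the error from neglecting the ends
    of \<open>t\<close>, and the excess mass \<open>\<mu> * \<kappa> * c\<close>.\<close>
  define \<kappa> where "\<kappa> = min (1/2) (\<eta> / (32 * (1 + c)))"
  have \<kappa>: "0 < \<kappa>" "\<kappa> \<le> 1" "\<kappa> * (1 + c) \<le> \<eta> / 32"
  proof -
    show "0 < \<kappa>" "\<kappa> \<le> 1" using \<eta> c0 by (auto simp: \<kappa>_def)
    have "\<kappa> \<le> \<eta> / (32 * (1 + c))" by (simp add: \<kappa>_def)
    then have "\<kappa> * (32 * (1 + c)) \<le> \<eta>" using c0 by (subst (asm) pos_le_divide_eq) auto
    then show "\<kappa> * (1 + c) \<le> \<eta> / 32" by (simp add: algebra_simps)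
  qed
  have \<kappa>': "\<kappa> \<le> \<eta> / 32" "\<kappa> * c \<le> \<eta> / 32"
  proof -
    have "\<kappa> * 1 \<le> \<kappa> * (1 + c)" "\<kappa> * c \<le> \<kappa> * (1 + c)" using \<kappa>(1) c0 by (auto intro!: mult_left_mono)
    then show "\<kappa> \<le> \<eta> / 32" "\<kappa> * c \<le> \<eta> / 32" using \<kappa>(3) by linarith+
  qed
  obtain tu where tu: "valid Z (\<eta>/8) tu" "\<And>j. \<bar>val tu $ j - u $ j\<bar> \<le> \<eta>/8" "mass tu \<le> c + \<eta>/8"
    using reachableD[OF u, of "\<eta>/8"] \<eta> by auto
  \<comment> \<open>Because \<open>d\<close> is reachable with mass 0, the plan \<open>t\<close> can
    be chosen after \<open>\<kappa>\<close>, with \<open>mass t / \<kappa>\<close> at most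
    \<open>\<eta>/8\<close>.\<close>
  define \<rho> where "\<rho> = \<kappa> * \<eta> / 8"
  have \<rho>: "0 < \<rho>" "\<rho> \<le> \<eta>/8" using \<kappa> \<eta> by (auto simp: \<rho>_def mult_le_cancel_right1)
  obtain t where t: "valid Z0 \<rho> t" "\<And>j. \<bar>val t $ j - d $ j\<bar> \<le> \<rho>" "mass t \<le> \<rho>"
    using reachableD[OF d \<rho>(1)] by auto
  define err where "err = \<eta>/8 + 4 * \<kappa>"
  have err: "err \<le> \<eta>/4" using \<kappa>' by (simp add: err_def)
  have "\<exists>T. valid Z e T \<and>
     (\<forall>j. \<bar>(1 - \<mu> + \<mu> * 1) * val T $ j - ((1 - \<mu>) * u $ j + \<mu> * 1 * val t $ j)\<bar> \<le> err) \<and>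
     (1 - \<mu> + \<mu> * 1) * mass T \<le> (1 - \<mu> + \<mu> * \<kappa>) * (c + \<eta>/8) + 1 * mass t / \<kappa>"
    using valid_mono[OF tu(1), of e] tu(2,3) t(1) \<kappa> \<mu> Z0 reachable_bound[OF u] \<eta> err \<rho> c0
    by (intro graft_tree[where tu = tu and e' = "\<eta>/8" and ?Z0.0 = Z0 and \<rho> = \<rho>]) (auto simp: err_def)
  then obtain T where T: "valid Z e T" "\<And>j. \<bar>val T $ j - ((1 - \<mu>) * u $ j + \<mu> * val t $ j)\<bar> \<le> err"
     "mass T \<le> (1 - \<mu> + \<mu> * \<kappa>) * (c + \<eta>/8) + mass t / \<kappa>" by auto
  have "\<bar>val T $ j - ((1 - \<mu>) *\<^sub>R u + \<mu> *\<^sub>R d) $ j\<bar> \<le> e" for j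
  proof -
    have "\<bar>\<mu> * (val t $ j - d $ j)\<bar> \<le> 1 * \<rho>"
      unfolding abs_mult using \<mu> t(2)[of j] by (intro mult_mono) auto
    then show ?thesis using T(2)[of j] err \<rho> \<eta> unfolding right_diff_distrib by simp
  qed
  moreover have "mass T \<le> (1 - \<mu>) * c + e"
  proof -
    have "mass t / \<kappa> \<le> \<eta>/8" using t(3) \<kappa> by (simp add: \<rho>_def divide_le_eq mult.commute)
    moreover have "(1 - \<mu> + \<mu> * \<kappa>) * (\<eta>/8) \<le> 1 * (\<eta>/8)"
      using \<mu> \<kappa> \<eta> by (intro mult_right_mono) (auto simp: mult_le_cancel_left1)
    moreover have "\<mu> * (\<kappa> * c) \<le> 1 * (\<eta>/32)" using \<mu> \<kappa> \<kappa>' c0 by (intro mult_mono) auto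
    moreover have "(1 - \<mu> + \<mu> * \<kappa>) * (c + \<eta>/8) = (1 - \<mu>) * c + \<mu> * (\<kappa> * c) + (1 - \<mu> + \<mu> * \<kappa>) * (\<eta>/8)"
      by (simp add: algebra_simps)
    ultimately show ?thesis using T(3) \<eta> by linarith
  qed
  ultimately show "\<exists>t. valid Z e t \<and> (\<forall>j. \<bar>val t $ j - ((1 - \<mu>) *\<^sub>R u + \<mu> *\<^sub>R d) $ j\<bar> \<le> e) \<and> mass t \<le> (1 - \<mu>) * c + e"
    using T(1) by blast
qed

text \<open>A share \<open>1 - mass t\<close> of the value consists of columns \<open>R i\<close>,
  on which \<open>g\<close> is at least \<open>\<theta>\<close>; the promised vectors, with share
  \<open>mass t\<close>, contribute at least -2 times the l1-norm of \<open>g\<close>.\<close>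

lemma functional_lower_bound:
  assumes "\<And>i. i \<in> Z \<Longrightarrow> \<theta> \<le> g \<bullet> R i" "0 < \<theta>"
  shows "valid Z e t \<Longrightarrow> \<theta> - (\<theta> + 2 * (\<Sum>j\<in>UNIV. \<bar>g $ j\<bar>)) * mass t \<le> g \<bullet> val t"
proof (induction t)
  case (Stop w)
  have "\<bar>g \<bullet> w\<bar> \<le> (\<Sum>j\<in>UNIV. \<bar>g $ j\<bar> * \<bar>w $ j\<bar>)"
    unfolding inner_vec_def using sum_abs[of "\<lambda>j. g $ j * w $ j" UNIV] by (simp add: abs_mult)
  also have "\<dots> \<le> (\<Sum>j\<in>UNIV. \<bar>g $ j\<bar> * 2)" using Stop by (intro sum_mono mult_left_mono) auto
  finally show ?case by (simp add: sum_distrib_left mult.commute)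
next
  case (Act i \<delta> t)
  define K where "K = \<theta> + 2 * (\<Sum>j\<in>UNIV. \<bar>g $ j\<bar>)"
  have "\<delta> * \<theta> + (1 - \<delta>) * (\<theta> - K * mass t) \<le> \<delta> * (g \<bullet> R i) + (1 - \<delta>) * (g \<bullet> val t)"
    using Act assms unfolding K_def by (intro add_mono mult_left_mono) auto
  then show ?case unfolding K_def[symmetric] by (simp add: inner_right_distrib algebra_simps)
next
  case (Mix p t s)
  define K where "K = \<theta> + 2 * (\<Sum>j\<in>UNIV. \<bar>g $ j\<bar>)"
  have "p * (\<theta> - K * mass t) + (1 - p) * (\<theta> - K * mass s) \<le> p * (g \<bullet> val t) + (1 - p) * (g \<bullet> val s)"
    using Mix unfolding K_def by (intro add_mono mult_left_mono) auto
  then show ?case unfolding K_def[symmetric] by (simp add: inner_right_distrib algebra_simps)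
qed

lemma functional_reachable:
  assumes "\<And>i. i \<in> Z \<Longrightarrow> \<theta> \<le> g \<bullet> R i" "0 < \<theta>" and d: "(d, 0) \<in> reachable Z"
  shows "\<theta> \<le> g \<bullet> d"
proof (rule field_le_epsilon)
  fix \<epsilon> :: real assume \<epsilon>: "0 < \<epsilon>"
  define G where "G = (\<Sum>j\<in>UNIV. \<bar>g $ j\<bar>)"
  have G: "0 \<le> G" by (simp add: G_def sum_nonneg)
  \<comment> \<open>\<open>\<theta> + 2 * G\<close> pays for the mass and one further
    \<open>G\<close> for the distance between \<open>val t\<close> and \<open>d\<close>.\<close>
  define e where "e = \<epsilon> / (\<theta> + 3 * G)"
  have e: "0 < e" "e * (\<theta> + 3 * G) = \<epsilon>" using \<epsilon> assms(2) G by (auto simp: e_def)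
  obtain t where t: "valid Z e t" "\<And>j. \<bar>val t $ j - d $ j\<bar> \<le> e" "mass t \<le> e"
    using reachableD[OF d e(1)] by auto
  have "\<theta> - (\<theta> + 2 * G) * mass t \<le> g \<bullet> val t"
    using functional_lower_bound[OF assms(1,2) t(1)] unfolding G_def .
  moreover have "(\<theta> + 2 * G) * mass t \<le> (\<theta> + 2 * G) * e" using t(3) G assms(2) by (intro mult_left_mono) auto
  moreover have "g \<bullet> (val t - d) \<le> G * e"
  proof -
    have "g \<bullet> (val t - d) \<le> (\<Sum>j\<in>UNIV. \<bar>g $ j\<bar> * \<bar>val t $ j - d $ j\<bar>)"
      unfolding inner_vec_def by (intro sum_mono) (auto simp: abs_mult[symmetric])
    also have "\<dots> \<le> (\<Sum>j\<in>UNIV. \<bar>g $ j\<bar> * e)" using t(2) by (intro sum_mono mult_left_mono) auto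
    finally show ?thesis by (simp add: G_def sum_distrib_right)
  qed
  ultimately show "\<theta> \<le> g \<bullet> d + \<epsilon>" using e(2) by (simp add: inner_diff_right algebra_simps)
qed

text \<open>Solutions for points near \<open>u\<close> that differ from \<open>u\<close> only on its zero set: if no nontrivial move from \<open>u\<close>
  survives in the limit, then all activity concentrates on the zero set.\<close>
lemma move_or_local:
  fixes u x :: "real^'i"
  assumes solv: "\<And>q. lcp_solvable Z q"
    and nomove: "\<not> (\<exists>z0 z. lcp_solution Z u z0 z \<and> z0 < 1)"
    and Z0: "Z0 = {j\<in>Z. u $ j = 0}" and u: "\<And>j. j \<in> Z \<Longrightarrow> 0 \<le> u $ j"
  shows "lcp_solvable Z0 x"
proof -
  define q where "q n = u + (1 / real (Suc n)) *\<^sub>R (\<chi> j. if j \<in> Z0 then x $ j else 0)" for n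
  have "\<forall>n. \<exists>p :: real \<times> (real^'i). lcp_solution Z (q n) (fst p) (\<lambda>i. snd p $ i)"
  proof
    fix n
    obtain z0 z where *: "lcp_solution Z (q n) z0 z" using solv unfolding lcp_solvable_def by blast
    show "\<exists>p :: real \<times> (real^'i). lcp_solution Z (q n) (fst p) (\<lambda>i. snd p $ i)"
      by (rule exI[of _ "(z0, \<chi> i. z i)"]) (use * in simp)
  qed
  then obtain p :: "nat \<Rightarrow> real \<times> (real^'i)" where P: "\<forall>n. lcp_solution Z (q n) (fst (p n)) (\<lambda>i. snd (p n) $ i)"
    by (rule exE[OF choice])
  have p:
     "\<And>n. 0 \<le> fst (p n)" "\<And>n i. 0 \<le> snd (p n) $ i" "\<And>n i. i \<notin> Z \<Longrightarrow> snd (p n) $ i = 0"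
     "\<And>n. fst (p n) + (\<Sum>i\<in>UNIV. snd (p n) $ i) = 1"
     "\<And>n j. j \<in> Z \<Longrightarrow> 0 \<le> (fst (p n) *\<^sub>R q n + (\<Sum>i\<in>UNIV. snd (p n) $ i *\<^sub>R R i)) $ j"
     "\<And>n j. j \<in> Z \<Longrightarrow> snd (p n) $ j * (fst (p n) *\<^sub>R q n + (\<Sum>i\<in>UNIV. snd (p n) $ i *\<^sub>R R i)) $ j = 0"
    using P unfolding lcp_solution_def lcp_value_def by blast+
  have p1: "fst (p n) \<le> 1" "snd (p n) $ i \<le> 1" for n i
  proof -
    have s: "snd (p n) $ i \<le> (\<Sum>i\<in>UNIV. snd (p n) $ i)" using p(2) by (intro member_le_sum) auto
    have s0: "0 \<le> (\<Sum>i\<in>UNIV. snd (p n) $ i)" using p(2) by (intro sum_nonneg) auto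
    show "fst (p n) \<le> 1" "snd (p n) $ i \<le> 1" using s s0 p(1)[of n] p(4)[of n] by linarith+
  qed
  have "bounded (range p)"
  proof (rule bounded_subset)
    show "bounded ({0..1::real} \<times> cbox 0 (1::real^'i))" by (intro bounded_Times) auto
    show "range p \<subseteq> {0..1::real} \<times> cbox 0 (1::real^'i)"
    proof (rule image_subsetI)
      fix n show "p n \<in> {0..1::real} \<times> cbox 0 (1::real^'i)"
        using p(1,2)[of n] p1[of n] by (simp add: mem_box_cart mem_Times_iff)
    qed
  qed
  then obtain l r where r: "strict_mono (r :: nat \<Rightarrow> nat)" and lim: "(p \<circ> r) \<longlonglongrightarrow> l"
    using bounded_imp_convergent_subsequence[of p] by blast
  obtain z0 z where l: "l = (z0, z)" by force
  have lz0: "(\<lambda>n. fst (p (r n))) \<longlonglongrightarrow> z0" using tendsto_fst[OF lim] by (simp add: l o_def)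
  have lz: "(\<lambda>n. snd (p (r n)) $ i) \<longlonglongrightarrow> z $ i" for i
    using tendsto_vec_nth[OF tendsto_snd[OF lim]] by (simp add: l o_def)
  have "(\<lambda>n. 1 / real (Suc n)) \<longlonglongrightarrow> 0" by (rule LIMSEQ_Suc[OF lim_1_over_n])
  then have "(\<lambda>n. 1 / real (Suc (r n))) \<longlonglongrightarrow> 0" using LIMSEQ_subseq_LIMSEQ[OF _ r] by (simp add: o_def)
  then have lq: "(\<lambda>n. q (r n) $ j) \<longlonglongrightarrow> u $ j" for j
  proof -
    have "(\<lambda>n. u $ j + 1 / real (Suc (r n)) * (if j \<in> Z0 then x $ j else 0)) \<longlonglongrightarrow> u $ j + 0 * (if j \<in> Z0 then x $ j else 0)"
      by (intro tendsto_intros \<open>(\<lambda>n. 1 / real (Suc (r n))) \<longlonglongrightarrow> 0\<close>)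
    then show ?thesis by (simp add: q_def cong: if_cong)
  qed
  define W where "W n = fst (p n) *\<^sub>R q n + (\<Sum>i\<in>UNIV. snd (p n) $ i *\<^sub>R R i)" for n
  have lW: "(\<lambda>n. W (r n) $ j) \<longlonglongrightarrow> (z0 *\<^sub>R u + (\<Sum>i\<in>UNIV. z $ i *\<^sub>R R i)) $ j" for j
    unfolding W_def by (simp, intro tendsto_intros lz0 lz lq)
  have l1: "0 \<le> z0" by (rule LIMSEQ_le_const[OF lz0]) (use p(1) in auto)
  have l2: "0 \<le> z $ i" for i by (rule LIMSEQ_le_const[OF lz]) (use p(2) in auto)
  have l3: "z $ i = 0" if "i \<notin> Z" for i
    using LIMSEQ_unique[OF lz[of i]] p(3)[OF that] by simp
  have l4: "z0 + (\<Sum>i\<in>UNIV. z $ i) = 1"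
  proof -
    have "(\<lambda>n. fst (p (r n)) + (\<Sum>i\<in>UNIV. snd (p (r n)) $ i)) \<longlonglongrightarrow> z0 + (\<Sum>i\<in>UNIV. z $ i)"
      by (intro tendsto_intros lz0 lz)
    then show ?thesis using p(4) LIMSEQ_unique[OF _ tendsto_const] by simp
  qed
  have l5: "0 \<le> (z0 *\<^sub>R u + (\<Sum>i\<in>UNIV. z $ i *\<^sub>R R i)) $ j" if "j \<in> Z" for j
    by (rule LIMSEQ_le_const[OF lW]) (use p(5)[OF that] in \<open>auto simp: W_def\<close>)
  have l6: "z $ j * (z0 *\<^sub>R u + (\<Sum>i\<in>UNIV. z $ i *\<^sub>R R i)) $ j = 0" if "j \<in> Z" for j
  proof -
    have "(\<lambda>n. snd (p (r n)) $ j * W (r n) $ j) = (\<lambda>_. 0)"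
      using p(6)[OF that] unfolding W_def by (intro ext)
    then have "(\<lambda>n. snd (p (r n)) $ j * W (r n) $ j) \<longlonglongrightarrow> 0" by (metis tendsto_const)
    then show ?thesis using LIMSEQ_unique[OF tendsto_mult[OF lz[of j] lW[of j]], of 0] by simp
  qed
  have "lcp_solution Z u z0 (\<lambda>i. z $ i)" unfolding lcp_solution_def lcp_value_def using l1 l2 l3 l4 l5 l6 by blast
  \<comment> \<open>The limit solves the problem for \<open>u\<close>; in the absence of a move it
    must put all its weight on \<open>u\<close>.\<close>
  then have "\<not> z0 < 1" using nomove by blast
  moreover have "0 \<le> (\<Sum>i\<in>UNIV. z $ i)" using l2 by (intro sum_nonneg) auto
  ultimately have z01: "z0 = 1" "(\<Sum>i\<in>UNIV. z $ i) = 0" using l4 by linarith+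
  then have zz: "z $ i = 0" for i using l2 by (simp add: sum_nonneg_eq_0_iff)
  \<comment> \<open>Off \<open>Z0\<close> the limit of \<open>W\<close> is \<open>u $ j > 0\<close>,
    so complementarity eventually switches player \<open>j\<close> off.\<close>
  have ev: "\<forall>\<^sub>F n in sequentially. \<forall>j\<in>Z - Z0. snd (p (r n)) $ j = 0"
  proof (rule eventually_ball_finite)
    show "\<forall>j\<in>Z - Z0. \<forall>\<^sub>F n in sequentially. snd (p (r n)) $ j = 0"
    proof
      fix j assume j: "j \<in> Z - Z0"
      then have "0 < u $ j" using u[of j] Z0 by force
      moreover have "(z0 *\<^sub>R u + (\<Sum>i\<in>UNIV. z $ i *\<^sub>R R i)) $ j = u $ j" by (simp add: z01 zz)
      ultimately have "\<forall>\<^sub>F n in sequentially. 0 < W (r n) $ j" using order_tendstoD(1)[OF lW[of j]] by simp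
      then show "\<forall>\<^sub>F n in sequentially. snd (p (r n)) $ j = 0"
      proof eventually_elim
        case (elim n)
        then show ?case using p(6)[of j "r n"] j by (auto simp: W_def)
      qed
    qed
  qed simp
  moreover have "\<forall>\<^sub>F n in sequentially. 0 < fst (p (r n))"
    using order_tendstoD(1)[OF lz0, of 0] z01 by simp
  ultimately have "\<forall>\<^sub>F n in sequentially. (\<forall>j\<in>Z - Z0. snd (p (r n)) $ j = 0) \<and> 0 < fst (p (r n))"
    by (rule eventually_conj)
  then obtain n where n: "\<And>j. j \<in> Z - Z0 \<Longrightarrow> snd (p (r n)) $ j = 0" "0 < fst (p (r n))"
    by (auto simp: eventually_sequentially)
  \<comment> \<open>On \<open>Z0\<close>, where \<open>u\<close> vanishes, \<open>q (r n)\<close> is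
    \<open>x\<close> divided by \<open>Suc (r n)\<close>; this factor goes into the weight of
    \<open>x\<close>.\<close>
  define \<zeta>0 where "\<zeta>0 = fst (p (r n)) / real (Suc (r n))"
  define \<zeta> where "\<zeta> i = snd (p (r n)) $ i" for i
  have \<zeta>: "0 < \<zeta>0" "\<And>i. 0 \<le> \<zeta> i" "\<And>i. i \<notin> Z0 \<Longrightarrow> \<zeta> i = 0"
  proof -
    show "0 < \<zeta>0" using n(2) by (simp add: \<zeta>0_def)
    show "0 \<le> \<zeta> i" for i using p(2) by (simp add: \<zeta>_def)
    show "\<zeta> i = 0" if "i \<notin> Z0" for i
      using n(1)[of i] p(3)[of i "r n"] that by (cases "i \<in> Z") (auto simp: \<zeta>_def)
  qed
  have eq: "lcp_value x \<zeta>0 \<zeta> $ j = W (r n) $ j" if "j \<in> Z0" for j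
    using that Z0 by (simp add: lcp_value_def W_def q_def \<zeta>0_def \<zeta>_def)
  show ?thesis
  proof (rule lcp_solvableI[OF less_imp_le[OF \<zeta>(1)] \<zeta>(2,3)])
    show "0 < \<zeta>0 + sum \<zeta> UNIV" using \<zeta> by (simp add: sum_nonneg add_pos_nonneg)
    fix j assume j: "j \<in> Z0"
    show "0 \<le> lcp_value x \<zeta>0 \<zeta> $ j" unfolding eq[OF j] using p(5)[of j "r n"] j Z0 by (auto simp: W_def)
    show "\<zeta> j * lcp_value x \<zeta>0 \<zeta> $ j = 0"
      unfolding eq[OF j] using p(6)[of j "r n"] j Z0 by (auto simp: W_def \<zeta>_def)
  qed
qed

section \<open>Minimal mass and induction on the set of players\<close>

lemma val_lower: "valid Z e t \<Longrightarrow> j \<in> Z \<Longrightarrow> - e \<le> val t $ j"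
proof (induction t)
  case (Mix p t s)
  then have "p * (- e) + (1 - p) * (- e) \<le> p * val t $ j + (1 - p) * val s $ j"
    by (intro add_mono mult_left_mono) auto
  then show ?case by (simp add: algebra_simps)
qed simp_all

lemma reachable_nonneg:
  assumes "(w, a) \<in> reachable Z" "j \<in> Z" shows "0 \<le> w $ j"
proof (rule field_le_epsilon)
  fix e :: real assume "e > 0"
  then have "e/2 > 0" by simp
  from reachableD[OF assms(1) this] obtain t where "valid Z (e/2) t" "\<bar>val t $ j - w $ j\<bar> \<le> e/2" by metis
  with val_lower[OF this(1) assms(2)] show "0 \<le> w $ j + e" by linarith
qed

text \<open>The claim about a zero coordinate serves the induction: when the plan for
  \<open>Z0\<close> is run before \<open>u\<close>, the common zero of \<open>d\<close> and
  \<open>u\<close> survives, so the new vector again has a nonempty zero set.\<close>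

lemma reachable_zero_mass:
  assumes "Z \<noteq> {}" "\<And>q. lcp_solvable Z q"
  shows "\<exists>d. (d, 0) \<in> reachable Z \<and> (\<exists>i\<in>Z. d $ i = 0)"
proof -
  have "finite Z" by simp
  then show ?thesis using assms
  proof (induction Z rule: finite_psubset_induct)
    case (psubset Z)
    define P :: "real^'i \<Rightarrow> real^'i" where "P v = (\<chi> j. if j \<in> Z then v $ j else 0)" for v
    define C where "C = {\<Sum>i\<in>UNIV. z i *\<^sub>R P (R i) |z. (\<forall>i. 0 \<le> z i) \<and> (\<forall>i. i \<notin> Z \<longrightarrow> z i = 0) \<and> sum z UNIV = 1}"
    show ?case
    \<comment> \<open>If 0 is a convex combination of the projected columns, its coefficients solve
      the problem with \<open>z0 = 0\<close>, and the resulting move leaves no mass.\<close>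
    proof (cases "0 \<in> C")
      case True
      then obtain z where z: "\<And>i. 0 \<le> z i" "\<And>i. i \<notin> Z \<Longrightarrow> z i = 0" "sum z UNIV = 1"
        "(\<Sum>i\<in>UNIV. z i *\<^sub>R P (R i)) = 0" by (auto simp: C_def)
      define w where "w = (\<Sum>i\<in>UNIV. z i *\<^sub>R R i)"
      have w: "w $ j = 0" if "j \<in> Z" for j
        using arg_cong[OF z(4), of "\<lambda>v. v $ j"] that by (simp add: w_def P_def)
      have "(0, 1) \<in> reachable Z" by (rule reachable_stop) auto
      moreover have lw: "lcp_value 0 0 z = w" by (simp add: lcp_value_def w_def)
      then have "lcp_solution Z 0 0 z" unfolding lcp_solution_def using z w by auto
      ultimately have "(w, 0 * 1) \<in> reachable Z" using reachable_move[of 0 1 Z 0 z] lw by simp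
      then show ?thesis using w psubset.prems(1) by auto
    next
      case False
      have "convex C"
      proof (rule convexI)
        fix x y :: "real^'i" and p q :: real
        assume x: "x \<in> C" and y: "y \<in> C" and pq: "0 \<le> p" "0 \<le> q" "p + q = 1"
        obtain z where z: "\<And>i. 0 \<le> z i" "\<And>i. i \<notin> Z \<Longrightarrow> z i = 0" "sum z UNIV = 1"
          "x = (\<Sum>i\<in>UNIV. z i *\<^sub>R P (R i))" using x by (auto simp: C_def)
        obtain z' where z': "\<And>i. 0 \<le> z' i" "\<And>i. i \<notin> Z \<Longrightarrow> z' i = 0" "sum z' UNIV = 1"
          "y = (\<Sum>i\<in>UNIV. z' i *\<^sub>R P (R i))" using y by (auto simp: C_def)
        have "p *\<^sub>R x + q *\<^sub>R y = (\<Sum>i\<in>UNIV. (p * z i + q * z' i) *\<^sub>R P (R i))"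
          by (simp add: z z' scaleR_sum_right sum.distrib scaleR_left_distrib)
        moreover have "(\<Sum>i\<in>UNIV. p * z i + q * z' i) = 1"
          using z(3) z'(3) pq by (simp add: sum.distrib flip: sum_distrib_left)
        ultimately show "p *\<^sub>R x + q *\<^sub>R y \<in> C"
          unfolding C_def using z z' pq by (intro CollectI exI[of _ "\<lambda>i. p * z i + q * z' i"]) auto
      qed
      moreover have "(\<lambda>i. P (R i)) ` Z \<subseteq> C"
      proof (rule image_subsetI)
        fix i assume i: "i \<in> Z"
        have "P (R i) = (\<Sum>k\<in>UNIV. (if k = i then 1 else 0) *\<^sub>R P (R k))"
          by (simp add: if_distrib[of "\<lambda>c. c *\<^sub>R _"] cong: if_cong)
        then show "P (R i) \<in> C"
          unfolding C_def using i by (intro CollectI exI[of _ "\<lambda>k. if k = i then 1 else 0"]) auto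
      qed
      ultimately have "convex hull ((\<lambda>i. P (R i)) ` Z) \<subseteq> C" by (simp add: hull_minimal)
      then have "0 \<notin> convex hull ((\<lambda>i. P (R i)) ` Z)" using False by auto
      moreover have "closed (convex hull ((\<lambda>i. P (R i)) ` Z))"
        by (intro compact_imp_closed finite_imp_compact_convex_hull) auto
      ultimately obtain a b where ab: "0 < b" "\<And>x. x \<in> convex hull ((\<lambda>i. P (R i)) ` Z) \<Longrightarrow> b < a \<bullet> x"
        using separating_hyperplane_closed_0[OF convex_convex_hull] by metis
      define g where "g = P a"
      have g0: "g $ j = 0" if "j \<notin> Z" for j using that by (simp add: g_def P_def)
      have gR: "b \<le> g \<bullet> R i" if "i \<in> Z" for i
      proof -
        have "g \<bullet> R i = a \<bullet> P (R i)"
          unfolding inner_vec_def g_def P_def by (intro sum.cong) auto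
        moreover have "P (R i) \<in> convex hull ((\<lambda>i. P (R i)) ` Z)" using that by (intro hull_inc) auto
        ultimately show ?thesis using ab(2) by force
      qed
      have g_sum: "b * sum z UNIV \<le> g \<bullet> (\<Sum>i\<in>UNIV. z i *\<^sub>R R i)"
        if "\<And>i. 0 \<le> z i" "\<And>i. i \<notin> Z \<Longrightarrow> z i = 0" for z
      proof -
        have "b * sum z UNIV = (\<Sum>i\<in>UNIV. z i * b)" by (simp add: sum_distrib_left mult.commute)
        also have "\<dots> \<le> (\<Sum>i\<in>UNIV. z i * (g \<bullet> R i))"
        proof (rule sum_mono)
          fix i show "z i * b \<le> z i * (g \<bullet> R i)"
            using that gR[of i] by (cases "i \<in> Z") (auto intro: mult_left_mono)
        qed
        finally show ?thesis by (simp add: inner_sum_right)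
      qed
      \<comment> \<open>The solution for the vector with all entries -1 contains a combination of
        columns that is nonnegative on \<open>Z\<close> and on which \<open>g\<close> is positive.
        So \<open>g\<close> has a positive entry, which provides the starting point
        \<open>axis k 1\<close> in the half-space.\<close>
      obtain k where k: "k \<in> Z" "0 < g $ k"
      proof -
        obtain z0 z where z: "0 \<le> z0" "\<And>i. 0 \<le> z i" "\<And>i. i \<notin> Z \<Longrightarrow> z i = 0" "z0 + sum z UNIV = 1"
         "\<And>j. j \<in> Z \<Longrightarrow> 0 \<le> (z0 *\<^sub>R (\<chi> j. -1) + (\<Sum>i\<in>UNIV. z i *\<^sub>R R i)) $ j"
          using psubset.prems(2)[of "\<chi> j. -1"] unfolding lcp_solvable_def lcp_solution_def lcp_value_def by blast
        have w: "0 \<le> (\<Sum>i\<in>UNIV. z i *\<^sub>R R i) $ j" if "j \<in> Z" for j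
          using z(5)[OF that] z(1) by simp
        have "sum z UNIV \<noteq> 0"
        proof
          assume s: "sum z UNIV = 0"
          then have "z i = 0" for i using z(2) by (simp add: sum_nonneg_eq_0_iff)
          moreover obtain j where "j \<in> Z" using psubset.prems(1) by blast
          ultimately show False using z(4) z(5)[of j] s by simp
        qed
        then have "0 < b * sum z UNIV" using z(2) ab(1) by (simp add: sum_nonneg order_less_le)
        then have "0 < g \<bullet> (\<Sum>i\<in>UNIV. z i *\<^sub>R R i)" using g_sum[of z, OF z(2,3)] by linarith
        then have "\<exists>k. 0 < g $ k * (\<Sum>i\<in>UNIV. z i *\<^sub>R R i) $ k"
          unfolding inner_vec_def by (metis (no_types, lifting) inner_real_def not_less sum_nonpos)
        then obtain k where k: "0 < g $ k * (\<Sum>i\<in>UNIV. z i *\<^sub>R R i) $ k" by blast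
        then have "k \<in> Z" using g0[of k] by force
        moreover have "0 < g $ k" using k w[OF \<open>k \<in> Z\<close>] by (simp add: zero_less_mult_iff)
        ultimately show thesis using that by blast
      qed
      \<comment> \<open>A second index gives \<open>axis k 1\<close> a zero in \<open>Z\<close>. It
        exists because the zero diagonal rules out \<open>Z = {k}\<close>.\<close>
      obtain i0 where i0: "i0 \<in> Z" "i0 \<noteq> k"
      proof -
        have "Z \<noteq> {k}"
        proof
          assume "Z = {k}"
          have "g \<bullet> R k = 0"
            unfolding inner_vec_def
          proof (intro sum.neutral ballI)
            fix j show "g $ j \<bullet> R k $ j = 0"
              using g0[of j] R_diag[of k] \<open>Z = {k}\<close> by (cases "j = k") auto
          qed
          then show False using gR[OF k(1)] ab(1) by simp
        qed
        then show thesis using that k(1) by blast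
      qed
      define \<theta> where "\<theta> = min b (g $ k)"
      have \<theta>: "0 < \<theta>" "\<theta> \<le> b" "\<theta> \<le> g $ k" using ab(1) k(2) by (auto simp: \<theta>_def)
      \<comment> \<open>The half-space keeps \<open>u\<close> from vanishing on all of
        \<open>Z\<close>, and the zero coordinate makes its zero set nonempty: both are used to
        apply the induction hypothesis to this zero set.\<close>
      define B where "B = reachable Z \<inter> {p. \<theta> \<le> g \<bullet> fst p} \<inter> {p. snd p \<le> 1} \<inter> (\<Union>i\<in>Z. {p. fst p $ i = 0})"
      have B_iff: "(w, c) \<in> B \<longleftrightarrow> (w, c) \<in> reachable Z \<and> \<theta> \<le> g \<bullet> w \<and> c \<le> 1 \<and> (\<exists>i\<in>Z. w $ i = 0)" for w c
        by (auto simp: B_def)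
      have "closed B"
        unfolding B_def
        by (intro closed_Int closed_reachable closed_UN ballI closed_Collect_le closed_Collect_eq
            continuous_on_component continuous_intros) auto
      moreover have "bounded B"
      proof (rule bounded_subset)
        show "bounded (cbox (\<chi> j. -2) (\<chi> j. 2) \<times> {0..1} :: ((real^'i) \<times> real) set)" by (intro bounded_Times) auto
        show "B \<subseteq> cbox (\<chi> j. -2) (\<chi> j. 2) \<times> {0..1}"
        proof (clarify, intro conjI)
          fix w c assume "(w, c) \<in> B"
          then have *: "(w, c) \<in> reachable Z" "c \<le> 1" by (auto simp: B_iff)
          show "w \<in> cbox (\<chi> j. -2) (\<chi> j. 2)"
            using reachable_bound[OF *(1)] by (simp add: mem_box_cart abs_le_iff) (metis minus_le_iff)
          show "c \<in> {0..1}" using reachable_mass_nonneg[OF *(1)] * by simp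
        qed
      qed
      ultimately have "compact B" by (simp add: compact_eq_bounded_closed)
      moreover have "(axis k 1, 1) \<in> B"
      proof -
        have "(axis k 1, 1) \<in> reachable Z" by (rule reachable_stop) (auto simp: axis_def)
        moreover have "g \<bullet> axis k 1 = g $ k" by (simp add: inner_axis)
        moreover have "axis k (1::real) $ i0 = 0" using i0 by (simp add: axis_def)
        ultimately show ?thesis using i0 \<theta> by (auto simp: B_iff)
      qed
      then have "B \<noteq> {}" by blast
      ultimately obtain p where p: "p \<in> B" "\<And>p'. p' \<in> B \<Longrightarrow> snd p \<le> snd p'"
        using continuous_attains_inf[of B snd] continuous_on_snd[OF continuous_on_id] by blast
      obtain u c where uc: "p = (u, c)" by force
      have u: "(u, c) \<in> reachable Z" "\<theta> \<le> g \<bullet> u" "c \<le> 1" "\<exists>i\<in>Z. u $ i = 0" using p(1) by (auto simp: uc B_iff)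
      have c0: "0 \<le> c" using reachable_mass_nonneg[OF u(1)] .
      have "c = 0"
      proof (rule ccontr)
        assume "c \<noteq> 0"
        then have c: "0 < c" using c0 by simp
        show False
        proof (cases "\<exists>z0 z. lcp_solution Z u z0 z \<and> z0 < 1")
          case True
          then obtain z0 z where sol: "lcp_solution Z u z0 z" and z01: "z0 < 1" by blast
          define w where "w = lcp_value u z0 z"
          have z: "0 \<le> z0" "z0 < 1" "\<And>i. 0 \<le> z i" "\<And>i. i \<notin> Z \<Longrightarrow> z i = 0" "z0 + sum z UNIV = 1"
            "\<And>j. j \<in> Z \<Longrightarrow> z j * w $ j = 0" using sol z01 unfolding lcp_solution_def w_def by blast+
          have w: "(w, z0 * c) \<in> reachable Z" unfolding w_def by (rule reachable_move[OF u(1) sol z01])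
          \<comment> \<open>The half-space contains \<open>u\<close> and the columns, hence also
            their convex combination \<open>w\<close>.\<close>
          have "\<theta> \<le> g \<bullet> w"
          proof -
            have "z0 * \<theta> + b * sum z UNIV \<le> g \<bullet> w"
              using g_sum[of z, OF z(3,4)] mult_left_mono[OF u(2) z(1)] by (simp add: w_def lcp_value_def inner_right_distrib)
            moreover have "\<theta> * sum z UNIV \<le> b * sum z UNIV" using \<theta> z(3) by (intro mult_right_mono sum_nonneg) auto
            moreover have "z0 * \<theta> + \<theta> * sum z UNIV = \<theta>" using z(5) by (metis distrib_left mult.commute mult.right_neutral)
            ultimately show ?thesis by linarith
          qed
          moreover have "\<exists>i\<in>Z. w $ i = 0"
          proof -
            have "\<exists>i. z i \<noteq> 0" using z(2,5) by (metis add.right_neutral order_less_irrefl sum.neutral)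
            then obtain i where "z i \<noteq> 0" by blast
            then show ?thesis using z(4)[of i] z(6)[of i] by auto
          qed
          moreover have "z0 * c \<le> 1 * 1" using z(1,2) u(3) c by (intro mult_mono) auto
          ultimately have "(w, z0 * c) \<in> B" using w by (simp add: B_iff)
          then have "c \<le> z0 * c" using p(2) uc by force
          then show False using c z(2) by simp
        next
          case nomove: False
          define Z0 where "Z0 = {j\<in>Z. u $ j = 0}"
          have "lcp_solvable Z0 x" for x
            by (rule move_or_local[OF psubset.prems(2) nomove Z0_def]) (use reachable_nonneg[OF u(1)] in auto)
          moreover have "Z0 \<noteq> {}" using u(4) by (auto simp: Z0_def)
          moreover have "Z0 \<subset> Z"
          proof -
            have "Z0 \<noteq> Z"
            proof
              assume *: "Z0 = Z"
              have "g \<bullet> u = 0"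
                unfolding inner_vec_def
              proof (intro sum.neutral ballI)
                fix j show "g $ j \<bullet> u $ j = 0" using g0[of j] * by (cases "j \<in> Z") (auto simp: Z0_def)
              qed
              then show False using u(2) \<theta> by simp
            qed
            then show ?thesis by (auto simp: Z0_def)
          qed
          ultimately obtain d i where d: "(d, 0) \<in> reachable Z0" "i \<in> Z0" "d $ i = 0"
            using psubset.IH by blast
          \<comment> \<open>\<open>8 * \<mu>\<close> is at most every positive coordinate of
            \<open>u\<close> in \<open>Z\<close>, as grafting demands.\<close>
          define \<mu> where "\<mu> = Min (insert (1/2) ((\<lambda>j. u $ j / 8) ` (Z - Z0)))"
          have \<mu>: "0 < \<mu>" "\<mu> \<le> 1/2" "\<And>j. j \<in> Z - Z0 \<Longrightarrow> 8 * \<mu> \<le> u $ j"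
          proof -
            have "0 < u $ j" if "j \<in> Z - Z0" for j
              using that reachable_nonneg[OF u(1), of j] by (force simp: Z0_def)
            then show "0 < \<mu>" by (auto simp: \<mu>_def)
            show "\<mu> \<le> 1/2" unfolding \<mu>_def by (intro Min_le) auto
            fix j assume "j \<in> Z - Z0"
            then have "\<mu> \<le> u $ j / 8" unfolding \<mu>_def by (intro Min_le) auto
            then show "8 * \<mu> \<le> u $ j" by simp
          qed
          have "((1 - \<mu>) *\<^sub>R u + \<mu> *\<^sub>R d, (1 - \<mu>) * c) \<in> reachable Z"
            by (rule reachable_graft[OF d(1) u(1)]) (use \<mu> in \<open>auto simp: Z0_def\<close>)
          moreover have "\<theta> \<le> g \<bullet> d"
            using functional_reachable[OF _ ab(1) d(1), of g] gR \<theta> by (force simp: Z0_def)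
          then have "(1 - \<mu>) * \<theta> + \<mu> * \<theta> \<le> g \<bullet> ((1 - \<mu>) *\<^sub>R u + \<mu> *\<^sub>R d)"
            unfolding inner_right_distrib inner_scaleR_right using u(2) \<mu> by (intro add_mono mult_left_mono) auto
          then have "\<theta> \<le> g \<bullet> ((1 - \<mu>) *\<^sub>R u + \<mu> *\<^sub>R d)" by (simp add: algebra_simps)
          moreover have "(1 - \<mu>) * c \<le> 1 * 1" using \<mu> c u(3) by (intro mult_mono) auto
          moreover have "((1 - \<mu>) *\<^sub>R u + \<mu> *\<^sub>R d) $ i = 0" "i \<in> Z" using d by (auto simp: Z0_def)
          ultimately have "((1 - \<mu>) *\<^sub>R u + \<mu> *\<^sub>R d, (1 - \<mu>) * c) \<in> B" by (auto simp: B_iff)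
          then have "c \<le> (1 - \<mu>) * c" using p(2) uc by force
          then show False using c \<mu>(1) by simp
        qed
      qed
      then show ?thesis using u by auto
    qed
  qed
qed

end

section \<open>Public signals\<close>

lemma space_unif01: "space unif01 = {0..1}"
  by (simp add: unif01_def space_restrict_space)

lemma prob_space_unif01: "prob_space unif01"
  by (rule prob_spaceI) (simp add: unif01_def emeasure_restrict_space space_restrict_space)

interpretation U: prob_space unif01 by (rule prob_space_unif01)

interpretation signals: sequence_space unif01 ..

lemma signal_space_eq: "signal_space = signals.S"
  by (simp add: signal_space_def)

interpretation S: prob_space signal_space
  unfolding signal_space_def by (rule prob_space_PiM) (rule prob_space_unif01)

interpretation US: pair_prob_space unif01 signal_space ..

lemma measurable_unif01_borel: "(\<lambda>x. x) \<in> borel_measurable unif01"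
  unfolding unif01_def by (intro measurable_restrict_space1) simp

lemma measurable_unif01I:
  assumes "f \<in> borel_measurable N" "\<And>\<omega>. \<omega> \<in> space N \<Longrightarrow> f \<omega> \<in> {0..1}"
  shows "f \<in> measurable N unif01"
  unfolding unif01_def by (rule measurable_restrict_space2) (use assms in auto)

lemma measurable_signal: "(\<lambda>s. s n) \<in> measurable signal_space unif01"
  unfolding signal_space_def by simp

abbreviation signal_pairs where
  "signal_pairs \<equiv> unif01 \<Otimes>\<^sub>M signal_space"

lemma measurable_case_nat_pair: "(\<lambda>(x, s). case_nat x s) \<in> measurable signal_pairs signal_space"
proof -
  have "(\<lambda>p. case_nat (fst p) (snd p)) \<in> measurable signal_pairs signal_space"
    unfolding signal_space_def by (rule measurable_case_nat') auto
  then show ?thesis by (simp add: case_prod_beta')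
qed

text \<open>A first signal put in front of an independent copy of the whole sequence has the law of
  the sequence.\<close>

lemma integral_signal_split:
  fixes f :: "(nat \<Rightarrow> real) \<Rightarrow> real"
  assumes f: "f \<in> borel_measurable signal_space" and B: "\<And>s. \<bar>f s\<bar> \<le> B"
  shows "(\<integral>s. f s \<partial>signal_space) = (\<integral>x. (\<integral>s. f (case_nat x s) \<partial>signal_space) \<partial>unif01)"
proof -
  have d: "distr signal_pairs signal_space (\<lambda>(x, s). case_nat x s) = signal_space"
    using signals.PiM_iter unfolding signal_space_eq .
  have "(\<integral>s. f s \<partial>signal_space) = (\<integral>s. f s \<partial>distr signal_pairs signal_space (\<lambda>(x, s). case_nat x s))"
    by (simp add: d)
  also have "\<dots> = (\<integral>p. f (case p of (x, s) \<Rightarrow> case_nat x s) \<partial>signal_pairs)"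
    by (rule integral_distr[OF measurable_case_nat_pair f])
  also have "\<dots> = (\<integral>x. (\<integral>s. f (case_nat x s) \<partial>signal_space) \<partial>unif01)"
  proof -
    have "(\<lambda>p. f (case p of (x, s) \<Rightarrow> case_nat x s)) \<in> borel_measurable signal_pairs"
      using measurable_compose[OF measurable_case_nat_pair f] .
    then have "integrable signal_pairs (\<lambda>p. f (case p of (x, s) \<Rightarrow> case_nat x s))"
      by (intro US.P.integrable_const_bound[of _ B]) (auto simp: B)
    from US.integral_fst'[OF this] show ?thesis by simp
  qed
  finally show ?thesis .
qed

text \<open>Given \<open>x < p\<close> the quotient \<open>x / p\<close> is again uniform, and
  similarly above \<open>p\<close>: one signal pays for a lottery and leaves a fresh uniform signal.
  The equation with \<open>f1\<close> stops short of \<open>x = 1\<close>, because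
  \<open>p * 1\<close> belongs to the second branch; this point is a null set.\<close>

lemma integral_unif01_mix:
  fixes f :: "real \<Rightarrow> real"
  assumes f: "f \<in> borel_measurable unif01" "f1 \<in> borel_measurable unif01" "f2 \<in> borel_measurable unif01"
    and B: "\<And>x. \<bar>f x\<bar> \<le> B" and p: "0 < p" "p < 1"
    and f1: "\<And>x. 0 \<le> x \<Longrightarrow> x < 1 \<Longrightarrow> f (p * x) = f1 x"
    and f2: "\<And>x. 0 \<le> x \<Longrightarrow> x \<le> 1 \<Longrightarrow> f (p + (1 - p) * x) = f2 x"
  shows "(\<integral>x. f x \<partial>unif01) = p * (\<integral>x. f1 x \<partial>unif01) + (1 - p) * (\<integral>x. f2 x \<partial>unif01)"
proof -
  have int: "(\<integral>x. h x \<partial>unif01) = (\<integral>x. indicator {0..1} x * h x \<partial>lborel)" for h :: "real \<Rightarrow> real"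
    unfolding unif01_def by (subst integral_restrict_space) auto
  have meas: "(\<lambda>x. indicator {0..1} x * h x) \<in> borel_measurable borel" if "h \<in> borel_measurable unif01" for h :: "real \<Rightarrow> real"
    using that unfolding unif01_def by (subst (asm) borel_measurable_restrict_space_iff) (auto simp: mult.commute)
  define g where "g = (\<lambda>x. indicator {0..1} x * f x)"
  have g: "g \<in> borel_measurable borel" unfolding g_def by (rule meas[OF f(1)])
  have integ: "integrable lborel (\<lambda>x. indicator A x * g x)" if "A \<in> sets borel" for A
  proof (rule Bochner_Integration.integrable_bound)
    show "integrable lborel (\<lambda>x. B * indicator {0..1::real} x)" by simp
    show "AE x in lborel. norm (indicator A x * g x) \<le> norm (B * indicator {0..1} x)"
      using B order_trans[OF B abs_ge_self] by (intro AE_I2) (auto simp: g_def indicator_def)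
  qed (use g that in simp)
  have "(\<integral>x. f x \<partial>unif01) = (\<integral>x. g x \<partial>lborel)" by (simp add: int g_def)
  also have "\<dots> = (\<integral>x. indicator {..<p} x * g x + indicator {p..} x * g x \<partial>lborel)"
    by (rule Bochner_Integration.integral_cong) (auto simp: indicator_def)
  also have "\<dots> = (\<integral>x. indicator {..<p} x * g x \<partial>lborel) + (\<integral>x. indicator {p..} x * g x \<partial>lborel)"
    by (intro Bochner_Integration.integral_add integ) auto
  also have "(\<integral>x. indicator {..<p} x * g x \<partial>lborel) = p * (\<integral>x. f1 x \<partial>unif01)"
  proof -
    have "(\<integral>x. indicator {..<p} x * g x \<partial>lborel) = p * (\<integral>x. indicator {..<p} (p * x) * g (p * x) \<partial>lborel)"
      using lborel_integral_real_affine[of p "\<lambda>x. indicator {..<p} x * g x" 0] p by simp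
    also have "(\<integral>x. indicator {..<p} (p * x) * g (p * x) \<partial>lborel) = (\<integral>x. indicator {0..1} x * f1 x \<partial>lborel)"
    proof (rule integral_cong_AE)
      show "AE x in lborel. indicator {..<p} (p * x) * g (p * x) = indicator {0..1} x * f1 x"
        using AE_lborel_singleton[of 1]
      proof eventually_elim
        case (elim x)
        have *: "p * x < p \<longleftrightarrow> x < 1" "0 \<le> p * x \<longleftrightarrow> 0 \<le> x"
          using p by (auto simp: zero_le_mult_iff)
        then have "x < 1 \<Longrightarrow> p * x < 1" using p by linarith
        note * this
        then show ?case using f1[of x] elim by (auto simp: indicator_def g_def)
      qed
    qed (use g meas[OF f(2)] in auto)
    finally show ?thesis by (simp add: int)
  qed
  also have "(\<integral>x. indicator {p..} x * g x \<partial>lborel) = (1 - p) * (\<integral>x. f2 x \<partial>unif01)"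
  proof -
    have "(\<integral>x. indicator {p..} x * g x \<partial>lborel) = (1 - p) * (\<integral>x. indicator {p..} (p + (1 - p) * x) * g (p + (1 - p) * x) \<partial>lborel)"
      using lborel_integral_real_affine[of "1 - p" "\<lambda>x. indicator {p..} x * g x" p] p by simp
    also have "(\<integral>x. indicator {p..} (p + (1 - p) * x) * g (p + (1 - p) * x) \<partial>lborel) = (\<integral>x. indicator {0..1} x * f2 x \<partial>lborel)"
    proof (rule Bochner_Integration.integral_cong)
      fix x :: real
      have "p \<le> p + (1 - p) * x \<longleftrightarrow> 0 \<le> x" using p by (simp add: zero_le_mult_iff)
      moreover have "p + (1 - p) * x \<le> 1 \<longleftrightarrow> x \<le> 1"
      proof -
        have "p + (1 - p) * x \<le> 1 \<longleftrightarrow> (1 - p) * x \<le> (1 - p) * 1" by (simp add: le_diff_eq add.commute)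
        then show ?thesis using p by (simp only: mult_le_cancel_left_pos)
      qed
      ultimately show "indicator {p..} (p + (1 - p) * x) * g (p + (1 - p) * x) = indicator {0..1} x * f2 x"
        using f2[of x] p by (auto simp: indicator_def g_def)
    qed simp
    finally show ?thesis by (simp add: int)
  qed
  finally show ?thesis .
qed

section \<open>Execution of plans with public signals\<close>

primrec actors :: "('i::finite) tree \<Rightarrow> 'i set" where
  "actors (Stop w) = {}"
| "actors (Act i \<delta> t) = insert i (actors t)"
| "actors (Mix p t u) = actors t \<union> actors u"

text \<open>The argument \<open>x\<close> is the still unused part of the current signal, \<open>s\<close> are the signals of the later
  stages, and \<open>M j\<close> is the probability that the players other than \<open>j\<close> have not quit so far.\<close>
primrec play :: "(('i::finite \<Rightarrow> real) \<Rightarrow> 'i \<Rightarrow> real) \<Rightarrow> 'i tree \<Rightarrow> ('i \<Rightarrow> real) \<Rightarrow> real \<Rightarrow> (nat \<Rightarrow> real) \<Rightarrow> nat \<Rightarrow> 'i \<Rightarrow> real" where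
  "play E (Stop w) M x s t = E M"
| "play E (Act k \<delta> T) M x s t = (case t of 0 \<Rightarrow> (\<lambda>_. 0)(k := \<delta>)
     | Suc t' \<Rightarrow> play E T (\<lambda>j. if j = k then M j else (1 - \<delta>) * M j) (s 0) (\<lambda>n. s (Suc n)) t')"
| "play E (Mix p T T') M x s t =
     (if x < p then play E T M (x / p) s t else play E T' M ((x - p) / (1 - p)) s t)"

lemma play_cong: "(\<And>n. n < t \<Longrightarrow> s n = s' n) \<Longrightarrow> play E T M x s t = play E T M x s' t"
proof (induction T arbitrary: M x s s' t)
  case (Act k \<delta> T)
  show ?case
  proof (cases t)
    case (Suc t')
    have "play E T (\<lambda>j. if j = k then M j else (1 - \<delta>) * M j) (s' 0) (\<lambda>n. s (Suc n)) t' =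
      play E T (\<lambda>j. if j = k then M j else (1 - \<delta>) * M j) (s' 0) (\<lambda>n. s' (Suc n)) t'"
      by (rule Act.IH) (use Act.prems Suc in auto)
    moreover have "s 0 = s' 0" using Act.prems Suc by simp
    ultimately show ?thesis using Suc by simp
  qed simp
next
  case (Mix p T1 T2)
  show ?case using Mix.IH(1)[OF Mix.prems] Mix.IH(2)[OF Mix.prems] by simp
qed simp

lemma play_measurable:
  "X \<in> borel_measurable N \<Longrightarrow> (\<And>n. n < t \<Longrightarrow> (\<lambda>\<omega>. S \<omega> n) \<in> borel_measurable N) \<Longrightarrow>
   (\<lambda>\<omega>. play E T M (X \<omega>) (S \<omega>) t i) \<in> borel_measurable N"
proof (induction T arbitrary: M X S t)
  case (Act k \<delta> T)
  show ?case
  proof (cases t)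
    case (Suc t')
    have "(\<lambda>\<omega>. play E T (\<lambda>j. if j = k then M j else (1 - \<delta>) * M j) (S \<omega> 0) (\<lambda>n. S \<omega> (Suc n)) t' i) \<in> borel_measurable N"
      by (rule Act.IH) (use Act.prems(2) Suc in auto)
    then show ?thesis using Suc by simp
  qed simp
next
  case (Mix p T1 T2)
  have "(\<lambda>\<omega>. if X \<omega> < p then play E T1 M (X \<omega> / p) (S \<omega>) t i else play E T2 M ((X \<omega> - p) / (1 - p)) (S \<omega>) t i) \<in> borel_measurable N"
    using Mix.prems by (intro measurable_If Mix.IH) auto
  then show ?case by (simp add: if_distrib[of "\<lambda>f. f i"] cong: if_cong)
qed simp

text \<open>The first signal is a separate argument because a lottery rescales it, whereas a stage
  discards it and puts \<open>s 0\<close> in its place.\<close>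

definition mean2 :: "(real \<Rightarrow> (nat \<Rightarrow> real) \<Rightarrow> real) \<Rightarrow> real" where
  "mean2 F = (\<integral>x. (\<integral>s. F x s \<partial>signal_space) \<partial>unif01)"

definition bounded_meas :: "(real \<Rightarrow> (nat \<Rightarrow> real) \<Rightarrow> real) \<Rightarrow> bool" where
  "bounded_meas F \<longleftrightarrow> (\<lambda>(x, s). F x s) \<in> borel_measurable signal_pairs \<and> (\<exists>B. \<forall>x s. \<bar>F x s\<bar> \<le> B)"

lemma bounded_meas_section:
  assumes "bounded_meas F" "x \<in> space unif01"
  shows "(\<lambda>s. F x s) \<in> borel_measurable signal_space"
  using assms measurable_compose_Pair1[of x unif01 "\<lambda>(x, s). F x s" signal_space borel]
  by (simp add: bounded_meas_def)

lemma bounded_meas_inner: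
  assumes "bounded_meas F"
  shows "(\<lambda>x. \<integral>s. F x s \<partial>signal_space) \<in> borel_measurable unif01"
  using assms S.borel_measurable_lebesgue_integral[of F unif01] by (simp add: bounded_meas_def)

lemma abs_integral_le:
  assumes "prob_space M" "\<And>x. \<bar>f x\<bar> \<le> B" "0 \<le> (B::real)" shows "\<bar>\<integral>x. f x \<partial>M\<bar> \<le> B"
proof (cases "integrable M f")
  case True
  interpret prob_space M by fact
  have "\<bar>\<integral>x. f x \<partial>M\<bar> \<le> (\<integral>x. \<bar>f x\<bar> \<partial>M)" by (rule integral_abs_bound)
  also have "\<dots> \<le> (\<integral>x. B \<partial>M)" using True assms(2) by (intro integral_mono) auto
  finally show ?thesis by (simp add: prob_space)
\<comment> \<open>A non-integrable function has integral 0 by convention.\<close>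
qed (use assms(3) in \<open>simp add: not_integrable_integral_eq\<close>)

lemma integral_le_bound:
  assumes "prob_space M" "f \<in> borel_measurable M" "\<And>x. \<bar>f x\<bar> \<le> B" "\<And>x. x \<in> space M \<Longrightarrow> f x \<le> (c::real)"
  shows "(\<integral>x. f x \<partial>M) \<le> c"
proof -
  interpret prob_space M by fact
  have "integrable M f" using assms by (intro integrable_const_bound[of _ B]) auto
  then have "(\<integral>x. f x \<partial>M) \<le> (\<integral>x. c \<partial>M)" using assms by (intro integral_mono) auto
  then show ?thesis by (simp add: prob_space)
qed

lemma mean2_le:
  assumes F: "bounded_meas F" and c: "\<And>x. x \<in> {0..1} \<Longrightarrow> (\<integral>s. F x s \<partial>signal_space) \<le> c"
  shows "mean2 F \<le> c"
proof -
  obtain B where B: "\<And>x s. \<bar>F x s\<bar> \<le> B" using F by (auto simp: bounded_meas_def)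
  have "0 \<le> B" using B[of 0 "\<lambda>_. 0"] by linarith
  then have B': "\<bar>\<integral>s. F x s \<partial>signal_space\<bar> \<le> B" for x by (intro abs_integral_le S.prob_space_axioms B)
  show ?thesis
    unfolding mean2_def
    by (rule integral_le_bound[OF prob_space_unif01 bounded_meas_inner[OF F] B']) (use c in \<open>simp add: space_unif01\<close>)
qed

lemma bounded_meas_integrable:
  assumes F: "bounded_meas F"
  shows "x \<in> space unif01 \<Longrightarrow> integrable signal_space (F x)"
    and "integrable unif01 (\<lambda>x. \<integral>s. F x s \<partial>signal_space)"
proof -
  obtain B where B: "\<And>x s. \<bar>F x s\<bar> \<le> B" using F by (auto simp: bounded_meas_def)
  have "0 \<le> B" using B[of 0 "\<lambda>_. 0"] by linarith
  then have B': "\<bar>\<integral>s. F x s \<partial>signal_space\<bar> \<le> B" for x by (intro abs_integral_le S.prob_space_axioms B)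
  show "x \<in> space unif01 \<Longrightarrow> integrable signal_space (F x)"
    using bounded_meas_section[OF F] B by (intro S.integrable_const_bound[of _ B]) auto
  show "integrable unif01 (\<lambda>x. \<integral>s. F x s \<partial>signal_space)"
    using bounded_meas_inner[OF F] B' by (intro U.integrable_const_bound[of _ B]) auto
qed

lemma mean2_affine:
  assumes F: "bounded_meas F"
  shows "mean2 (\<lambda>x s. a + b * F x s) = a + b * mean2 F"
proof -
  have "mean2 (\<lambda>x s. a + b * F x s) = (\<integral>x. a + b * (\<integral>s. F x s \<partial>signal_space) \<partial>unif01)"
    unfolding mean2_def
    by (rule Bochner_Integration.integral_cong) (use bounded_meas_integrable(1)[OF F] in \<open>auto simp: S.prob_space\<close>)
  then show ?thesis
    using bounded_meas_integrable(2)[OF F] by (simp add: mean2_def U.prob_space)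
qed

lemma mean2_uminus: "mean2 (\<lambda>x s. - F x s) = - mean2 F"
  by (simp add: mean2_def)

lemma bounded_meas_uminus: "bounded_meas F \<Longrightarrow> bounded_meas (\<lambda>x s. - F x s)"
  unfolding bounded_meas_def
proof safe
  fix B assume "(\<lambda>(x, s). F x s) \<in> borel_measurable signal_pairs" "\<forall>x s. \<bar>F x s\<bar> \<le> B"
  then show "(\<lambda>(x, s). - F x s) \<in> borel_measurable signal_pairs" "\<exists>B. \<forall>x s. \<bar>- F x s\<bar> \<le> B"
    by (auto simp: case_prod_beta')
qed

lemma integral_le_const:
  assumes F: "bounded_meas F" and x: "x \<in> {0..1}" and c: "\<And>s. F x s \<le> c"
  shows "(\<integral>s. F x s \<partial>signal_space) \<le> c"
proof -
  obtain B where B: "\<And>x s. \<bar>F x s\<bar> \<le> B" using F by (auto simp: bounded_meas_def)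
  have x': "x \<in> space unif01" using x by (simp add: space_unif01)
  show ?thesis
    by (rule integral_le_bound[OF S.prob_space_axioms bounded_meas_section[OF F x'] B c])
qed

lemma mean2_Mix:
  assumes F: "bounded_meas F" "bounded_meas F1" "bounded_meas F2" and p: "0 < p" "p < 1"
    and F1: "\<And>x s. 0 \<le> x \<Longrightarrow> x < 1 \<Longrightarrow> F (p * x) s = F1 x s"
    and F2: "\<And>x s. 0 \<le> x \<Longrightarrow> x \<le> 1 \<Longrightarrow> F (p + (1 - p) * x) s = F2 x s"
  shows "mean2 F = p * mean2 F1 + (1 - p) * mean2 F2"
proof -
  obtain B where B: "\<And>x s. \<bar>F x s\<bar> \<le> B" using F by (auto simp: bounded_meas_def)
  have "0 \<le> B" using B[of 0 "\<lambda>_. 0"] by linarith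
  then have B': "\<bar>\<integral>s. F x s \<partial>signal_space\<bar> \<le> B" for x by (intro abs_integral_le S.prob_space_axioms B)
  show ?thesis
    unfolding mean2_def
    by (rule integral_unif01_mix[OF bounded_meas_inner[OF F(1)] bounded_meas_inner[OF F(2)] bounded_meas_inner[OF F(3)] B' p])
       (simp_all add: F1 F2)
qed

text \<open>Once a stage has used up the first signal \<open>x\<close>, the next signal
  \<open>y\<close> takes over its role; this is the recursion at an \<open>Act\<close>.\<close>

lemma integral_eq_mean2:
  assumes F: "bounded_meas F" and x: "x \<in> {0..1}"
  shows "(\<integral>s. F x s \<partial>signal_space) = mean2 (\<lambda>y s. F x (case_nat y s))"
proof -
  obtain B where B: "\<And>x s. \<bar>F x s\<bar> \<le> B" using F by (auto simp: bounded_meas_def)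
  have x': "x \<in> space unif01" using x by (simp add: space_unif01)
  show ?thesis unfolding mean2_def by (rule integral_signal_split[OF bounded_meas_section[OF F x'] B])
qed

lemma bounded_meas_compose:
  assumes F: "bounded_meas F" and g: "g \<in> measurable signal_pairs signal_pairs"
  shows "bounded_meas (\<lambda>x s. F (fst (g (x, s))) (snd (g (x, s))))"
proof -
  have "(\<lambda>p. case g p of (x, s) \<Rightarrow> F x s) \<in> borel_measurable signal_pairs"
    using F by (intro measurable_compose[OF g]) (auto simp: bounded_meas_def)
  moreover have "(\<lambda>p. case g p of (x, s) \<Rightarrow> F x s) = (\<lambda>(x, s). F (fst (g (x, s))) (snd (g (x, s))))"
    by (auto simp: fun_eq_iff case_prod_beta')
  ultimately show ?thesis using F by (auto simp: bounded_meas_def)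
qed

lemma measurable_rescale:
  assumes p: "\<And>x. x \<in> {0..1} \<Longrightarrow> a + b * x \<in> {0..1::real}"
  shows "(\<lambda>(x, s). (a + b * x, s)) \<in> measurable signal_pairs signal_pairs"
proof -
  have "(\<lambda>x. a + b * x) \<in> measurable unif01 unif01"
    by (rule measurable_unif01I) (use measurable_unif01_borel p in \<open>auto simp: space_unif01\<close>)
  then have "(\<lambda>q. (a + b * fst q, snd q)) \<in> measurable signal_pairs signal_pairs"
    by (intro measurable_Pair measurable_compose[OF measurable_fst] measurable_snd)
  then show ?thesis by (simp add: case_prod_beta')
qed

lemma measurable_shift_signal:
  assumes x: "x \<in> {0..1}"
  shows "(\<lambda>(y, s). (x, case_nat y s)) \<in> measurable signal_pairs signal_pairs"
proof -
  have "(\<lambda>q. (x, case q of (y, s) \<Rightarrow> case_nat y s)) \<in> measurable signal_pairs signal_pairs"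
    using x by (intro measurable_Pair measurable_case_nat_pair measurable_const) (auto simp: space_unif01)
  then show ?thesis by (simp add: case_prod_beta')
qed

lemma probs_upd: "probs x \<Longrightarrow> 0 \<le> d \<Longrightarrow> d \<le> 1 \<Longrightarrow> probs (x(j := d))"
  by (auto simp: probs_def)

text \<open>Here \<open>x\<close> is the signal of stage 0 and \<open>s n\<close> that of stage \<open>n + 1\<close>.\<close>
definition adapted :: "(real \<Rightarrow> (nat \<Rightarrow> real) \<Rightarrow> nat \<Rightarrow> real) \<Rightarrow> bool" where
  "adapted D \<longleftrightarrow> (\<forall>t. (\<lambda>(x, s). D x s t) \<in> borel_measurable signal_pairs) \<and>
     (\<forall>x s t. 0 \<le> D x s t \<and> D x s t \<le> 1) \<and>
     (\<forall>x s s' t. (\<forall>n<t. s n = s' n) \<longrightarrow> D x s t = D x s' t)"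

lemma adapted_bounded_meas: "adapted D \<Longrightarrow> bounded_meas (\<lambda>x s. D x s t)"
  unfolding adapted_def bounded_meas_def by (auto intro!: exI[of _ 1] simp: abs_le_iff intro: order_trans[of _ 0])

lemma adapted_rescale:
  assumes "adapted D" "\<And>x. x \<in> {0..1} \<Longrightarrow> a + b * x \<in> {0..1::real}"
  shows "adapted (\<lambda>x s. D (a + b * x) s)"
  using assms bounded_meas_compose[OF adapted_bounded_meas[OF assms(1)] measurable_rescale[OF assms(2)]]
  unfolding adapted_def bounded_meas_def by simp

lemma adapted_shift:
  assumes D: "adapted D" and x: "x \<in> {0..1}"
  shows "adapted (\<lambda>y s t. D x (case_nat y s) (Suc t))"
proof -
  have "(\<lambda>(y, s). D x (case_nat y s) (Suc t)) \<in> borel_measurable signal_pairs" for t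
    using bounded_meas_compose[OF adapted_bounded_meas[OF D] measurable_shift_signal[OF x], of "Suc t"]
    by (simp add: bounded_meas_def)
  moreover have "D x (case_nat y s) (Suc t) = D x (case_nat y s') (Suc t)" if "\<forall>n<t. s n = s' n" for y s s' t
  proof -
    have "\<forall>n<Suc t. case_nat y s n = case_nat y s' n" using that by (auto simp: less_Suc_eq_0_disj)
    then show ?thesis using D unfolding adapted_def by blast
  qed
  ultimately show ?thesis using D unfolding adapted_def by blast
qed

lemma adapted_0: "adapted (\<lambda>_ _ _. 0)"
  by (simp add: adapted_def case_prod_beta')

lemma measurable_restrict_signal: "(\<lambda>s. restrict s {..t}) \<in> measurable signal_space (history_space t)"
  unfolding signal_space_def history_space_def by (rule measurable_restrict_subset) simp

lemma probs_qprob: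
  assumes "\<And>i. is_strategy (\<xi> i)" "s \<in> space signal_space"
  shows "probs (qprob \<xi> t s)"
proof -
  have "restrict s {..t} \<in> space (history_space t)"
    using measurable_space[OF measurable_restrict_signal assms(2)] .
  then show ?thesis using assms(1) by (simp add: probs_def qprob_def is_strategy_def)
qed

lemma integrable_payoff:
  fixes r :: "'i::finite set \<Rightarrow> 'i \<Rightarrow> real"
  assumes \<xi>: "\<And>i. is_strategy (\<xi> i)" and r: "\<And>S. \<bar>r S j\<bar> \<le> C"
  shows "integrable signal_space (\<lambda>s. payoff r (\<lambda>t. qprob \<xi> t s) j)"
proof -
  have "(\<lambda>s. qprob \<xi> t s i) \<in> borel_measurable signal_space" for t i
    unfolding qprob_def using measurable_compose[OF measurable_restrict_signal, of "\<xi> i t" t borel] \<xi>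
    by (simp add: is_strategy_def)
  then have "(\<lambda>s. payoff r (\<lambda>t. qprob \<xi> t s) j) \<in> borel_measurable signal_space" by (rule payoff_measurable)
  moreover have "\<bar>payoff r (\<lambda>t. qprob \<xi> t s) j\<bar> \<le> C" if "s \<in> space signal_space" for s
    using probs_qprob[OF \<xi> that] r by (intro payoff_bound)
  ultimately show ?thesis
    by (intro S.integrable_const_bound[of _ C] AE_I2) auto
qed

lemma exp_payoff_shift:
  fixes r :: "'i::finite set \<Rightarrow> 'i \<Rightarrow> real"
  assumes \<xi>: "\<And>i. is_strategy (\<xi> i)" and r: "\<And>S. \<bar>r S j\<bar> \<le> C"
  shows "exp_payoff (\<lambda>S i. r S i - k i) \<xi> j = exp_payoff r \<xi> j - k j"
proof -
  have "exp_payoff (\<lambda>S i. r S i - k i) \<xi> j = (\<integral>s. payoff r (\<lambda>t. qprob \<xi> t s) j - k j \<partial>signal_space)"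
    unfolding exp_payoff_def cond_payoff_eq_payoff
    by (intro Bochner_Integration.integral_cong refl payoff_shift[of _ r j C, OF _ r] probs_qprob \<xi>)
  also have "\<dots> = exp_payoff r \<xi> j - k j"
    unfolding exp_payoff_def cond_payoff_eq_payoff using integrable_payoff[of \<xi> r j C, OF \<xi> r] by (simp add: S.prob_space)
  finally show ?thesis .
qed

section \<open>Plans as approximate equilibria\<close>

locale normalized_game =
  fixes r :: "'i::finite set \<Rightarrow> 'i \<Rightarrow> real"
  assumes r_bound: "\<bar>r S j\<bar> \<le> 2" and r_own: "r {j} j = 0"
begin

definition solo :: "'i \<Rightarrow> real^'i" where
  "solo i = (\<chi> j. r {i} j)"

sublocale solo_payoffs solo
  by unfold_locales (simp_all add: solo_def r_bound r_own)

lemma stage_one: "stage_payoff r ((\<lambda>_. 0)(k := d)) j = d * r {k} j" "quits ((\<lambda>_. 0)(k := d)) = d"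
  by (simp_all add: stage_payoff_def quits_def outcome_mean_one)

lemma stage_two:
  assumes "j \<noteq> k"
  shows "stage_payoff r ((\<lambda>_. 0)(k := \<delta>, j := d)) j = d * (\<delta> * r {j, k} j) + (1 - d) * (\<delta> * r {k} j)"
    "1 - quits ((\<lambda>_. 0)(k := \<delta>, j := d)) = (1 - d) * (1 - \<delta>)"
  using assms by (simp_all add: stage_payoff_def quits_def outcome_mean_two r_own algebra_simps)

lemma probs_play: "valid Z e T \<Longrightarrow> (\<And>M. probs (E M)) \<Longrightarrow> probs (play E T M x s t)"
  by (induction T arbitrary: M x s t) (auto simp: probs_def split: nat.split)

lemma bounded_meas_payoff:
  assumes "valid Z e T" "\<And>M. probs (E M)" "adapted D"
  shows "bounded_meas (\<lambda>x s. payoff r (\<lambda>t. (play E T M x s t)(j := D x s t)) j)"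
    and "bounded_meas (\<lambda>x s. payoff r (play E T M x s) j)"
proof -
  have X: "(\<lambda>p. fst p) \<in> borel_measurable signal_pairs"
    by (rule measurable_compose[OF measurable_fst measurable_unif01_borel])
  have S: "(\<lambda>p. snd p n) \<in> borel_measurable signal_pairs" for n
    using measurable_compose[OF measurable_compose[OF measurable_snd measurable_signal] measurable_unif01_borel] .
  have P: "(\<lambda>p. play E T M (fst p) (snd p) t i) \<in> borel_measurable signal_pairs" for t i
    by (rule play_measurable[OF X S])
  have D: "(\<lambda>p. D (fst p) (snd p) t) \<in> borel_measurable signal_pairs" for t
    using assms(3) by (simp add: adapted_def case_prod_beta')
  have "(\<lambda>p. ((play E T M (fst p) (snd p) t)(j := D (fst p) (snd p) t)) i) \<in> borel_measurable signal_pairs" for t i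
    using P D by (cases "i = j") auto
  from payoff_measurable[of "\<lambda>p t. (play E T M (fst p) (snd p) t)(j := D (fst p) (snd p) t)", OF this]
  have "(\<lambda>p. payoff r (\<lambda>t. (play E T M (fst p) (snd p) t)(j := D (fst p) (snd p) t)) j) \<in> borel_measurable signal_pairs" .
  moreover have "probs ((play E T M x s t)(j := D x s t))" for x s t
    using probs_play[OF assms(1,2)] assms(3) by (intro probs_upd) (auto simp: adapted_def)
  then have "\<bar>payoff r (\<lambda>t. (play E T M x s t)(j := D x s t)) j\<bar> \<le> 2" for x s
    by (intro payoff_bound r_bound)
  ultimately show "bounded_meas (\<lambda>x s. payoff r (\<lambda>t. (play E T M x s t)(j := D x s t)) j)"
    unfolding bounded_meas_def by (auto simp: case_prod_beta')
  from payoff_measurable[of "\<lambda>p. play E T M (fst p) (snd p)", OF P]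
  have "(\<lambda>p. payoff r (play E T M (fst p) (snd p)) j) \<in> borel_measurable signal_pairs" .
  moreover have "\<bar>payoff r (play E T M x s) j\<bar> \<le> 2" for x s
    by (intro payoff_bound r_bound probs_play[OF assms(1,2)])
  ultimately show "bounded_meas (\<lambda>x s. payoff r (play E T M x s) j)"
    unfolding bounded_meas_def by (auto simp: case_prod_beta')
qed

text \<open>The case of a player who is not the actor. Quitting earns at most
  \<open>2 * \<delta>\<close>, since quitting alone earns 0, while \<open>W + B\<close> is at least
  \<open>2 * e\<close>. Continuing leads to the bound for the rest of the plan, whose weight
  \<open>(1 - \<delta>) * M\<close> contains the probability that the actor has not quit.\<close>

lemma act_other_arith:
  fixes M d \<delta> e :: real
  assumes M: "0 \<le> M" and d: "0 \<le> d" "d \<le> 1" and \<delta>: "0 < \<delta>" "\<delta> \<le> e" "\<delta> \<le> 1/2" and a: "a \<le> 2"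
    and W: "W = \<delta> * \<rho> + (1 - \<delta>) * W'" "- e \<le> W" and J: "(1 - \<delta>) * M * J \<le> (1 - \<delta>) * M * (W' + B) + F"
    and F: "0 \<le> F" and B: "3 * e \<le> B"
  shows "M * (d * (\<delta> * a) + (1 - d) * (\<delta> * \<rho>) + (1 - d) * (1 - \<delta>) * J) \<le> M * (W + B) + F"
proof -
  have B0: "0 \<le> B" using B \<delta> by linarith
  have 1: "M * (\<delta> * \<rho>) + (1 - \<delta>) * M * J \<le> M * (W + B) + F"
  proof -
    have "(1 - \<delta>) * M * B \<le> 1 * M * B" using M \<delta> B0 by (intro mult_right_mono) auto
    then show ?thesis using J by (simp add: W(1) algebra_simps)
  qed
  have 2: "M * (\<delta> * a) \<le> M * (W + B) + F"
  proof -
    have "\<delta> * a \<le> \<delta> * 2" using \<delta> a by (intro mult_left_mono) auto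
    then have "\<delta> * a \<le> W + B" using W(2) B \<delta> by linarith
    then show ?thesis using mult_left_mono[OF _ M] F by (smt (verit))
  qed
  have "M * (d * (\<delta> * a) + (1 - d) * (\<delta> * \<rho>) + (1 - d) * (1 - \<delta>) * J) =
     d * (M * (\<delta> * a)) + (1 - d) * (M * (\<delta> * \<rho>) + (1 - \<delta>) * M * J)" by (simp add: algebra_simps)
  also have "\<dots> \<le> d * (M * (W + B) + F) + (1 - d) * (M * (W + B) + F)"
    using mult_left_mono[OF 1, of "1 - d"] mult_left_mono[OF 2, of d] d by linarith
  finally show ?thesis by (simp add: algebra_simps)
qed

text \<open>The case of the actor. Continuing raises the value from \<open>W\<close> to
  \<open>W'\<close>, that is by \<open>\<delta> * W' \<le> 2 * e * \<delta>\<close>; these gains add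
  up to \<open>2 * e * duration T\<close>. The weight \<open>M\<close> stays the same, since it
  counts only the quitting of the others.\<close>

lemma act_self_arith:
  fixes M d \<delta> e :: real
  assumes M: "0 \<le> M" and d: "0 \<le> d" "d \<le> 1" and \<delta>: "0 < \<delta>" "\<delta> \<le> 1/2"
    and W: "W = (1 - \<delta>) * W'" "\<bar>W\<bar> \<le> e" and J: "M * J \<le> M * (W' + B) + F"
    and F: "0 \<le> F" and B: "3 * e \<le> B"
  shows "M * ((1 - d) * J) \<le> M * (W + B + 2 * e * \<delta>) + F"
proof -
  have e: "0 \<le> e" using W by linarith
  have "1/2 * \<bar>W'\<bar> \<le> (1 - \<delta>) * \<bar>W'\<bar>" using \<delta> by (intro mult_right_mono) auto
  then have "\<bar>W'\<bar> \<le> 2 * e" using W \<delta> by (simp add: abs_mult)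
  then have "\<delta> * W' \<le> \<delta> * (2 * e)" using \<delta> by (intro mult_left_mono) auto
  then have "W' \<le> W + 2 * e * \<delta>" by (simp add: W(1) algebra_simps)
  then have "M * (W' + B) \<le> M * (W + B + 2 * e * \<delta>)" using M by (intro mult_left_mono) auto
  then have 1: "M * J \<le> M * (W + B + 2 * e * \<delta>) + F" using J by linarith
  have "0 \<le> W + B + 2 * e * \<delta>" using W(2) B e mult_nonneg_nonneg[of e \<delta>] \<delta> by linarith
  then have "0 \<le> M * (W + B + 2 * e * \<delta>) + F" using M F by simp
  then have "(1 - d) * (M * J) \<le> 1 * (M * (W + B + 2 * e * \<delta>) + F)"
    using 1 d mult_left_mono[OF 1, of "1 - d"] mult_right_mono[of "1 - d" 1 "M * (W + B + 2 * e * \<delta>) + F"] by linarith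
  then show ?thesis by (simp add: ac_simps)
qed

lemma duration_nonneg: "valid Z e T \<Longrightarrow> 0 \<le> duration T"
  by (induction T) auto

text \<open>At every stage at most one player acts, so \<open>M i * M k\<close> shrinks like the mass of the plan for \<open>i \<noteq> k\<close>. At the
  end \<open>M j\<close> is therefore small for all players but the one with the largest \<open>M j\<close>, who is punished by \<open>E\<close>.\<close>
lemma deviation_bound:
  assumes E: "\<And>M. probs (E M)"
    and E_pun: "\<And>M. (\<forall>i\<in>N. \<forall>j. j \<notin> N \<longrightarrow> M j \<le> M i) \<Longrightarrow> \<exists>i. (\<forall>j. M j \<le> M i) \<and>
       (\<forall>d. (\<forall>t. 0 \<le> d t \<and> d t \<le> 1) \<longrightarrow> payoff r (\<lambda>t. (E M)(i := d t)) i \<le> 2 * e)"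
    and \<kappa>: "0 < \<kappa>" and e: "0 < e"
  shows "valid UNIV e T \<Longrightarrow> actors T \<subseteq> N \<Longrightarrow> (\<And>i. 0 \<le> M i) \<Longrightarrow> (\<And>i j. i \<in> N \<Longrightarrow> j \<notin> N \<Longrightarrow> M j \<le> M i) \<Longrightarrow>
    (\<And>i k. i \<noteq> k \<Longrightarrow> M i * M k \<le> \<sigma>) \<Longrightarrow> 0 \<le> \<sigma> \<Longrightarrow> adapted D \<Longrightarrow>
    M j * mean2 (\<lambda>x s. payoff r (\<lambda>t. (play E T M x s t)(j := D x s t)) j)
      \<le> M j * (val T $ j + 3 * e + 2 * e * duration T) + 2 * (\<kappa> + \<sigma> * mass T / \<kappa>)"
proof (induction T arbitrary: M \<sigma> D)
  case (Stop w)
  let ?F = "\<lambda>x s. payoff r (\<lambda>t. (play E (Stop w) M x s t)(j := D x s t)) j"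
  have bm: "bounded_meas ?F" using bounded_meas_payoff(1)[OF Stop.prems(1) E Stop.prems(7)] .
  have Dp: "0 \<le> D x s t" "D x s t \<le> 1" for x s t using Stop.prems(7) by (auto simp: adapted_def)
  obtain i where i: "\<And>j. M j \<le> M i"
     "\<And>d. (\<And>t. 0 \<le> d t \<and> d t \<le> 1) \<Longrightarrow> payoff r (\<lambda>t. (E M)(i := d t)) i \<le> 2 * e"
    using E_pun[of M] Stop.prems(4) by blast
  have w: "- e \<le> w $ j" using Stop.prems(1) by simp
  have F0: "0 \<le> 2 * (\<kappa> + \<sigma> / \<kappa>)" using \<kappa> Stop.prems(6) by simp
  show ?case
  proof (cases "j = i")
    case True
    have "mean2 ?F \<le> 2 * e"
    proof (rule mean2_le[OF bm integral_le_const[OF bm]])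
      fix x s show "?F x s \<le> 2 * e" unfolding True using i(2)[of "D x s"] Dp by simp
    qed
    then have "M j * mean2 ?F \<le> M j * (w $ j + 3 * e)" using w Stop.prems(3) by (intro mult_left_mono) auto
    then have "M j * mean2 ?F \<le> M j * (w $ j + 3 * e) + 2 * (\<kappa> + \<sigma> / \<kappa>)" using F0 by linarith
    then show ?thesis by (simp only: val.simps duration.simps mass.simps mult_zero_right add_0_right mult_1_right)
  next
    case False
    have "mean2 ?F \<le> 2"
    proof (rule mean2_le[OF bm integral_le_const[OF bm]])
      fix x s
      have "probs ((E M)(j := D x s t))" for t using E Dp by (intro probs_upd) auto
      then show "?F x s \<le> 2" using payoff_bound[of "\<lambda>t. (E M)(j := D x s t)" r j 2] r_bound by (simp add: abs_le_iff)
    qed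
    \<comment> \<open>As \<open>M i\<close> is largest,
      \<open>M j * M j \<le> M i * M j \<le> \<sigma>\<close>. So \<open>M j\<close> is at most
      \<open>\<kappa>\<close> or at most \<open>\<sigma> / \<kappa>\<close>.\<close>
    moreover have "M j \<le> \<kappa> + \<sigma> / \<kappa>"
    proof (cases "M j \<le> \<kappa>")
      case True
      then show ?thesis using \<kappa> Stop.prems(6) by (simp add: add_increasing2)
    next
      case False
      have "M j * \<kappa> \<le> M j * M j" using False Stop.prems(3)[of j] by (intro mult_left_mono) auto
      also have "\<dots> \<le> M i * M j" using i(1) Stop.prems(3) by (intro mult_right_mono)
      also have "\<dots> \<le> \<sigma>" using Stop.prems(5)[of i j] \<open>j \<noteq> i\<close> by auto
      finally have "M j \<le> \<sigma> / \<kappa>" using \<kappa> by (simp add: pos_le_divide_eq)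
      then show ?thesis using \<kappa> by linarith
    qed
    moreover have "0 \<le> M j * (w $ j + 3 * e)" using w e Stop.prems(3) by (intro mult_nonneg_nonneg) auto
    moreover have "M j * mean2 ?F \<le> M j * 2" using calculation(1) Stop.prems(3) by (intro mult_left_mono) auto
    moreover have "M j * 2 \<le> (\<kappa> + \<sigma> / \<kappa>) * 2" using calculation(2) by (rule mult_right_mono) simp
    ultimately have "M j * mean2 ?F \<le> M j * (w $ j + 3 * e) + 2 * (\<kappa> + \<sigma> / \<kappa>)"
      unfolding mult.commute[of 2 "\<kappa> + \<sigma> / \<kappa>"] by (blast intro: order_trans add_increasing)
    then show ?thesis by (simp only: val.simps duration.simps mass.simps mult_zero_right add_0_right mult_1_right)
  qed
next
  case (Act k \<delta> T)
  let ?T = "Act k \<delta> T"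
  let ?F = "\<lambda>x s. payoff r (\<lambda>t. (play E ?T M x s t)(j := D x s t)) j"
  have bm: "bounded_meas ?F" using bounded_meas_payoff(1)[OF Act.prems(1) E Act.prems(7)] .
  have Dp: "0 \<le> D x s t" "D x s t \<le> 1" for x s t using Act.prems(7) by (auto simp: adapted_def)
  have v: "valid UNIV e T" and k: "k \<in> N" and \<delta>: "0 < \<delta>" "\<delta> \<le> e" "\<delta> \<le> 1/2"
    and W: "\<bar>val ?T $ k\<bar> \<le> e" "\<And>i. - e \<le> val ?T $ i" using Act.prems by auto
  define M' where "M' = (\<lambda>i. if i = k then M i else (1 - \<delta>) * M i)"
  define \<sigma>' where "\<sigma>' = (1 - \<delta>) * \<sigma>"
  define F where "F = 2 * (\<kappa> + \<sigma> * mass ?T / \<kappa>)"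
  define B where "B = 3 * e + 2 * e * duration T"
  have F': "2 * (\<kappa> + \<sigma>' * mass T / \<kappa>) = F" by (simp add: F_def \<sigma>'_def ac_simps)
  have F0: "0 \<le> F" unfolding F_def using \<kappa> Act.prems(6) mass_nonneg[OF Act.prems(1)] by simp
  have B3: "3 * e \<le> B" using duration_nonneg[OF v] e by (simp add: B_def)
  have M'0: "0 \<le> M' i" for i using Act.prems(3) \<delta> by (simp add: M'_def)
  \<comment> \<open>A player outside \<open>N\<close> never acts, so the weight of this player
    shrinks at every stage. The largest weight thus belongs to a player in \<open>N\<close>, as
    \<open>E_pun\<close> requires.\<close>
  have M'N: "M' j \<le> M' i" if "i \<in> N" "j \<notin> N" for i j
  proof -
    have "(1 - \<delta>) * M j \<le> (1 - \<delta>) * M i" using Act.prems(4)[OF that] \<delta> by (intro mult_left_mono) auto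
    moreover have "(1 - \<delta>) * M i \<le> 1 * M i" using Act.prems(3) \<delta> by (intro mult_right_mono) auto
    ultimately show ?thesis using that k by (auto simp: M'_def)
  qed
  \<comment> \<open>At least one of \<open>i\<close> and \<open>l\<close> differs from the actor, so
    the product gains a factor \<open>1 - \<delta>\<close>.\<close>
  have M'\<sigma>: "M' i * M' l \<le> \<sigma>'" if "i \<noteq> l" for i l
  proof -
    have *: "(1 - \<delta>) * (M i * M l) \<le> \<sigma>'" unfolding \<sigma>'_def using Act.prems(5)[OF that] \<delta> by (intro mult_left_mono) auto
    have "(1 - \<delta>) * ((1 - \<delta>) * (M i * M l)) \<le> 1 * ((1 - \<delta>) * (M i * M l))"
      using \<delta> Act.prems(3) by (intro mult_right_mono mult_nonneg_nonneg) auto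
    then show ?thesis using * that by (auto simp: M'_def ac_simps)
  qed
  have \<sigma>'0: "0 \<le> \<sigma>'" using Act.prems(6) \<delta> by (simp add: \<sigma>'_def)
  have "(\<integral>s. ?F x s \<partial>signal_space) \<le> c" if x: "x \<in> {0..1}" and c: "c * M j = M j * (val ?T $ j + 3 * e + 2 * e * duration ?T) + F" "0 < M j" for x c
  proof -
    \<comment> \<open>The first move of the deviation depends on the first signal only; the zero
      sequence is an arbitrary representative of the later ones.\<close>
    define d where "d = D x (\<lambda>_. 0) 0"
    have d: "0 \<le> d" "d \<le> 1" using Dp by (auto simp: d_def)
    have D0: "D x s 0 = d" for s using Act.prems(7) unfolding adapted_def d_def by blast
    define D' where "D' = (\<lambda>y s t. D x (case_nat y s) (Suc t))"
    have D': "adapted D'" unfolding D'_def by (rule adapted_shift[OF Act.prems(7) x])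
    define J where "J = mean2 (\<lambda>x s. payoff r (\<lambda>t. (play E T M' x s t)(j := D' x s t)) j)"
    have J: "M' j * J \<le> M' j * (val T $ j + B) + F"
    proof -
      have "actors T \<subseteq> N" using Act.prems(2) by simp
      from Act.IH[of M' \<sigma>' D', OF v this M'0 M'N M'\<sigma> \<sigma>'0 D'] show ?thesis
        unfolding J_def F' B_def add.assoc .
    qed
    define x0 where "x0 = ((\<lambda>_. 0)(k := \<delta>, j := d))"
    have "?F x (case_nat y s) = stage_payoff r x0 j + (1 - quits x0) * payoff r (\<lambda>t. (play E T M' y s t)(j := D' y s t)) j" for y s
    proof -
      have "probs ((play E ?T M x (case_nat y s) t)(j := D x (case_nat y s) t))" for t
        using probs_play[OF Act.prems(1) E] Dp by (intro probs_upd) auto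
      from payoff_Suc[OF this r_bound] show ?thesis
        by (simp add: D0 x0_def D'_def M'_def)
    qed
    then have "(\<integral>s. ?F x s \<partial>signal_space) = mean2 (\<lambda>y s. stage_payoff r x0 j + (1 - quits x0) * payoff r (\<lambda>t. (play E T M' y s t)(j := D' y s t)) j)"
      using integral_eq_mean2[OF bm x] by simp
    also have "\<dots> = stage_payoff r x0 j + (1 - quits x0) * J"
      unfolding J_def by (rule mean2_affine[OF bounded_meas_payoff(1)[OF v E D']])
    finally have I: "(\<integral>s. ?F x s \<partial>signal_space) = stage_payoff r x0 j + (1 - quits x0) * J" .
    have "M j * (stage_payoff r x0 j + (1 - quits x0) * J) \<le> M j * (val ?T $ j + B + 2 * e * \<delta>) + F"
    proof (cases "j = k")
      case True
      have x0: "x0 = (\<lambda>_. 0)(k := d)" by (simp add: x0_def True)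
      have "M k * ((1 - d) * J) \<le> M k * (val ?T $ k + B + 2 * e * \<delta>) + F"
      proof (rule act_self_arith[OF Act.prems(3) d \<delta>(1,3) _ W(1) _ F0 B3])
        show "val ?T $ k = (1 - \<delta>) * val T $ k" by (simp add: solo_def r_own)
        show "M k * J \<le> M k * (val T $ k + B) + F" using J by (simp add: True M'_def)
      qed
      then show ?thesis unfolding x0 True stage_one by (simp add: r_own)
    next
      case False
      have "M j * (d * (\<delta> * r {j, k} j) + (1 - d) * (\<delta> * r {k} j) + (1 - d) * (1 - \<delta>) * J) \<le> M j * (val ?T $ j + B) + F"
      proof (rule act_other_arith[OF Act.prems(3) d \<delta> _ _ W(2) _ F0 B3])
        show "r {j, k} j \<le> 2" using r_bound[of "{j,k}" j] by (simp add: abs_le_iff)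
        show "val ?T $ j = \<delta> * r {k} j + (1 - \<delta>) * val T $ j" by (simp add: solo_def)
        show "(1 - \<delta>) * M j * J \<le> (1 - \<delta>) * M j * (val T $ j + B) + F" using J False by (simp add: M'_def)
      qed
      moreover have "0 \<le> M j * (2 * e * \<delta>)" using Act.prems(3) e \<delta> by simp
      ultimately show ?thesis unfolding x0_def stage_two[OF False] distrib_left by linarith
    qed
    also have "\<dots> = M j * c" using c(1) by (simp add: B_def algebra_simps)
    finally show ?thesis unfolding I using c(2) by simp
  qed
  note inner = this
  show ?case
  proof (cases "M j = 0")
    case True
    then show ?thesis using F0 by (simp add: F_def)
  next
    case False
    then have Mj: "0 < M j" using Act.prems(3)[of j] by simp
    \<comment> \<open>The bound on \<open>mean2\<close> comes from a constant bound on the inner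
      integral, hence the division by \<open>M j\<close>.\<close>
    define c where "c = (M j * (val ?T $ j + 3 * e + 2 * e * duration ?T) + F) / M j"
    have c: "c * M j = M j * (val ?T $ j + 3 * e + 2 * e * duration ?T) + F" using Mj by (simp add: c_def)
    have "mean2 ?F \<le> c" by (rule mean2_le[OF bm inner[OF _ c Mj]])
    then have "mean2 ?F * M j \<le> c * M j" using Mj by (intro mult_right_mono) auto
    then show ?thesis unfolding c F_def mult.commute[of "mean2 ?F"] .
  qed
next
  case (Mix p T1 T2)
  have p: "0 < p" "p < 1" and v: "valid UNIV e T1" "valid UNIV e T2" using Mix.prems(1) by auto
  define D1 where "D1 = (\<lambda>x. D (p * x))"
  define D2 where "D2 = (\<lambda>x. D (p + (1 - p) * x))"
  have D1: "adapted D1" using adapted_rescale[OF Mix.prems(7), of 0 p] p unfolding D1_def by (simp add: mult_le_one)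
  have D2: "adapted D2" unfolding D2_def
  proof (rule adapted_rescale[OF Mix.prems(7)])
    fix x :: real assume "x \<in> {0..1}"
    then have "0 \<le> p + (1 - p) * x" "p + (1 - p) * x \<le> 1"
      using p convex_bound_le[of 1 1 x p "1 - p"] by auto
    then show "p + (1 - p) * x \<in> {0..1}" by simp
  qed
  let ?F1 = "\<lambda>x s. payoff r (\<lambda>t. (play E T1 M x s t)(j := D1 x s t)) j"
  let ?F2 = "\<lambda>x s. payoff r (\<lambda>t. (play E T2 M x s t)(j := D2 x s t)) j"
  have I: "mean2 (\<lambda>x s. payoff r (\<lambda>t. (play E (Mix p T1 T2) M x s t)(j := D x s t)) j) = p * mean2 ?F1 + (1 - p) * mean2 ?F2"
  proof (rule mean2_Mix[OF bounded_meas_payoff(1)[OF Mix.prems(1) E Mix.prems(7)]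
        bounded_meas_payoff(1)[OF v(1) E D1] bounded_meas_payoff(1)[OF v(2) E D2] p])
    fix x :: real and s :: "nat \<Rightarrow> real"
    show "payoff r (\<lambda>t. (play E (Mix p T1 T2) M (p * x) s t)(j := D (p * x) s t)) j = ?F1 x s" if "0 \<le> x" "x < 1"
      using p that by (simp add: D1_def)
    show "payoff r (\<lambda>t. (play E (Mix p T1 T2) M (p + (1 - p) * x) s t)(j := D (p + (1 - p) * x) s t)) j = ?F2 x s" if "0 \<le> x" "x \<le> 1"
    proof -
      have "\<not> p + (1 - p) * x < p" using p that by (simp add: not_less)
      then show ?thesis using p by (simp add: D2_def)
    qed
  qed
  define L where "L = max (duration T1) (duration T2)"
  have 1: "M j * mean2 ?F1 \<le> M j * (val T1 $ j + 3 * e + 2 * e * L) + 2 * (\<kappa> + \<sigma> * mass T1 / \<kappa>)"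
  proof -
    have "M j * mean2 ?F1 \<le> M j * (val T1 $ j + 3 * e + 2 * e * duration T1) + 2 * (\<kappa> + \<sigma> * mass T1 / \<kappa>)"
      using Mix.prems by (intro Mix.IH(1) v D1) auto
    moreover have "M j * (val T1 $ j + 3 * e + 2 * e * duration T1) \<le> M j * (val T1 $ j + 3 * e + 2 * e * L)"
      using Mix.prems(3) e by (intro mult_left_mono add_left_mono) (auto simp: L_def)
    ultimately show ?thesis by linarith
  qed
  have 2: "M j * mean2 ?F2 \<le> M j * (val T2 $ j + 3 * e + 2 * e * L) + 2 * (\<kappa> + \<sigma> * mass T2 / \<kappa>)"
  proof -
    have "M j * mean2 ?F2 \<le> M j * (val T2 $ j + 3 * e + 2 * e * duration T2) + 2 * (\<kappa> + \<sigma> * mass T2 / \<kappa>)"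
      using Mix.prems by (intro Mix.IH(2) v D2) auto
    moreover have "M j * (val T2 $ j + 3 * e + 2 * e * duration T2) \<le> M j * (val T2 $ j + 3 * e + 2 * e * L)"
      using Mix.prems(3) e by (intro mult_left_mono add_left_mono) (auto simp: L_def)
    ultimately show ?thesis by linarith
  qed
  have "M j * (p * mean2 ?F1 + (1 - p) * mean2 ?F2) = p * (M j * mean2 ?F1) + (1 - p) * (M j * mean2 ?F2)"
    by (simp add: algebra_simps)
  also have "\<dots> \<le> p * (M j * (val T1 $ j + 3 * e + 2 * e * L) + 2 * (\<kappa> + \<sigma> * mass T1 / \<kappa>)) +
     (1 - p) * (M j * (val T2 $ j + 3 * e + 2 * e * L) + 2 * (\<kappa> + \<sigma> * mass T2 / \<kappa>))"
    using 1 2 p by (intro add_mono mult_left_mono) auto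
  also have "\<dots> = M j * (val (Mix p T1 T2) $ j + 3 * e + 2 * e * L) + 2 * (\<kappa> + \<sigma> * mass (Mix p T1 T2) / \<kappa>)"
    by (simp add: algebra_simps add_divide_distrib diff_divide_distrib)
  finally show ?case unfolding I by (simp add: L_def)
qed

text \<open>Only at the ends of the plan can the actual payoff differ from the promised one, by at
  most 4, and they are reached with probability \<open>mass T\<close>.\<close>

lemma on_path_bound:
  assumes E: "\<And>M. probs (E M)"
  shows "valid Z e T \<Longrightarrow> val T $ j - 4 * mass T \<le> mean2 (\<lambda>x s. payoff r (play E T M x s) j)"
proof (induction T arbitrary: M)
  case (Stop w)
  let ?F = "\<lambda>x s. payoff r (play E (Stop w) M x s) j"
  have bm: "bounded_meas ?F" by (rule bounded_meas_payoff(2)[OF Stop E adapted_0])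
  have "mean2 (\<lambda>x s. - ?F x s) \<le> 2"
  proof (rule mean2_le[OF bounded_meas_uminus[OF bm] integral_le_const[OF bounded_meas_uminus[OF bm]]])
    fix x s
    have "\<bar>?F x s\<bar> \<le> 2" by (intro payoff_bound r_bound probs_play[OF Stop E])
    then show "- ?F x s \<le> 2" by (simp only: abs_le_iff)
  qed
  then have "- 2 \<le> mean2 ?F" unfolding mean2_uminus by linarith
  moreover have "w $ j \<le> 2" using val_bound[OF Stop, of j] by (simp add: abs_le_iff)
  ultimately have "w $ j - 4 * 1 \<le> mean2 ?F" by linarith
  then show ?case by (simp only: val.simps mass.simps)
next
  case (Act k \<delta> T)
  let ?T = "Act k \<delta> T"
  let ?F = "\<lambda>x s. payoff r (play E ?T M x s) j"
  have bm: "bounded_meas ?F" by (rule bounded_meas_payoff(2)[OF Act.prems E adapted_0])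
  have v: "valid Z e T" and \<delta>: "0 < \<delta>" "\<delta> \<le> 1/2" using Act.prems by auto
  define M' where "M' = (\<lambda>i. if i = k then M i else (1 - \<delta>) * M i)"
  define J where "J = mean2 (\<lambda>x s. payoff r (play E T M' x s) j)"
  have "?F x (case_nat y s) = \<delta> * r {k} j + (1 - \<delta>) * payoff r (play E T M' y s) j" for x y s
  proof -
    have "probs (play E ?T M x (case_nat y s) t)" for t by (rule probs_play[OF Act.prems E])
    from payoff_Suc[of "play E ?T M x (case_nat y s)", OF this r_bound, where j = j] show ?thesis
      by (simp add: stage_one M'_def)
  qed
  then have I: "(\<integral>s. ?F x s \<partial>signal_space) = \<delta> * r {k} j + (1 - \<delta>) * J" if "x \<in> {0..1}" for x
    using integral_eq_mean2[OF bm that] mean2_affine[OF bounded_meas_payoff(2)[OF v E adapted_0]]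
    unfolding J_def by simp
  have "mean2 (\<lambda>x s. - ?F x s) \<le> - (\<delta> * r {k} j + (1 - \<delta>) * J)"
  proof (rule mean2_le[OF bounded_meas_uminus[OF bm]])
    fix x :: real assume "x \<in> {0..1}"
    from I[OF this] show "(\<integral>s. - ?F x s \<partial>signal_space) \<le> - (\<delta> * r {k} j + (1 - \<delta>) * J)"
      unfolding integral_minus by (simp only: order_refl)
  qed
  then have "\<delta> * r {k} j + (1 - \<delta>) * J \<le> mean2 ?F" unfolding mean2_uminus by linarith
  moreover have "(1 - \<delta>) * (val T $ j - 4 * mass T) \<le> (1 - \<delta>) * J"
    unfolding J_def using Act.IH[OF v] \<delta> by (intro mult_left_mono) auto
  moreover have "val ?T $ j - 4 * mass ?T = \<delta> * r {k} j + (1 - \<delta>) * (val T $ j - 4 * mass T)"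
    by (simp add: solo_def algebra_simps)
  ultimately show ?case by linarith
next
  case (Mix p T1 T2)
  have p: "0 < p" "p < 1" and v: "valid Z e T1" "valid Z e T2" using Mix.prems by auto
  let ?F1 = "\<lambda>x s. payoff r (play E T1 M x s) j"
  let ?F2 = "\<lambda>x s. payoff r (play E T2 M x s) j"
  have I: "mean2 (\<lambda>x s. payoff r (play E (Mix p T1 T2) M x s) j) = p * mean2 ?F1 + (1 - p) * mean2 ?F2"
  proof (rule mean2_Mix[OF bounded_meas_payoff(2)[OF Mix.prems E adapted_0]
        bounded_meas_payoff(2)[OF v(1) E adapted_0] bounded_meas_payoff(2)[OF v(2) E adapted_0] p])
    fix x :: real and s :: "nat \<Rightarrow> real"
    show "payoff r (play E (Mix p T1 T2) M (p * x) s) j = ?F1 x s" if "0 \<le> x" "x < 1"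
    proof -
      have "play E (Mix p T1 T2) M (p * x) s = play E T1 M x s" using p that by (intro ext) simp
      then show ?thesis by simp
    qed
    show "payoff r (play E (Mix p T1 T2) M (p + (1 - p) * x) s) j = ?F2 x s" if "0 \<le> x" "x \<le> 1"
    proof -
      have "\<not> p + (1 - p) * x < p" using p that by (simp add: not_less)
      then have "play E (Mix p T1 T2) M (p + (1 - p) * x) s = play E T2 M x s" using p by (intro ext) simp
      then show ?thesis by simp
    qed
  qed
  have "p * (val T1 $ j - 4 * mass T1) + (1 - p) * (val T2 $ j - 4 * mass T2) \<le> p * mean2 ?F1 + (1 - p) * mean2 ?F2"
    using Mix.IH(1)[OF v(1)] Mix.IH(2)[OF v(2)] p by (intro add_mono mult_left_mono) auto
  then show ?case unfolding I by (simp add: algebra_simps)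
qed

section \<open>Strategy profiles from plans\<close>

definition tree_profile :: "(('i \<Rightarrow> real) \<Rightarrow> 'i \<Rightarrow> real) \<Rightarrow> 'i tree \<Rightarrow> 'i profile" where
  "tree_profile E T i t h = play E T (\<lambda>_. 1) (h 0) (\<lambda>n. h (Suc n)) t i"

lemma qprob_tree_profile: "qprob (tree_profile E T) t (case_nat x s) = play E T (\<lambda>_. 1) x s t"
proof
  fix i
  have "play E T (\<lambda>_. 1) x (\<lambda>n. restrict (case_nat x s) {..t} (Suc n)) t = play E T (\<lambda>_. 1) x s t"
    by (rule play_cong) simp
  then show "qprob (tree_profile E T) t (case_nat x s) i = play E T (\<lambda>_. 1) x s t i"
    by (simp add: qprob_def tree_profile_def)
qed

lemma tree_profile_strategy:
  assumes "valid Z e T" "\<And>M. probs (E M)"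
  shows "is_strategy (tree_profile E T i)"
  unfolding is_strategy_def
proof (intro allI conjI ballI)
  fix t
  have m: "(\<lambda>h. h n) \<in> borel_measurable (history_space t)" if "n \<le> t" for n
    unfolding history_space_def
    using that by (intro measurable_compose[OF measurable_component_singleton[of n] measurable_unif01_borel]) auto
  show "tree_profile E T i t \<in> borel_measurable (history_space t)"
    unfolding tree_profile_def by (rule play_measurable) (use m in auto)
  fix h show "0 \<le> tree_profile E T i t h" "tree_profile E T i t h \<le> 1"
    using probs_play[OF assms, where M = "\<lambda>_. 1" and x = "h 0" and s = "\<lambda>n. h (Suc n)" and t = t] by (auto simp: probs_def tree_profile_def)
qed

lemma exp_payoff_split:
  assumes "\<And>i. is_strategy (\<xi> i)"
  shows "exp_payoff r \<xi> j = mean2 (\<lambda>x s. payoff r (\<lambda>t. qprob \<xi> t (case_nat x s)) j)"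
proof -
  \<comment> \<open>Set to 0 off the signal space, since splitting off the first signal uses a bound
    at every argument.\<close>
  define f where "f s = (if s \<in> space signal_space then payoff r (\<lambda>t. qprob \<xi> t s) j else 0)" for s
  have "(\<lambda>s. payoff r (\<lambda>t. qprob \<xi> t s) j) \<in> borel_measurable signal_space"
    using integrable_payoff[OF assms r_bound] by (rule borel_measurable_integrable)
  then have f: "f \<in> borel_measurable signal_space" unfolding f_def by (subst measurable_cong) auto
  have "\<bar>f s\<bar> \<le> 2" for s
  proof (cases "s \<in> space signal_space")
    case True
    then show ?thesis using payoff_bound[OF probs_qprob[OF assms True] r_bound] by (simp add: f_def)
  qed (simp add: f_def)
  note split = integral_signal_split[OF f this]
  have "exp_payoff r \<xi> j = (\<integral>s. f s \<partial>signal_space)"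
    unfolding exp_payoff_def cond_payoff_eq_payoff by (rule Bochner_Integration.integral_cong) (auto simp: f_def)
  also have "\<dots> = mean2 (\<lambda>x s. f (case_nat x s))" unfolding split mean2_def ..
  also have "\<dots> = mean2 (\<lambda>x s. payoff r (\<lambda>t. qprob \<xi> t (case_nat x s)) j)"
    unfolding mean2_def
  proof (intro Bochner_Integration.integral_cong refl)
    fix x s assume "x \<in> space unif01" "s \<in> space signal_space"
    then have "case_nat x s \<in> space signal_space"
      using measurable_space[OF measurable_case_nat_pair, of "(x, s)"] by (simp add: space_pair_measure)
    then show "f (case_nat x s) = payoff r (\<lambda>t. qprob \<xi> t (case_nat x s)) j" by (simp add: f_def)
  qed
  finally show ?thesis .
qed

lemma tree_profile_deviation:
  assumes E: "\<And>M. probs (E M)"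
    and E_pun: "\<And>M. (\<forall>i\<in>N. \<forall>j. j \<notin> N \<longrightarrow> M j \<le> M i) \<Longrightarrow> \<exists>i. (\<forall>j. M j \<le> M i) \<and>
       (\<forall>d. (\<forall>t. 0 \<le> d t \<and> d t \<le> 1) \<longrightarrow> payoff r (\<lambda>t. (E M)(i := d t)) i \<le> 2 * e)"
    and \<kappa>: "0 < \<kappa>" and e: "0 < e"
    and T: "valid UNIV e T" "actors T \<subseteq> N" and \<xi>': "is_strategy \<xi>'"
  shows "exp_payoff r ((tree_profile E T)(j := \<xi>')) j \<le>
     exp_payoff r (tree_profile E T) j + (3 * e + 2 * e * duration T + 2 * (\<kappa> + mass T / \<kappa>) + 4 * mass T)"
proof -
  let ?\<xi> = "tree_profile E T"
  have st: "is_strategy (?\<xi> i)" for i by (rule tree_profile_strategy[OF T(1) E])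
  have st': "is_strategy ((?\<xi>(j := \<xi>')) i)" for i using st \<xi>' by simp
  define h where "h t x s = restrict (case_nat x s) {..t}" for t :: nat and x :: real and s :: "nat \<Rightarrow> real"
  have h: "(\<lambda>(x, s). h t x s) \<in> measurable signal_pairs (history_space t)" for t
    using measurable_compose[OF measurable_case_nat_pair measurable_restrict_signal, of t]
    by (simp add: h_def case_prod_beta')
  \<comment> \<open>\<open>\<xi>'\<close> takes values in [0,1] on genuine histories, whereas
    \<open>adapted\<close> asks for this everywhere; on genuine histories the clipping changes
    nothing.\<close>
  define D where "D x s t = max 0 (min 1 (\<xi>' t (h t x s)))" for x s t
  have D: "adapted D"
  proof -
    have "(\<lambda>p. \<xi>' t (case p of (x, s) \<Rightarrow> h t x s)) \<in> borel_measurable signal_pairs" for t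
      using \<xi>' by (intro measurable_compose[OF h]) (simp add: is_strategy_def)
    then have "(\<lambda>(x, s). D x s t) \<in> borel_measurable signal_pairs" for t
      unfolding D_def by (simp add: case_prod_beta')
    moreover have "h t x s = h t x s'" if "\<forall>n<t. s n = s' n" for t x s s'
      unfolding h_def using that by (auto simp: restrict_def fun_eq_iff split: nat.split)
    then have "D x s t = D x s' t" if "\<forall>n<t. s n = s' n" for t x s s' using that unfolding D_def by metis
    moreover have "0 \<le> D x s t \<and> D x s t \<le> 1" for x s t by (simp add: D_def)
    ultimately show ?thesis unfolding adapted_def by blast
  qed
  have "exp_payoff r (?\<xi>(j := \<xi>')) j = mean2 (\<lambda>x s. payoff r (\<lambda>t. qprob (?\<xi>(j := \<xi>')) t (case_nat x s)) j)"
    by (rule exp_payoff_split[OF st'])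
  also have "\<dots> = mean2 (\<lambda>x s. payoff r (\<lambda>t. (play E T (\<lambda>_. 1) x s t)(j := D x s t)) j)"
    unfolding mean2_def
  proof (intro Bochner_Integration.integral_cong refl)
    fix x s assume xs: "x \<in> space unif01" "s \<in> space signal_space"
    have "qprob (?\<xi>(j := \<xi>')) t (case_nat x s) = (play E T (\<lambda>_. 1) x s t)(j := D x s t)" for t
    proof -
      have "h t x s \<in> space (history_space t)"
        using measurable_space[OF h, of "(x, s)"] xs by (simp add: space_pair_measure)
      then have "D x s t = \<xi>' t (h t x s)" using \<xi>' by (simp add: D_def is_strategy_def)
      moreover have "qprob (?\<xi>(j := \<xi>')) t (case_nat x s) = (qprob ?\<xi> t (case_nat x s))(j := \<xi>' t (h t x s))"
        by (auto simp: qprob_def h_def)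
      ultimately show ?thesis by (simp add: qprob_tree_profile)
    qed
    then show "payoff r (\<lambda>t. qprob (?\<xi>(j := \<xi>')) t (case_nat x s)) j = payoff r (\<lambda>t. (play E T (\<lambda>_. 1) x s t)(j := D x s t)) j"
      by simp
  qed
  also have "\<dots> \<le> val T $ j + 3 * e + 2 * e * duration T + 2 * (\<kappa> + mass T / \<kappa>)"
    using deviation_bound[of E N e \<kappa> T "\<lambda>_. 1" 1 D j, OF E E_pun \<kappa> e T] D by simp
  finally have 1: "exp_payoff r (?\<xi>(j := \<xi>')) j \<le> val T $ j + 3 * e + 2 * e * duration T + 2 * (\<kappa> + mass T / \<kappa>)" .
  have "val T $ j - 4 * mass T \<le> mean2 (\<lambda>x s. payoff r (play E T (\<lambda>_. 1) x s) j)"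
    by (rule on_path_bound[OF E T(1)])
  also have "\<dots> = exp_payoff r ?\<xi> j"
    unfolding exp_payoff_split[OF st] qprob_tree_profile ..
  finally show ?thesis using 1 by linarith
qed

section \<open>Punishment of a single player\<close>

definition punishable :: "'i set" where
  "punishable = {i. r {} i \<le> 0 \<or> (\<exists>k. k \<noteq> i \<and> r {k} i \<le> 0)}"

text \<open>If \<open>r {} i \<le> 0\<close>, the others continue forever. Otherwise some
  \<open>k\<close> with \<open>r {k} i \<le> 0\<close> quits with probability \<open>e\<close> at
  every stage: then \<open>i\<close> gets 0 by quitting alone and at most 0 by waiting, and only
  quitting together with \<open>k\<close>, which has probability at most \<open>e\<close>, can bring
  up to 2.\<close>

lemma punishment_exists:
  assumes i: "i \<in> punishable" and e: "0 < e" "e \<le> 1"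
  shows "\<exists>y. probs y \<and> (\<forall>d. (\<forall>t. 0 \<le> d t \<and> d t \<le> 1) \<longrightarrow> payoff r (\<lambda>t. y(i := d t)) i \<le> 2 * e)"
proof (cases "r {} i \<le> 0")
  case True
  show ?thesis
  proof (intro exI[of _ "\<lambda>_. 0"] conjI allI impI)
    show "probs (\<lambda>_. 0)" by (simp add: probs_def)
    fix d :: "nat \<Rightarrow> real" assume d: "\<forall>t. 0 \<le> d t \<and> d t \<le> 1"
    then have Q: "probs ((\<lambda>_. 0)(i := d t))" for t by (simp add: probs_def)
    show "payoff r (\<lambda>t. (\<lambda>_. 0)(i := d t)) i \<le> 2 * e"
    proof (rule payoff_le[of _ r i 2, OF Q r_bound])
      fix t show "stage_payoff r ((\<lambda>_. 0)(i := d t)) i \<le> 2 * e * quits ((\<lambda>_. 0)(i := d t))"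
        unfolding stage_one r_own using d e by simp
    qed (use True e in simp)
  qed
next
  case False
  then obtain k where k: "k \<noteq> i" "r {k} i \<le> 0" using i by (auto simp: punishable_def)
  show ?thesis
  proof (intro exI[of _ "(\<lambda>_. 0)(k := e)"] conjI allI impI)
    show "probs ((\<lambda>_. 0)(k := e))" using e by (simp add: probs_def)
    fix d :: "nat \<Rightarrow> real" assume d: "\<forall>t. 0 \<le> d t \<and> d t \<le> 1"
    then have Q: "probs ((\<lambda>_. 0)(k := e, i := d t))" for t using e by (simp add: probs_def)
    have q: "1 - quits ((\<lambda>_. 0)(k := e, i := d t)) = (1 - d t) * (1 - e)" for t
      using k by (intro stage_two(2)) auto
    have q1: "d t \<le> quits ((\<lambda>_. 0)(k := e, i := d t))" "e \<le> quits ((\<lambda>_. 0)(k := e, i := d t))" for t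
    proof -
      have "quits ((\<lambda>_. 0)(k := e, i := d t)) = d t + e * (1 - d t)"
        "quits ((\<lambda>_. 0)(k := e, i := d t)) = e + d t * (1 - e)"
        using q[of t] by (simp_all add: algebra_simps)
      moreover have "0 \<le> e * (1 - d t)" "0 \<le> d t * (1 - e)" using d e by simp_all
      ultimately show "d t \<le> quits ((\<lambda>_. 0)(k := e, i := d t))" "e \<le> quits ((\<lambda>_. 0)(k := e, i := d t))"
        by linarith+
    qed
    show "payoff r (\<lambda>t. (\<lambda>_. 0)(k := e, i := d t)) i \<le> 2 * e"
    proof (rule payoff_le[of _ r i 2, OF Q r_bound])
      fix t
      have "stage_payoff r ((\<lambda>_. 0)(k := e, i := d t)) i = d t * (e * r {i, k} i) + (1 - d t) * (e * r {k} i)"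
        using k by (intro stage_two) auto
      moreover have "d t * (e * r {i, k} i) \<le> d t * (e * 2)"
        using d e r_bound[of "{i, k}" i] by (intro mult_left_mono) (auto simp: abs_le_iff)
      moreover have "(1 - d t) * (e * r {k} i) \<le> 0"
        using d e k by (intro mult_nonneg_nonpos) (auto simp: mult_nonneg_nonpos)
      moreover have "2 * e * d t \<le> 2 * e * quits ((\<lambda>_. 0)(k := e, i := d t))"
        using q1(1) e by (intro mult_left_mono) auto
      ultimately show "stage_payoff r ((\<lambda>_. 0)(k := e, i := d t)) i \<le> 2 * e * quits ((\<lambda>_. 0)(k := e, i := d t))"
        by (simp add: mult_ac)
    qed (use lim_survival_0[OF Q q1(2) e(1)] in simp)
  qed
qed

text \<open>A branch is stopped, with its current value as promise, once its \<open>\<delta>\<close>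
  add up to \<open>L\<close>; by \<open>1 - \<delta> \<le> exp (- \<delta>)\<close> this adds mass
  at most \<open>exp (- L)\<close>. The last step overshoots by at most 1/2. The duration is now
  bounded independently of \<open>e\<close>.\<close>

lemma truncate_tree:
  "valid Z e T \<Longrightarrow> \<exists>T'. valid Z e T' \<and> val T' = val T \<and> actors T' \<subseteq> actors T \<and>
     mass T' \<le> mass T + exp (- L) \<and> duration T' \<le> (if L \<le> 0 then 0 else L + 1/2)"
proof (induction T arbitrary: L)
  case (Stop w)
  then show ?case by (intro exI[of _ "Stop w"]) auto
next
  case (Act i \<delta> T)
  have v: "valid Z e T" and \<delta>: "0 < \<delta>" "\<delta> \<le> 1/2" using Act.prems by auto
  show ?case
  proof (cases "L \<le> 0")
    case True
    have "valid Z e (Stop (val (Act i \<delta> T)))"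
      using val_bound[OF Act.prems] Act.prems by (auto simp del: val.simps)
    moreover have "1 \<le> mass (Act i \<delta> T) + exp (- L)"
      using mass_nonneg[OF Act.prems] True one_le_exp_iff[of "- L"] by linarith
    ultimately show ?thesis using True by (intro exI[of _ "Stop (val (Act i \<delta> T))"]) (auto simp del: val.simps simp: val.simps(1))
  next
    case False
    obtain T' where T': "valid Z e T'" "val T' = val T" "actors T' \<subseteq> actors T"
     "mass T' \<le> mass T + exp (- (L - \<delta>))" "duration T' \<le> (if L - \<delta> \<le> 0 then 0 else L - \<delta> + 1/2)"
      using Act.IH[OF v, of "L - \<delta>"] by blast
    have "(1 - \<delta>) * exp \<delta> \<le> 1"
    proof -
      have "(1 - \<delta>) * exp \<delta> \<le> exp (- \<delta>) * exp \<delta>"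
        using exp_ge_add_one_self[of "- \<delta>"] by (intro mult_right_mono) auto
      then show ?thesis by (simp flip: exp_add)
    qed
    then have "(1 - \<delta>) * exp \<delta> * exp (- L) \<le> 1 * exp (- L)" by (rule mult_right_mono) simp
    moreover have "exp (- (L - \<delta>)) = exp \<delta> * exp (- L)" by (simp flip: exp_add)
    moreover have "(1 - \<delta>) * mass T' \<le> (1 - \<delta>) * (mass T + exp (- (L - \<delta>)))"
      using T'(4) \<delta> by (intro mult_left_mono) auto
    ultimately have "mass (Act i \<delta> T') \<le> mass (Act i \<delta> T) + exp (- L)"
      by (simp only: mass.simps distrib_left mult.assoc mult_1)
    moreover have "duration (Act i \<delta> T') \<le> L + 1/2" using T'(5) False \<delta> by (auto split: if_splits)
    moreover have "valid Z e (Act i \<delta> T')" using Act.prems T'(1,2) by simp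
    ultimately show ?thesis using T'(2,3) False by (intro exI[of _ "Act i \<delta> T'"]) auto
  qed
next
  case (Mix p T1 T2)
  have p: "0 < p" "p < 1" and v: "valid Z e T1" "valid Z e T2" using Mix.prems by auto
  obtain T1' where 1: "valid Z e T1'" "val T1' = val T1" "actors T1' \<subseteq> actors T1"
     "mass T1' \<le> mass T1 + exp (- L)" "duration T1' \<le> (if L \<le> 0 then 0 else L + 1/2)"
    using Mix.IH(1)[OF v(1), of L] by blast
  obtain T2' where 2: "valid Z e T2'" "val T2' = val T2" "actors T2' \<subseteq> actors T2"
     "mass T2' \<le> mass T2 + exp (- L)" "duration T2' \<le> (if L \<le> 0 then 0 else L + 1/2)"
    using Mix.IH(2)[OF v(2), of L] by blast
  have "p * mass T1' + (1 - p) * mass T2' \<le> p * (mass T1 + exp (- L)) + (1 - p) * (mass T2 + exp (- L))"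
    using p 1 2 by (intro add_mono mult_left_mono) auto
  then have "mass (Mix p T1' T2') \<le> mass (Mix p T1 T2) + exp (- L)" by (simp add: algebra_simps)
  then show ?case using 1 2 p by (intro exI[of _ "Mix p T1' T2'"]) auto
qed

text \<open>Promised vectors may be changed outside \<open>N\<close>: the entries there are set to
  0, and nonnegative solo payoffs of the actors keep the values of these players nonnegative
  throughout.\<close>

lemma extend_tree:
  assumes N: "\<And>k j. k \<in> N \<Longrightarrow> j \<notin> N \<Longrightarrow> 0 \<le> solo k $ j" and e: "0 < e"
  shows "valid N e T \<Longrightarrow> \<exists>T'. valid UNIV e T' \<and> actors T' \<subseteq> N \<and> mass T' = mass T \<and>
    (\<forall>j\<in>N. val T' $ j = val T $ j) \<and> (\<forall>j. j \<notin> N \<longrightarrow> 0 \<le> val T' $ j)"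
proof (induction T)
  case (Stop w)
  define w' where "w' = (\<chi> j. if j \<in> N then w $ j else 0)"
  have "valid UNIV e (Stop w')" using Stop e by (auto simp: w'_def)
  then show ?case by (intro exI[of _ "Stop w'"]) (auto simp: w'_def)
next
  case (Act i \<delta> T)
  have v: "valid N e T" and \<delta>: "0 < \<delta>" "\<delta> \<le> 1/2" "i \<in> N" using Act.prems by auto
  obtain T' where T': "valid UNIV e T'" "actors T' \<subseteq> N" "mass T' = mass T"
    "\<And>j. j \<in> N \<Longrightarrow> val T' $ j = val T $ j" "\<And>j. j \<notin> N \<Longrightarrow> 0 \<le> val T' $ j"
    using Act.IH[OF v] by blast
  have a: "val (Act i \<delta> T') $ j = val (Act i \<delta> T) $ j" if "j \<in> N" for j using T'(4)[OF that] by simp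
  have b: "0 \<le> val (Act i \<delta> T') $ j" if "j \<notin> N" for j using T'(5)[OF that] N[OF \<delta>(3) that] \<delta> by simp
  have "- e \<le> val (Act i \<delta> T') $ j" for j
    using Act.prems a[of j] b[of j] e by (cases "j \<in> N") (auto simp del: val.simps intro: order_trans[of "- e" 0])
  moreover have "\<bar>val (Act i \<delta> T') $ i\<bar> \<le> e" using Act.prems a[OF \<delta>(3)] by (simp del: val.simps)
  ultimately have "valid UNIV e (Act i \<delta> T')" using Act.prems T'(1) by (simp del: val.simps)
  then show ?case using T' a b \<delta> by (intro exI[of _ "Act i \<delta> T'"]) (simp del: val.simps)
next
  case (Mix p T1 T2)
  have p: "0 < p" "p < 1" and v: "valid N e T1" "valid N e T2" using Mix.prems by auto
  obtain T1' where 1: "valid UNIV e T1'" "actors T1' \<subseteq> N" "mass T1' = mass T1"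
    "\<forall>j\<in>N. val T1' $ j = val T1 $ j" "\<forall>j. j \<notin> N \<longrightarrow> 0 \<le> val T1' $ j" using Mix.IH(1)[OF v(1)] by blast
  obtain T2' where 2: "valid UNIV e T2'" "actors T2' \<subseteq> N" "mass T2' = mass T2"
    "\<forall>j\<in>N. val T2' $ j = val T2 $ j" "\<forall>j. j \<notin> N \<longrightarrow> 0 \<le> val T2' $ j" using Mix.IH(2)[OF v(2)] by blast
  show ?case using 1 2 p by (intro exI[of _ "Mix p T1' T2'"]) auto
qed

lemma punishable_solo: "k \<in> punishable \<Longrightarrow> j \<notin> punishable \<Longrightarrow> 0 \<le> solo k $ j"
  by (auto simp: punishable_def solo_def intro: less_imp_le) (metis not_le order_less_imp_le)

lemma reachable_zero_equilibrium:
  assumes d: "(d, 0) \<in> reachable punishable" and N: "punishable \<noteq> {}" and \<epsilon>: "0 < \<epsilon>"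
  shows "\<exists>\<xi>. sunspot_eps_equilibrium r \<epsilon> \<xi>"
proof -
  \<comment> \<open>The order of choice is \<open>\<kappa>\<close>, \<open>m\<close>,
    \<open>L\<close>, \<open>e\<close>: \<open>m \<le> \<kappa> * \<kappa>\<close> makes
    \<open>m / \<kappa>\<close> small, \<open>L\<close> depends on \<open>m\<close> only, and
    \<open>e\<close> comes last, so that \<open>e\<close> times the duration, which is at most
    \<open>L + 1/2\<close>, is small.\<close>
  define \<kappa> where "\<kappa> = \<epsilon> / 16"
  define m where "m = min (\<kappa> * \<kappa>) (\<epsilon> / 32)"
  have \<kappa>: "0 < \<kappa>" and m: "0 < m" using \<epsilon> by (auto simp: \<kappa>_def m_def)
  define L where "L = max 1 (- ln (m / 2))"
  have L: "0 < L" "exp (- L) \<le> m / 2"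
  proof -
    show "0 < L" by (simp add: L_def)
    have "exp (- L) \<le> exp (ln (m / 2))" by (simp add: L_def)
    then show "exp (- L) \<le> m / 2" using m by simp
  qed
  define e where "e = min (1/2) (min (m / 2) (\<epsilon> / (8 * (2 * L + 4))))"
  have e: "0 < e" "e \<le> 1" using m L \<epsilon> by (auto simp: e_def)
  have e3: "e \<le> m / 2" unfolding e_def by (rule order_trans[OF min.cobounded2 min.cobounded1])
  have eL: "e * (2 * L + 4) \<le> \<epsilon> / 8"
  proof -
    have "e \<le> \<epsilon> / (8 * (2 * L + 4))" by (simp add: e_def)
    then have "e * (8 * (2 * L + 4)) \<le> \<epsilon>" using L by (subst (asm) pos_le_divide_eq) auto
    then show ?thesis by (simp add: algebra_simps)
  qed
  obtain T0 where T0: "valid punishable e T0" "mass T0 \<le> e" using reachableD[OF d e(1)] by auto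
  obtain T1 where T1: "valid UNIV e T1" "actors T1 \<subseteq> punishable" "mass T1 = mass T0"
    using extend_tree[OF punishable_solo e(1) T0(1)] by blast
  obtain T where T: "valid UNIV e T" "actors T \<subseteq> punishable" "mass T \<le> mass T1 + exp (- L)" "duration T \<le> L + 1/2"
    using truncate_tree[OF T1(1), of L] T1(2) L(1) by auto
  have mT: "0 \<le> mass T" "mass T \<le> m" using mass_nonneg[OF T(1)] T(3) T0(2) T1(3) L(2) e3 by linarith+
  have "\<forall>i\<in>punishable. \<exists>y. probs y \<and> (\<forall>d. (\<forall>t. 0 \<le> d t \<and> d t \<le> 1) \<longrightarrow> payoff r (\<lambda>t. y(i := d t)) i \<le> 2 * e)"
    using punishment_exists[OF _ e(1,2)] by blast
  then obtain pun where pun: "\<And>i. i \<in> punishable \<Longrightarrow> probs (pun i)"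
    "\<And>i d. i \<in> punishable \<Longrightarrow> (\<And>t. 0 \<le> d t \<and> d t \<le> 1) \<Longrightarrow> payoff r (\<lambda>t. (pun i)(i := d t)) i \<le> 2 * e"
    using bchoice[of punishable "\<lambda>i y. probs y \<and> (\<forall>d. (\<forall>t. 0 \<le> d t \<and> d t \<le> 1) \<longrightarrow> payoff r (\<lambda>t. y(i := d t)) i \<le> 2 * e)"]
    by blast
  have "\<exists>i. i \<in> punishable \<and> (\<forall>j\<in>punishable. M j \<le> M i)" for M :: "'i \<Rightarrow> real"
  proof -
    have "Max (M ` punishable) \<in> M ` punishable" using N by (intro Max_in) auto
    then obtain i where "i \<in> punishable" "M i = Max (M ` punishable)" by auto
    then show ?thesis by (intro exI[of _ i]) auto
  qed
  then have "\<forall>M :: 'i \<Rightarrow> real. \<exists>i. i \<in> punishable \<and> (\<forall>j\<in>punishable. M j \<le> M i)" by blast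
  from choice[OF this] obtain top where top: "\<And>M. top M \<in> punishable" "\<And>M :: 'i \<Rightarrow> real. \<And>j. j \<in> punishable \<Longrightarrow> M j \<le> M (top M)"
    by blast
  define E where "E M = pun (top M)" for M
  have E: "probs (E M)" for M using pun(1)[OF top(1)] by (simp add: E_def)
  have E_pun: "\<exists>i. (\<forall>j. M j \<le> M i) \<and> (\<forall>d. (\<forall>t. 0 \<le> d t \<and> d t \<le> 1) \<longrightarrow> payoff r (\<lambda>t. (E M)(i := d t)) i \<le> 2 * e)"
    if "\<forall>i\<in>punishable. \<forall>j. j \<notin> punishable \<longrightarrow> M j \<le> M i" for M
  proof (intro exI[of _ "top M"] conjI allI impI)
    fix j show "M j \<le> M (top M)" using that top by blast
  next
    fix d :: "nat \<Rightarrow> real" assume "\<forall>t. 0 \<le> d t \<and> d t \<le> 1"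
    then show "payoff r (\<lambda>t. (E M)(top M := d t)) (top M) \<le> 2 * e" unfolding E_def by (intro pun(2) top(1)) auto
  qed
  have err: "3 * e + 2 * e * duration T + 2 * (\<kappa> + mass T / \<kappa>) + 4 * mass T \<le> \<epsilon>"
  proof -
    have "2 * e * duration T \<le> 2 * e * (L + 1/2)" using T(4) e(1) by (intro mult_left_mono) auto
    then have 1: "3 * e + 2 * e * duration T \<le> \<epsilon> / 8" using eL by (simp add: algebra_simps)
    have "mass T / \<kappa> \<le> \<kappa>" using mT(2) \<kappa> by (simp add: pos_divide_le_eq m_def)
    then have 2: "2 * (\<kappa> + mass T / \<kappa>) \<le> \<epsilon> / 4" by (simp add: \<kappa>_def)
    have "4 * mass T \<le> \<epsilon> / 8" using mT(2) by (simp add: m_def)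
    then show ?thesis using 1 2 \<epsilon> by linarith
  qed
  show ?thesis
  proof (intro exI[of _ "tree_profile E T"], unfold sunspot_eps_equilibrium_def, intro conjI allI impI)
    fix i show "is_strategy (tree_profile E T i)" by (rule tree_profile_strategy[OF T(1) E])
    fix \<xi>' assume "is_strategy \<xi>'"
    from tree_profile_deviation[OF E E_pun \<kappa> e(1) T(1,2) this, of i] err
    show "exp_payoff r ((tree_profile E T)(i := \<xi>')) i - \<epsilon> \<le> exp_payoff r (tree_profile E T) i" by linarith
  qed
qed

section \<open>Stationary equilibria\<close>

text \<open>Given the signals, a deviation is a deterministic sequence \<open>d\<close>; the bound
  holds for each realisation and is integrated.\<close>

lemma signal_free_equilibrium:
  assumes Q: "\<And>t. probs (Q t)"
    and dev: "\<And>j d. (\<And>t. 0 \<le> d t \<and> d t \<le> 1) \<Longrightarrow> payoff r (\<lambda>t. (Q t)(j := d t)) j \<le> payoff r Q j + \<epsilon>"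
  shows "\<exists>\<xi>. sunspot_eps_equilibrium r \<epsilon> \<xi>"
proof (intro exI[of _ "\<lambda>i t h. Q t i"], unfold sunspot_eps_equilibrium_def, intro conjI allI impI)
  let ?\<xi> = "\<lambda>i t h. Q t i"
  show st: "is_strategy (?\<xi> i)" for i using Q by (simp add: is_strategy_def probs_def)
  fix j \<xi>' assume \<xi>': "is_strategy \<xi>'"
  have st': "is_strategy ((?\<xi>(j := \<xi>')) i)" for i using st \<xi>' by simp
  have "exp_payoff r (?\<xi>(j := \<xi>')) j \<le> (\<integral>s. payoff r Q j + \<epsilon> \<partial>signal_space)"
    unfolding exp_payoff_def cond_payoff_eq_payoff
  proof (rule integral_mono[OF integrable_payoff[OF st' r_bound]])
    fix s assume s: "s \<in> space signal_space"
    have "qprob (?\<xi>(j := \<xi>')) t s = (Q t)(j := qprob (?\<xi>(j := \<xi>')) t s j)" for t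
      by (auto simp: qprob_def)
    moreover have "0 \<le> qprob (?\<xi>(j := \<xi>')) t s j \<and> qprob (?\<xi>(j := \<xi>')) t s j \<le> 1" for t
      using probs_qprob[of "?\<xi>(j := \<xi>')", OF st' s] by (simp add: probs_def)
    ultimately show "payoff r (\<lambda>t. qprob (?\<xi>(j := \<xi>')) t s) j \<le> payoff r Q j + \<epsilon>"
      using dev[of "\<lambda>t. qprob (?\<xi>(j := \<xi>')) t s j" j] by simp
  qed simp
  moreover have "exp_payoff r ?\<xi> j = payoff r Q j"
  proof -
    have "(\<lambda>t. qprob ?\<xi> t s) = Q" for s by (auto simp: qprob_def fun_eq_iff)
    then show ?thesis unfolding exp_payoff_def cond_payoff_eq_payoff by (simp add: S.prob_space)
  qed
  ultimately show "exp_payoff r (?\<xi>(j := \<xi>')) j - \<epsilon> \<le> exp_payoff r ?\<xi> j" by (simp add: S.prob_space)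
qed

text \<open>With nobody punishable, eternal continuation pays everybody more than the 0 from
  quitting alone.\<close>

lemma all_continue_equilibrium:
  assumes "punishable = {}" "0 < \<epsilon>"
  shows "\<exists>\<xi>. sunspot_eps_equilibrium r \<epsilon> \<xi>"
proof (rule signal_free_equilibrium[of "\<lambda>_ _. 0"])
  show Q: "probs (\<lambda>_. 0 :: real)" by (simp add: probs_def)
  fix j and d :: "nat \<Rightarrow> real" assume d: "\<And>t. 0 \<le> d t \<and> d t \<le> 1"
  have r0: "0 \<le> r {} j" using assms by (auto simp: punishable_def not_le intro: less_imp_le)
  have "payoff r (\<lambda>t. (\<lambda>_. 0)(j := d t)) j \<le> r {} j"
  proof (rule payoff_le[of _ r j 2, OF _ r_bound])
    fix t
    show "probs ((\<lambda>_. 0)(j := d t))" using d by (simp add: probs_def)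
    show "stage_payoff r ((\<lambda>_. 0)(j := d t)) j \<le> r {} j * quits ((\<lambda>_. 0)(j := d t))"
      unfolding stage_one r_own using r0 d by simp
  qed simp
  moreover have "r {} j \<le> payoff r (\<lambda>_ _. 0) j"
    by (rule payoff_ge[of _ r j 2, OF Q r_bound]) (simp_all add: quits_def stage_payoff_def outcome_mean_none)
  ultimately show "payoff r (\<lambda>t. (\<lambda>_. 0)(j := d t)) j \<le> payoff r (\<lambda>_ _. 0) j + \<epsilon>" using assms(2) by linarith
qed

text \<open>Whoever deviates, some other player quits with a fixed positive probability at every
  stage. Play then ends almost surely, and one-shot optimality against \<open>w\<close> implies
  optimality.\<close>

lemma stationary_equilibrium:
  assumes x: "probs x" and \<epsilon>: "0 < \<epsilon>"
    and val: "\<And>j. w j = stage_payoff r x j + (1 - quits x) * w j"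
    and opt: "\<And>j d. 0 \<le> d \<Longrightarrow> d \<le> 1 \<Longrightarrow> stage_payoff r (x(j := d)) j + (1 - quits (x(j := d))) * w j \<le> w j"
    and two: "\<And>j. \<exists>k. k \<noteq> j \<and> 0 < x k"
  shows "\<exists>\<xi>. sunspot_eps_equilibrium r \<epsilon> \<xi>"
proof (rule signal_free_equilibrium[of "\<lambda>_. x"])
  fix j and d :: "nat \<Rightarrow> real" assume d: "\<And>t. 0 \<le> d t \<and> d t \<le> 1"
  obtain k where k: "k \<noteq> j" "0 < x k" using two by blast
  have Q: "probs (x(j := d t))" for t using x d by (simp add: probs_def)
  have "payoff r (\<lambda>t. x(j := d t)) j \<le> w j"
  proof (rule payoff_le[of _ r j 2, OF Q r_bound])
    fix t show "stage_payoff r (x(j := d t)) j \<le> w j * quits (x(j := d t))"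
      using opt[of "d t" j] d by (simp add: algebra_simps)
  next
    have "x k \<le> quits (x(j := d t))" for t using quits_ge[OF Q[of t], of k] k by simp
    from lim_survival_0[OF Q this k(2)] show "lim (survival (\<lambda>t. x(j := d t))) = 0 \<or> r {} j \<le> w j" by simp
  qed
  moreover have "w j \<le> payoff r (\<lambda>_. x) j"
  proof (rule payoff_ge[of _ r j 2, OF x r_bound])
    show "w j * quits x \<le> stage_payoff r x j" using val[of j] by (simp add: algebra_simps)
    from lim_survival_0[of "\<lambda>_. x", OF x quits_ge[OF x] k(2)] show "lim (survival (\<lambda>_. x)) = 0 \<or> w j \<le> r {} j" by simp
  qed
  ultimately show "payoff r (\<lambda>t. x(j := d t)) j \<le> payoff r (\<lambda>_. x) j + \<epsilon>" using \<epsilon> by linarith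
qed (rule x)

text \<open>The only quitter \<open>i\<close> could make play last forever. So \<open>x\<close> is
  played for \<open>n\<close> stages, with \<open>(1 - p) ^ n\<close> small, and then
  \<open>i\<close> is punished. One-shot optimality, carried backwards from stage \<open>n\<close>,
  deters the others.\<close>

lemma single_quitter_equilibrium:
  assumes p: "0 < p" "p \<le> 1" and i: "i \<in> punishable" and \<epsilon>: "0 < \<epsilon>" and x: "x = (\<lambda>_. 0)(i := p)"
    and val: "\<And>j. w j = stage_payoff r x j + (1 - quits x) * w j"
    and opt: "\<And>j d. 0 \<le> d \<Longrightarrow> d \<le> 1 \<Longrightarrow> stage_payoff r (x(j := d)) j + (1 - quits (x(j := d))) * w j \<le> w j"
  shows "\<exists>\<xi>. sunspot_eps_equilibrium r \<epsilon> \<xi>"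
proof -
  define e where "e = min 1 (\<epsilon> / 4)"
  have e: "0 < e" "e \<le> 1" "2 * e \<le> \<epsilon> / 2" using \<epsilon> by (auto simp: e_def)
  obtain y where y: "probs y" "\<And>d. (\<And>t. 0 \<le> d t \<and> d t \<le> 1) \<Longrightarrow> payoff r (\<lambda>t. y(i := d t)) i \<le> 2 * e"
    using punishment_exists[OF i e(1,2)] by blast
  have "\<exists>n. (1 - p) ^ n < \<epsilon> / 16" using p \<epsilon> by (intro real_arch_pow_inv) auto
  then obtain n where n: "(1 - p) ^ n < \<epsilon> / 16" by blast
  have px: "probs x" using p by (simp add: x probs_def)
  have qx: "quits x = p" "stage_payoff r x j = p * r {i} j" for j by (simp_all add: x stage_one)
  have wr: "w j = r {i} j" for j
  proof -
    have "p * (w j - r {i} j) = 0" using val[of j] unfolding qx by (simp add: algebra_simps)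
    then show ?thesis using p by simp
  qed
  have wb: "\<bar>w j\<bar> \<le> 2" for j using r_bound wr by simp
  define Q where "Q n t = (if t < n then x else y)" for n t :: nat
  have pQ: "probs (Q n t)" for n t using px y(1) by (simp add: Q_def)
  have QSuc: "Q (Suc n) (Suc t) = Q n t" "Q (Suc n) 0 = x" "Q 0 t = y" for n t by (simp_all add: Q_def)
  have path: "w j - 4 * (1 - p) ^ n \<le> payoff r (Q n) j" for n j
  proof (induction n)
    case 0
    have "\<bar>payoff r (Q 0) j\<bar> \<le> 2" by (intro payoff_bound pQ r_bound)
    then show ?case using wb[of j] by (simp add: abs_le_iff)
  next
    case (Suc n)
    have "payoff r (Q (Suc n)) j = p * r {i} j + (1 - p) * payoff r (Q n) j"
      using payoff_Suc[of "Q (Suc n)", OF pQ r_bound, where j = j] by (simp add: QSuc qx)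
    moreover have "(1 - p) * (w j - 4 * (1 - p) ^ n) \<le> (1 - p) * payoff r (Q n) j"
      using Suc p by (intro mult_left_mono) auto
    ultimately show ?case using wr[of j] by (simp add: algebra_simps)
  qed
  have other: "(\<And>t. 0 \<le> d t \<and> d t \<le> 1) \<Longrightarrow> payoff r (\<lambda>t. (Q n t)(j := d t)) j \<le> w j + 4 * (1 - p) ^ n"
    if j: "j \<noteq> i" for n j d
  proof (induction n arbitrary: d)
    case 0
    have "\<bar>payoff r (\<lambda>t. (Q 0 t)(j := d t)) j\<bar> \<le> 2" using 0 by (intro payoff_bound probs_upd pQ r_bound) auto
    then show ?case using wb[of j] unfolding abs_le_iff power_0 by linarith
  next
    case (Suc n)
    have pr: "probs ((Q (Suc n) t)(j := d t))" for t using Suc.prems pQ by (intro probs_upd) auto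
    let ?q = "quits (x(j := d 0))"
    have q: "1 - ?q = (1 - d 0) * (1 - p)" unfolding x using j by (intro stage_two(2)) auto
    have q01: "0 \<le> 1 - ?q" "1 - ?q \<le> 1 - p"
      unfolding q using Suc.prems[of 0] p by (auto intro: mult_left_le_one_le)
    have "payoff r (\<lambda>t. (Q (Suc n) t)(j := d t)) j =
        stage_payoff r (x(j := d 0)) j + (1 - ?q) * payoff r (\<lambda>t. (Q n t)(j := d (Suc t))) j"
      using payoff_Suc[of "\<lambda>t. (Q (Suc n) t)(j := d t)", OF pr r_bound, where j = j] by (simp add: QSuc)
    also have "\<dots> \<le> stage_payoff r (x(j := d 0)) j + (1 - ?q) * (w j + 4 * (1 - p) ^ n)"
      using Suc.prems q01 by (intro add_left_mono mult_left_mono Suc.IH) auto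
    also have "\<dots> \<le> w j + (1 - ?q) * (4 * (1 - p) ^ n)"
      using opt[of "d 0" j] Suc.prems[of 0] by (simp add: distrib_left)
    also have "\<dots> \<le> w j + (1 - p) * (4 * (1 - p) ^ n)"
      using q01 p by (intro add_left_mono mult_right_mono) auto
    finally show ?case unfolding power_Suc mult.left_commute[of 4 "1 - p"] .
  qed
  \<comment> \<open>Before the punishment \<open>i\<close> can only wait or quit alone for 0, so the
    bound \<open>2 * e\<close> of the punishment carries over.\<close>
  have self: "(\<And>t. 0 \<le> d t \<and> d t \<le> 1) \<Longrightarrow> payoff r (\<lambda>t. (Q n t)(i := d t)) i \<le> 2 * e" for n d
  proof (induction n arbitrary: d)
    case 0
    then show ?case unfolding QSuc by (rule y(2))
  next
    case (Suc n)
    have pr: "probs ((Q (Suc n) t)(i := d t))" for t using Suc.prems pQ by (intro probs_upd) auto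
    have xi: "x(i := d 0) = (\<lambda>_. 0)(i := d 0)" by (simp add: x)
    have "payoff r (\<lambda>t. (Q (Suc n) t)(i := d t)) i = (1 - d 0) * payoff r (\<lambda>t. (Q n t)(i := d (Suc t))) i"
      using payoff_Suc[of "\<lambda>t. (Q (Suc n) t)(i := d t)" r i 2, OF pr r_bound]
      unfolding QSuc xi stage_one r_own by simp
    also have "\<dots> \<le> (1 - d 0) * (2 * e)"
      using Suc.prems by (intro mult_left_mono Suc.IH) auto
    also have "\<dots> \<le> 1 * (2 * e)" using Suc.prems[of 0] e by (intro mult_right_mono) auto
    finally show ?case unfolding mult_1_left .
  qed
  show ?thesis
  proof (rule signal_free_equilibrium[of "Q n", OF pQ])
    fix j and d :: "nat \<Rightarrow> real" assume d: "\<And>t. 0 \<le> d t \<and> d t \<le> 1"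
    show "payoff r (\<lambda>t. (Q n t)(j := d t)) j \<le> payoff r (Q n) j + \<epsilon>"
    proof (cases "j = i")
      case True
      have "w i = 0" using wr[of i] r_own by simp
      then show ?thesis unfolding True using self[of d n, OF d] path[of i n] e(3) n \<epsilon> by linarith
    next
      case False
      then show ?thesis using other[OF False, of d n, OF d] path[of j n] n \<epsilon> by linarith
    qed
  qed
qed

section \<open>Vanishing termination probability\<close>

definition outcome :: "real \<Rightarrow> 'i \<Rightarrow> 'i set \<Rightarrow> real" where
  "outcome w j S = (if S = {} then w else r S j)"

lemma outcome_mean_outcome: "outcome_mean (outcome w j) x = stage_payoff r x j + (1 - quits x) * w"
  unfolding outcome_def by (rule one_shot[symmetric])

definition gain :: "real^'i \<Rightarrow> real^'i \<Rightarrow> 'i \<Rightarrow> real" where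
  "gain x w j = outcome_mean (outcome (w $ j) j) ((\<lambda>i. x $ i)(j := 1)) - outcome_mean (outcome (w $ j) j) ((\<lambda>i. x $ i)(j := 0))"

lemma outcome_mean_gain:
  "outcome_mean (outcome (w $ j) j) ((\<lambda>i. x $ i)(j := d)) = outcome_mean (outcome (w $ j) j) ((\<lambda>i. x $ i)(j := 0)) + d * gain x w j"
  using outcome_mean_affine[of "outcome (w $ j) j" "\<lambda>i. x $ i" j d] by (simp add: gain_def algebra_simps)

text \<open>\<open>x\<close> is a stationary equilibrium, with payoff \<open>w\<close>, of the quitting game in which every stage is
  preceded, with probability \<open>l\<close>, by termination with payoff \<open>q\<close>.\<close>
definition discounted_equilibrium :: "real \<Rightarrow> real^'i \<Rightarrow> real^'i \<Rightarrow> real^'i \<Rightarrow> bool" where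
  "discounted_equilibrium l q x w \<longleftrightarrow>
     (\<forall>j. 0 \<le> x $ j \<and> x $ j \<le> 1 \<and> \<bar>w $ j\<bar> \<le> 2 \<and>
        w $ j = l * q $ j + (1 - l) * outcome_mean (outcome (w $ j) j) (\<lambda>i. x $ i) \<and>
        (x $ j < 1 \<longrightarrow> gain x w j \<le> 0) \<and> (0 < x $ j \<longrightarrow> 0 \<le> gain x w j))"

text \<open>Brouwer's theorem is applied to quitting probabilities and values together, so the value
  equation need not be solved for \<open>w\<close>. At a fixed point of the clipped map
  \<open>x + gain\<close>, a positive gain forces probability 1 and a negative one probability
  0.\<close>

lemma discounted_equilibrium_exists:
  assumes l: "0 \<le> l" "l \<le> 1" and q: "\<And>j. \<bar>q $ j\<bar> \<le> 2"
  shows "\<exists>x w. discounted_equilibrium l q x w"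
proof -
  define K where "K = (cbox 0 1 \<times> cbox (\<chi> j. -2) (\<chi> j. 2) :: ((real^'i) \<times> (real^'i)) set)"
  define F where "F p = ((\<chi> j. max 0 (min 1 (fst p $ j + gain (fst p) (snd p) j))),
     (\<chi> j. l * q $ j + (1 - l) * outcome_mean (outcome (snd p $ j) j) (\<lambda>i. fst p $ i)))" for p :: "(real^'i) \<times> (real^'i)"
  have mem: "p \<in> K \<longleftrightarrow> (\<forall>j. 0 \<le> fst p $ j \<and> fst p $ j \<le> 1 \<and> \<bar>snd p $ j\<bar> \<le> 2)" for p
    by (auto simp: K_def mem_Times_iff mem_box_cart abs_le_iff minus_le_iff[of 2])
  have c1: "continuous_on K (\<lambda>p. outcome (snd p $ j) j S)" for j S
    by (cases "S = {}") (auto simp: outcome_def intro!: continuous_intros continuous_on_component)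
  have c2: "continuous_on K (\<lambda>p. ((\<lambda>i. fst p $ i)(j := d)) i)" for i j d
    by (cases "i = j") (auto intro!: continuous_intros continuous_on_component)
  have c3: "continuous_on K (\<lambda>p. fst p $ i)" for i by (intro continuous_intros continuous_on_component)
  have "continuous_on K F"
    unfolding F_def gain_def
    by (intro continuous_on_Pair continuous_on_vec_lambda continuous_on_max continuous_on_min continuous_intros
        continuous_on_outcome_mean c1 c2 c3)
  moreover have "F \<in> K \<rightarrow> K"
  proof
    fix p assume p: "p \<in> K"
    have "\<bar>l * q $ j + (1 - l) * outcome_mean (outcome (snd p $ j) j) (\<lambda>i. fst p $ i)\<bar> \<le> 2" for j
    proof (rule convex_abs_le[OF q _ l])
      have pr: "probs (\<lambda>i. fst p $ i)" using p by (simp add: mem probs_def)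
      have o: "- 2 \<le> outcome (snd p $ j) j S" "outcome (snd p $ j) j S \<le> 2" for S
        using p r_bound[of S j] by (auto simp: outcome_def mem abs_le_iff minus_le_iff)
      have "outcome_mean (\<lambda>_. 2 * 1 + 0 * 0) (\<lambda>i. fst p $ i) = 2" "outcome_mean (\<lambda>_. (-2) * 1 + 0 * 0) (\<lambda>i. fst p $ i) = - 2"
        unfolding outcome_mean_linear by simp_all
      then show "\<bar>outcome_mean (outcome (snd p $ j) j) (\<lambda>i. fst p $ i)\<bar> \<le> 2"
        using outcome_mean_mono[OF pr, of "outcome (snd p $ j) j" "\<lambda>_. 2"] outcome_mean_mono[OF pr, of "\<lambda>_. -2" "outcome (snd p $ j) j"] o
        by (simp add: abs_le_iff minus_le_iff)
    qed
    then show "F p \<in> K" by (simp add: mem F_def)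
  qed
  moreover have "compact K" "convex K" "K \<noteq> {}"
  proof -
    show "compact K" "convex K" unfolding K_def by (auto intro: compact_Times convex_Times)
    have "0 \<in> K" by (simp add: mem)
    then show "K \<noteq> {}" by blast
  qed
  ultimately obtain p where p: "p \<in> K" "F p = p" using brouwer[of K F] by blast
  obtain x w where xw: "p = (x, w)" by force
  have b: "0 \<le> x $ j" "x $ j \<le> 1" "\<bar>w $ j\<bar> \<le> 2" for j using p(1) by (auto simp: mem xw)
  have "fst (F p) $ j = x $ j" "snd (F p) $ j = w $ j" for j using p(2) by (simp_all add: xw)
  then have f: "max 0 (min 1 (x $ j + gain x w j)) = x $ j"
    "l * q $ j + (1 - l) * outcome_mean (outcome (w $ j) j) (\<lambda>i. x $ i) = w $ j" for j
    by (simp_all add: F_def xw)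
  have "gain x w j \<le> 0" if "x $ j < 1" for j using f(1)[of j] that by (auto simp: max_def min_def split: if_splits)
  moreover have "0 \<le> gain x w j" if "0 < x $ j" for j using f(1)[of j] that b(2)[of j] by (auto simp: max_def min_def split: if_splits)
  ultimately show ?thesis unfolding discounted_equilibrium_def using b f(2) by metis
qed

text \<open>Solo quitting by others pays \<open>j\<close> at least \<open>\<theta> > 0\<close> and
  termination pays 1, so waiting is profitable to first order in \<open>l\<close> and the
  probabilities of the others. Quitting yields 0 unless somebody else quits at the same
  time.\<close>

lemma not_punishable_inactive:
  assumes j: "j \<notin> punishable" and q: "q $ j = 1"
  obtains \<eta> where "0 < \<eta>" "\<And>l x w. discounted_equilibrium l q x w \<Longrightarrow> 0 < l \<Longrightarrow> l \<le> 1 \<Longrightarrow> (\<Sum>k\<in>UNIV - {j}. x $ k) \<le> \<eta> \<Longrightarrow> x $ j = 0"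
proof -
  have rpos: "0 < r {k} j" if "k \<noteq> j" for k using j that by (force simp: punishable_def not_le)
  define \<theta> where "\<theta> = Min (insert 1 ((\<lambda>k. r {k} j) ` (UNIV - {j})))"
  have \<theta>: "0 < \<theta>" "\<And>k. k \<noteq> j \<Longrightarrow> \<theta> \<le> r {k} j" using rpos by (auto simp: \<theta>_def)
  define K where "K = 2 ^ CARD('i) * (2::real)"
  have K: "0 \<le> K" by (simp add: K_def)
  define \<eta> where "\<eta> = min (1/8) (\<theta> / (3 + K))"
  have \<eta>: "0 < \<eta>" "\<eta> \<le> 1/8"
  proof -
    show "0 < \<eta>" using \<theta> K by (simp add: \<eta>_def)
    show "\<eta> \<le> 1/8" unfolding \<eta>_def by (rule min.cobounded1)
  qed
  have \<eta>': "(3 + K) * \<eta> \<le> \<theta>"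
  proof -
    have "\<eta> \<le> \<theta> / (3 + K)" by (simp add: \<eta>_def)
    then have "\<eta> * (3 + K) \<le> \<theta>" using K by (subst (asm) pos_le_divide_eq) auto
    then show ?thesis by (simp add: mult.commute)
  qed
  show thesis
  proof (rule that[OF \<eta>(1)])
    fix l x w assume eq: "discounted_equilibrium l q x w" and l: "0 < l" "l \<le> 1" and y\<eta>: "(\<Sum>k\<in>UNIV - {j}. x $ k) \<le> \<eta>"
    define y where "y = (\<Sum>k\<in>UNIV - {j}. x $ k)"
    have x01: "0 \<le> x $ k" "x $ k \<le> 1" for k using eq by (auto simp: discounted_equilibrium_def)
    have y: "0 \<le> y" "y \<le> \<eta>" using x01 y\<eta> by (auto simp: y_def sum_nonneg)
    define x0 where "x0 = (\<lambda>i. x $ i)(j := 0)"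
    have pr: "probs x0" using x01 by (simp add: x0_def probs_def)
    have sum0: "sum x0 UNIV = y"
      by (simp add: sum.remove[of UNIV j] x0_def y_def)
    define A where "A = stage_payoff r x0 j"
    define \<pi> where "\<pi> = quits x0"
    have \<pi>: "0 \<le> \<pi>" "\<pi> \<le> y"
    proof -
      show "0 \<le> \<pi>" using quits_bounds[OF pr] by (simp add: \<pi>_def)
      have "1 - sum x0 UNIV \<le> (\<Prod>i\<in>UNIV. 1 - x0 i)" using pr by (intro Weierstrass_prod_ineq) (auto simp: probs_def)
      then show "\<pi> \<le> y" unfolding prod_one_minus sum0 \<pi>_def by simp
    qed
    have A: "\<theta> * y - K * (y * y) \<le> A"
    proof -
      have "\<bar>A - (\<Sum>i\<in>UNIV. x0 i * (if {i} = {} then 0 else r {i} j))\<bar> \<le> 2 ^ CARD('i) * 2 * (sum x0 UNIV)\<^sup>2"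
        unfolding A_def stage_payoff_def using r_bound by (intro outcome_mean_first_order pr) auto
      then have "\<bar>A - (\<Sum>i\<in>UNIV. x0 i * r {i} j)\<bar> \<le> K * (y * y)" by (simp add: sum0 K_def power2_eq_square)
      moreover have "\<theta> * y \<le> (\<Sum>i\<in>UNIV. x0 i * r {i} j)"
      proof -
        have "\<theta> * y = (\<Sum>i\<in>UNIV. x0 i * \<theta>)" by (simp add: sum0[symmetric] sum_distrib_left mult.commute)
        also have "\<dots> \<le> (\<Sum>i\<in>UNIV. x0 i * r {i} j)"
        proof (rule sum_mono)
          fix i show "x0 i * \<theta> \<le> x0 i * r {i} j"
            using \<theta>(2)[of i] x01 by (cases "i = j") (auto simp: x0_def intro: mult_left_mono)
        qed
        finally show ?thesis .
      qed
      ultimately show ?thesis by linarith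
    qed
    define Qt where "Qt = outcome_mean (outcome (w $ j) j) ((\<lambda>i. x $ i)(j := 1))"
    have Qt: "Qt \<le> 2 * \<pi>"
    proof -
      let ?x1 = "(\<lambda>i. x $ i)(j := 1)"
      have "outcome_mean (\<lambda>S. if S = {j} then 1 else 0) ?x1 = (\<Sum>S\<in>{{j}}. (\<Prod>i\<in>UNIV. if i \<in> S then ?x1 i else 1 - ?x1 i) * (if S = {j} then 1 else 0))"
        unfolding outcome_mean_def by (rule sum.mono_neutral_right) auto
      also have "\<dots> = (\<Prod>i\<in>UNIV. 1 - x0 i)" by (auto simp: x0_def intro!: prod.cong)
      finally have 1: "outcome_mean (\<lambda>S. if S = {j} then 1 else 0) ?x1 = 1 - \<pi>" by (simp add: prod_one_minus \<pi>_def)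
      have pr1: "probs ?x1" using x01 by (simp add: probs_def)
      have "\<bar>w $ j\<bar> \<le> 2" using eq by (simp add: discounted_equilibrium_def)
      then have "outcome (w $ j) j S \<le> 2 * 1 + (-2) * (if S = {j} then 1 else 0)" for S
        using r_bound[of S j] r_own[of j] by (auto simp: outcome_def abs_le_iff)
      then have "Qt \<le> outcome_mean (\<lambda>S. 2 * 1 + (-2) * (if S = {j} then 1 else 0)) ?x1"
        unfolding Qt_def by (intro outcome_mean_mono pr1)
      also have "\<dots> = 2 * \<pi>" unfolding outcome_mean_linear 1 by simp
      finally show ?thesis .
    qed
    show "x $ j = 0"
    proof (rule ccontr)
      assume "x $ j \<noteq> 0"
      then have xj: "0 < x $ j" using x01[of j] by simp
      have g0: "0 \<le> gain x w j" and g1: "x $ j < 1 \<Longrightarrow> gain x w j \<le> 0"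
        and wj: "w $ j = l * 1 + (1 - l) * outcome_mean (outcome (w $ j) j) (\<lambda>i. x $ i)"
        using eq xj q by (auto simp: discounted_equilibrium_def)
      have cont: "outcome_mean (outcome (w $ j) j) x0 = A + (1 - \<pi>) * w $ j"
        by (simp add: outcome_mean_outcome A_def \<pi>_def)
      have "outcome_mean (outcome (w $ j) j) (\<lambda>i. x $ i) = Qt"
      proof (cases "x $ j < 1")
        case True
        then have "gain x w j = 0" using g0 g1 by simp
        then show ?thesis using outcome_mean_gain[of w j x "x $ j"] outcome_mean_gain[of w j x 1] by (simp add: Qt_def)
      next
        case False
        then have "x $ j = 1" using x01(2)[of j] by simp
        then have "(\<lambda>i. x $ i)(j := 1) = (\<lambda>i. x $ i)" by auto
        then show ?thesis by (simp add: Qt_def)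
      qed
      then have wQ: "w $ j = l + (1 - l) * Qt" using wj by simp
      have "A + (1 - \<pi>) * w $ j \<le> Qt" using g0 cont unfolding gain_def Qt_def x0_def by simp
      \<comment> \<open>For small \<open>y\<close> and \<open>l\<close> the left side is of first
        order in \<open>y\<close> and \<open>l\<close>, while the right side is of second order
        because \<open>Qt \<le> 2 * \<pi>\<close>.\<close>
      then have 1: "A + (1 - \<pi>) * l \<le> Qt * (\<pi> + l * (1 - \<pi>))" unfolding wQ by (simp add: algebra_simps)
      have \<pi>1: "\<pi> \<le> 1/8" "y \<le> 1/8" using \<pi> y \<eta> by linarith+
      have 2: "Qt * (\<pi> + l * (1 - \<pi>)) \<le> 2 * y * (y + l)"
      proof -
        have "Qt * (\<pi> + l * (1 - \<pi>)) \<le> 2 * \<pi> * (\<pi> + l * (1 - \<pi>))"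
          using Qt \<pi> \<pi>1 l by (intro mult_right_mono add_nonneg_nonneg mult_nonneg_nonneg) auto
        also have "\<dots> \<le> 2 * y * (y + l * 1)" using \<pi> \<pi>1 l y by (intro mult_mono add_mono mult_left_mono add_nonneg_nonneg mult_nonneg_nonneg) auto
        finally show ?thesis by simp
      qed
      have 3: "1/2 * l \<le> (1 - \<pi>) * l" using \<pi>1 l by (intro mult_right_mono) auto
      have 4: "2 * y * l \<le> 1/4 * l" using \<pi>1 l by (intro mult_right_mono) auto
      have 5: "(2 + K) * (y * y) \<le> \<theta> * y"
      proof -
        have "(2 + K) * y \<le> (3 + K) * \<eta>" using y K by (intro mult_mono) auto
        then have "(2 + K) * y * y \<le> \<theta> * y" using \<eta>' y by (intro mult_right_mono) auto
        then show ?thesis by (simp add: mult.assoc)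
      qed
      have "A + (1 - \<pi>) * l \<le> 2 * (y * y) + 2 * y * l" using 1 2 by (simp add: algebra_simps)
      moreover have "(2 + K) * (y * y) = 2 * (y * y) + K * (y * y)" by (simp add: distrib_right)
      ultimately show False using A 3 4 5 l by linarith
    qed
  qed
qed

text \<open>The value 1 of \<open>q\<close> outside \<open>punishable\<close> makes those players
  inactive near the limit, so that the limit problem involves the punishable players only.\<close>

lemma no_equilibrium_lcp_normalized:
  assumes \<epsilon>: "0 < \<epsilon>" and no_eq: "\<not> (\<exists>\<xi>. sunspot_eps_equilibrium r \<epsilon> \<xi>)"
    and q: "\<And>j. \<bar>q $ j\<bar> \<le> 2" "\<And>j. j \<notin> punishable \<Longrightarrow> q $ j = 1"
  shows "lcp_solvable punishable q"
proof -
  define L where "L n = 1 / real (Suc n)" for n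
  have L: "0 < L n" "L n \<le> 1" for n by (auto simp: L_def)
  have "\<forall>n. \<exists>p. discounted_equilibrium (L n) q (fst p) (snd p)"
    using discounted_equilibrium_exists[OF less_imp_le[OF L(1)] L(2) q(1)] by simp
  from choice[OF this] obtain P0 where P0: "\<And>n. discounted_equilibrium (L n) q (fst (P0 n)) (snd (P0 n))" by blast
  \<comment> \<open>Total activity. The quotients by \<open>s n\<close> lie in [0,1] and sum to 1,
    so they too converge along a subsequence.\<close>
  define s where "s n = L n + (\<Sum>i\<in>UNIV. fst (P0 n) $ i)" for n
  have b0: "0 \<le> fst (P0 n) $ i" "fst (P0 n) $ i \<le> 1" "\<bar>snd (P0 n) $ i\<bar> \<le> 2" for n i
    using P0[of n] unfolding discounted_equilibrium_def by blast+
  have s0: "L n \<le> s n" "fst (P0 n) $ i \<le> s n" "0 < s n" for n i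
  proof -
    have "0 \<le> (\<Sum>i\<in>UNIV. fst (P0 n) $ i)" using b0 by (intro sum_nonneg) auto
    moreover have "fst (P0 n) $ i \<le> (\<Sum>i\<in>UNIV. fst (P0 n) $ i)" using b0 by (intro member_le_sum) auto
    ultimately show "L n \<le> s n" "fst (P0 n) $ i \<le> s n" "0 < s n" using L(1)[of n] by (auto simp: s_def)
  qed
  define P where "P n = (P0 n, L n / s n, (1 / s n) *\<^sub>R fst (P0 n))" for n
  have "bounded (range P)"
  proof (rule bounded_subset)
    let ?B = "(cbox 0 1 \<times> cbox (\<chi> j. -2) (\<chi> j. 2)) \<times> {0..1::real} \<times> cbox 0 1 :: (((real^'i) \<times> (real^'i)) \<times> real \<times> (real^'i)) set"
    show "bounded ?B" by (intro bounded_Times) auto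
    show "range P \<subseteq> ?B"
    proof (rule image_subsetI)
      fix n
      have "- 2 \<le> snd (P0 n) $ i" "snd (P0 n) $ i \<le> 2" for i using b0(3)[of n i] by (auto simp: abs_le_iff)
      then show "P n \<in> ?B"
        using b0[of n] s0[of n] less_imp_le[OF L(1)[of n]] by (simp add: P_def mem_Times_iff mem_box_cart)
    qed
  qed
  then obtain l \<rho> where \<rho>: "strict_mono (\<rho> :: nat \<Rightarrow> nat)" and lim: "(P \<circ> \<rho>) \<longlonglongrightarrow> l"
    using bounded_imp_convergent_subsequence[of P] by blast
  obtain x w z0 z where l: "l = ((x, w), z0, z)"
    by (rule that[of "fst (fst l)" "snd (fst l)" "fst (snd l)" "snd (snd l)"]) simp
  define X where "X n = fst (P0 (\<rho> n))" for n
  define W where "W n = snd (P0 (\<rho> n))" for n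
  define D where "D n = L (\<rho> n)" for n
  define t where "t n = s (\<rho> n)" for n
  have eq: "discounted_equilibrium (D n) q (X n) (W n)" for n using P0 by (simp add: D_def X_def W_def)
  have eqs: "W n $ j = D n * q $ j + (1 - D n) * outcome_mean (outcome (W n $ j) j) (\<lambda>i. X n $ i)"
    "X n $ j < 1 \<Longrightarrow> gain (X n) (W n) j \<le> 0" "0 < X n $ j \<Longrightarrow> 0 \<le> gain (X n) (W n) j" for n j
    using eq[of n] unfolding discounted_equilibrium_def by blast+
  have D01: "0 < D n" "D n \<le> 1" for n using L by (auto simp: D_def)
  have X01: "0 \<le> X n $ i" "X n $ i \<le> 1" for n i using b0 by (auto simp: X_def)
  have t0: "0 < t n" "t n = D n + (\<Sum>i\<in>UNIV. X n $ i)" for n using s0(3) by (auto simp: t_def s_def D_def X_def)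
  have lX: "(\<lambda>n. X n $ i) \<longlonglongrightarrow> x $ i" for i
    using tendsto_vec_nth[OF tendsto_fst[OF tendsto_fst[OF lim]]] by (simp add: l o_def P_def X_def)
  have lW: "(\<lambda>n. W n $ i) \<longlonglongrightarrow> w $ i" for i
    using tendsto_vec_nth[OF tendsto_snd[OF tendsto_fst[OF lim]]] by (simp add: l o_def P_def W_def)
  have lz0: "(\<lambda>n. D n / t n) \<longlonglongrightarrow> z0"
    using tendsto_fst[OF tendsto_snd[OF lim]] by (simp add: l o_def P_def D_def t_def)
  have lz: "(\<lambda>n. X n $ i / t n) \<longlonglongrightarrow> z $ i" for i
    using tendsto_vec_nth[OF tendsto_snd[OF tendsto_snd[OF lim]], of i] by (simp add: l o_def P_def X_def t_def)
  have "L \<longlonglongrightarrow> 0" unfolding L_def by (rule LIMSEQ_Suc[OF lim_1_over_n])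
  then have lD: "D \<longlonglongrightarrow> 0" using LIMSEQ_subseq_LIMSEQ[OF _ \<rho>, of L 0] by (simp add: D_def[abs_def] o_def)
  have lO: "(\<lambda>n. outcome (W n $ j) j S) \<longlonglongrightarrow> outcome (w $ j) j S" for j S
    using lW by (cases "S = {}") (auto simp: outcome_def)
  have lU: "(\<lambda>n. ((\<lambda>i. X n $ i)(j := d)) i) \<longlonglongrightarrow> ((\<lambda>i. x $ i)(j := d)) i" for i j d
    using lX by (cases "i = j") auto
  have lG: "(\<lambda>n. gain (X n) (W n) j) \<longlonglongrightarrow> gain x w j" for j
    unfolding gain_def by (intro tendsto_diff tendsto_outcome_mean lO lU)
  have wj: "w $ j = outcome_mean (outcome (w $ j) j) (\<lambda>i. x $ i)" for j
  proof -
    have "(\<lambda>n. D n * q $ j + (1 - D n) * outcome_mean (outcome (W n $ j) j) (\<lambda>i. X n $ i)) \<longlonglongrightarrow>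
       0 * q $ j + (1 - 0) * outcome_mean (outcome (w $ j) j) (\<lambda>i. x $ i)"
      by (intro tendsto_intros tendsto_outcome_mean lD lO lX)
    moreover have "D n * q $ j + (1 - D n) * outcome_mean (outcome (W n $ j) j) (\<lambda>i. X n $ i) = W n $ j" for n
      by (rule eqs(1)[symmetric])
    ultimately have "(\<lambda>n. W n $ j) \<longlonglongrightarrow> outcome_mean (outcome (w $ j) j) (\<lambda>i. x $ i)" by simp
    then show ?thesis by (rule LIMSEQ_unique[OF lW])
  qed
  have g1: "gain x w j \<le> 0" if "x $ j < 1" for j
  proof (rule tendsto_upperbound[OF lG[of j]])
    show "\<forall>\<^sub>F n in sequentially. gain (X n) (W n) j \<le> 0"
      using order_tendstoD(2)[OF lX that] by eventually_elim (rule eqs(2))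
  qed simp
  have g2: "0 \<le> gain x w j" if "0 < x $ j" for j
  proof (rule tendsto_lowerbound[OF lG[of j]])
    show "\<forall>\<^sub>F n in sequentially. 0 \<le> gain (X n) (W n) j"
      using order_tendstoD(1)[OF lX that] by eventually_elim (rule eqs(3))
  qed simp
  have x01: "0 \<le> x $ i" "x $ i \<le> 1" for i
    using LIMSEQ_le_const[OF lX[of i], of 0] LIMSEQ_le_const2[OF lX[of i], of 1] X01 by auto
  have pr: "probs (\<lambda>i. x $ i)" using x01 by (simp add: probs_def)
  have val: "w $ j = stage_payoff r (\<lambda>i. x $ i) j + (1 - quits (\<lambda>i. x $ i)) * w $ j" for j
    using wj[of j] unfolding outcome_mean_outcome .
  have opt: "stage_payoff r ((\<lambda>i. x $ i)(j := d)) j + (1 - quits ((\<lambda>i. x $ i)(j := d))) * w $ j \<le> w $ j"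
    if d: "0 \<le> d" "d \<le> 1" for j :: "'i" and d :: real
  proof -
    have arith: "b + d * g = a + (d - y) * g" if "a = b + y * g" for a b g y :: real
      using that by (simp add: algebra_simps)
    have "w $ j = outcome_mean (outcome (w $ j) j) ((\<lambda>i. x $ i)(j := 0)) + x $ j * gain x w j"
    proof -
      have "(\<lambda>i. x $ i)(j := x $ j) = (\<lambda>i. x $ i)" by auto
      from outcome_mean_gain[of w j x "x $ j", unfolded this] wj[of j] show ?thesis by (rule trans[rotated])
    qed
    then have "outcome_mean (outcome (w $ j) j) ((\<lambda>i. x $ i)(j := d)) = w $ j + (d - x $ j) * gain x w j"
      by (subst outcome_mean_gain) (rule arith)
    moreover have "(d - x $ j) * gain x w j \<le> 0"
    proof -
      consider "x $ j < 1" "0 < x $ j" | "x $ j = 0" | "x $ j = 1" using x01[of j] by linarith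
      then show ?thesis
      proof cases
        case 1
        then have "gain x w j = 0" using g1[of j] g2[of j] by linarith
        then show ?thesis by simp
      next
        case 2 then show ?thesis using g1[of j] d by (simp add: mult_nonneg_nonpos)
      next
        case 3 then show ?thesis using g2[of j] d by (simp add: mult_nonpos_nonneg)
      qed
    qed
    ultimately show ?thesis unfolding outcome_mean_outcome by linarith
  qed
  have inactive: "\<forall>\<^sub>F n in sequentially. X n $ j = 0" if j: "j \<notin> punishable" and others: "\<And>k. k \<noteq> j \<Longrightarrow> x $ k = 0" for j
  proof -
    obtain \<eta> where \<eta>: "0 < \<eta>" "\<And>l x w. discounted_equilibrium l q x w \<Longrightarrow> 0 < l \<Longrightarrow> l \<le> 1 \<Longrightarrow> (\<Sum>k\<in>UNIV - {j}. x $ k) \<le> \<eta> \<Longrightarrow> x $ j = 0"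
      using not_punishable_inactive[of j q, OF j q(2)[OF j]] by blast
    have "(\<lambda>n. \<Sum>k\<in>UNIV - {j}. X n $ k) \<longlonglongrightarrow> (\<Sum>k\<in>UNIV - {j}. x $ k)" by (intro tendsto_sum lX)
    also have "(\<Sum>k\<in>UNIV - {j}. x $ k) = 0" using others by (intro sum.neutral) auto
    finally have "\<forall>\<^sub>F n in sequentially. (\<Sum>k\<in>UNIV - {j}. X n $ k) < \<eta>" using order_tendstoD(2) \<eta>(1) by blast
    then show ?thesis by eventually_elim (use \<eta>(2)[OF eq D01] in auto)
  qed
  \<comment> \<open>A nonzero limit would be a stationary solution of the quitting game itself.
    Either every player faces another quitter, or there is a single quitter; a single quitter is
    punishable, since otherwise \<open>inactive\<close> applies.\<close>
  have x0: "x $ i = 0" for i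
  proof (rule ccontr)
    assume "x $ i \<noteq> 0"
    then have xi: "0 < x $ i" using x01[of i] by simp
    show False
    proof (cases "\<forall>j. \<exists>k. k \<noteq> j \<and> 0 < x $ k")
      case True
      then show False using stationary_equilibrium[OF pr \<epsilon> val opt] no_eq by blast
    next
      case False
      then obtain j where "\<And>k. k \<noteq> j \<Longrightarrow> \<not> 0 < x $ k" by blast
      then have j: "x $ k = 0" if "k \<noteq> j" for k using x01(1)[of k] that by force
      then have ij: "j = i" using xi by force
      have xe: "(\<lambda>k. x $ k) = (\<lambda>_. 0)(i := x $ i)" using j ij by auto
      show False
      proof (cases "i \<in> punishable")
        case True
        then show False using single_quitter_equilibrium[OF xi x01(2) True \<epsilon> xe val opt] no_eq by blast
      next
        case False
        have "x $ i = 0"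
          by (rule LIMSEQ_unique[OF lX tendsto_eventually[OF inactive[OF False]]]) (use j ij in auto)
        then show False using xi by simp
      qed
    qed
  qed
  \<comment> \<open>The quadratic error of the first-order expansion, divided by \<open>t n\<close>,
    is at most a multiple of the total quitting probability, which tends to 0.\<close>
  have lS: "(\<lambda>n. outcome_mean \<sigma> (\<lambda>i. X n $ i) / t n) \<longlonglongrightarrow> (\<Sum>i\<in>UNIV. z $ i * \<sigma> {i})"
    if \<sigma>: "\<And>S. \<bar>\<sigma> S\<bar> \<le> 2" "\<sigma> {} = 0" for \<sigma>
  proof -
    define c where "c = 2 ^ CARD('i) * (2::real)"
    have "(\<lambda>n. outcome_mean \<sigma> (\<lambda>i. X n $ i) / t n - (\<Sum>i\<in>UNIV. X n $ i / t n * \<sigma> {i})) \<longlonglongrightarrow> 0"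
    proof (rule Lim_null_comparison)
      have "(\<lambda>n. c * (\<Sum>i\<in>UNIV. X n $ i)) \<longlonglongrightarrow> c * (\<Sum>i\<in>UNIV. x $ i)" by (intro tendsto_intros lX)
      then show "(\<lambda>n. c * (\<Sum>i\<in>UNIV. X n $ i)) \<longlonglongrightarrow> 0" by (simp add: x0)
      show "\<forall>\<^sub>F n in sequentially. norm (outcome_mean \<sigma> (\<lambda>i. X n $ i) / t n - (\<Sum>i\<in>UNIV. X n $ i / t n * \<sigma> {i})) \<le> c * (\<Sum>i\<in>UNIV. X n $ i)"
      proof (intro always_eventually allI)
        fix n
        define y where "y = (\<Sum>i\<in>UNIV. X n $ i)"
        have y: "0 \<le> y" "y \<le> t n" using X01 t0(2)[of n] D01(1)[of n] by (auto simp: y_def sum_nonneg)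
        have "outcome_mean \<sigma> (\<lambda>i. X n $ i) / t n - (\<Sum>i\<in>UNIV. X n $ i / t n * \<sigma> {i}) =
          (outcome_mean \<sigma> (\<lambda>i. X n $ i) - (\<Sum>i\<in>UNIV. X n $ i * \<sigma> {i})) / t n"
          by (simp add: diff_divide_distrib sum_divide_distrib)
        moreover have "\<bar>outcome_mean \<sigma> (\<lambda>i. X n $ i) - (\<Sum>i\<in>UNIV. X n $ i * \<sigma> {i})\<bar> \<le> c * y\<^sup>2"
          unfolding c_def y_def using X01 \<sigma> by (intro outcome_mean_first_order) (auto simp: probs_def)
        moreover have "c * y\<^sup>2 \<le> c * y * t n"
          unfolding power2_eq_square mult.assoc using y by (intro mult_left_mono) (auto simp: c_def)
        moreover have "\<bar>a / t n\<bar> \<le> c * y" if "\<bar>a\<bar> \<le> c * y\<^sup>2" "c * y\<^sup>2 \<le> c * y * t n" for a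
          using order_trans[OF that] t0(1)[of n] by (simp add: abs_divide pos_divide_le_eq)
        ultimately show "norm (outcome_mean \<sigma> (\<lambda>i. X n $ i) / t n - (\<Sum>i\<in>UNIV. X n $ i / t n * \<sigma> {i})) \<le> c * (\<Sum>i\<in>UNIV. X n $ i)"
          unfolding real_norm_def y_def by metis
      qed
    qed
    note null = this
    have "(\<lambda>n. (outcome_mean \<sigma> (\<lambda>i. X n $ i) / t n - (\<Sum>i\<in>UNIV. X n $ i / t n * \<sigma> {i})) + (\<Sum>i\<in>UNIV. X n $ i / t n * \<sigma> {i}))
       \<longlonglongrightarrow> 0 + (\<Sum>i\<in>UNIV. z $ i * \<sigma> {i})" by (intro tendsto_add[OF null] tendsto_intros lz)
    then show ?thesis by simp
  qed
  have zsum: "z0 + (\<Sum>i\<in>UNIV. z $ i) = 1"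
  proof (rule LIMSEQ_unique)
    show "(\<lambda>n. D n / t n + (\<Sum>i\<in>UNIV. X n $ i / t n)) \<longlonglongrightarrow> z0 + (\<Sum>i\<in>UNIV. z $ i)" by (intro tendsto_intros lz0 lz)
    have "D n / t n + (\<Sum>i\<in>UNIV. X n $ i / t n) = 1" for n
      using t0(1)[of n] t0(2)[of n] by (simp flip: sum_divide_distrib add_divide_distrib)
    then show "(\<lambda>n. D n / t n + (\<Sum>i\<in>UNIV. X n $ i / t n)) \<longlonglongrightarrow> 1" by simp
  qed
  \<comment> \<open>In the value equation the terms of order 0 cancel; what is left has a limit
    after division by \<open>t n\<close>.\<close>
  have w_eq: "w $ j = z0 * q $ j + (\<Sum>i\<in>UNIV. z $ i * r {i} j)" for j
  proof -
    have lq: "(\<lambda>n. quits (\<lambda>i. X n $ i) / t n) \<longlonglongrightarrow> (\<Sum>i\<in>UNIV. z $ i)"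
      using lS[of "\<lambda>S. if S = {} then 0 else 1"] by (simp add: quits_def)
    have ls: "(\<lambda>n. stage_payoff r (\<lambda>i. X n $ i) j / t n) \<longlonglongrightarrow> (\<Sum>i\<in>UNIV. z $ i * r {i} j)"
      using lS[of "\<lambda>S. if S = {} then 0 else r S j"] r_bound by (simp add: stage_payoff_def)
    have step: "W n $ j * (D n / t n + (1 - D n) * (quits (\<lambda>i. X n $ i) / t n)) =
       D n / t n * q $ j + (1 - D n) * (stage_payoff r (\<lambda>i. X n $ i) j / t n)" for n
    proof -
      have "W n $ j = D n * q $ j + (1 - D n) * (stage_payoff r (\<lambda>i. X n $ i) j + (1 - quits (\<lambda>i. X n $ i)) * W n $ j)"
        using eqs(1)[of n j] unfolding outcome_mean_outcome .
      moreover have "a * (d + (1 - d) * k) = d * b + (1 - d) * g" if "a = d * b + (1 - d) * (g + (1 - k) * a)" for a b d g k :: real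
        using that by algebra
      ultimately have "W n $ j * (D n + (1 - D n) * quits (\<lambda>i. X n $ i)) = D n * q $ j + (1 - D n) * stage_payoff r (\<lambda>i. X n $ i) j"
        by blast
      then have "W n $ j * (D n + (1 - D n) * quits (\<lambda>i. X n $ i)) / t n = (D n * q $ j + (1 - D n) * stage_payoff r (\<lambda>i. X n $ i) j) / t n"
        by simp
      then show ?thesis by (simp add: add_divide_distrib distrib_left)
    qed
    have "(\<lambda>n. W n $ j * (D n / t n + (1 - D n) * (quits (\<lambda>i. X n $ i) / t n))) \<longlonglongrightarrow> w $ j * (z0 + (1 - 0) * (\<Sum>i\<in>UNIV. z $ i))"
      by (intro tendsto_intros lW lz0 lD lq)
    moreover have "(\<lambda>n. D n / t n * q $ j + (1 - D n) * (stage_payoff r (\<lambda>i. X n $ i) j / t n)) \<longlonglongrightarrow> z0 * q $ j + (1 - 0) * (\<Sum>i\<in>UNIV. z $ i * r {i} j)"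
      by (intro tendsto_intros lz0 lD ls)
    ultimately have "w $ j * (z0 + (1 - 0) * (\<Sum>i\<in>UNIV. z $ i)) = z0 * q $ j + (1 - 0) * (\<Sum>i\<in>UNIV. z $ i * r {i} j)"
      unfolding step by (rule LIMSEQ_unique)
    then show ?thesis using zsum by simp
  qed
  \<comment> \<open>At \<open>x = 0\<close> quitting yields the own solo payoff 0 and continuing
    yields \<open>w $ j\<close>. The sign conditions on gains thereby become
    complementarity.\<close>
  have gain0: "gain x w j = - w $ j" for j
  proof -
    have "(\<lambda>i. x $ i)(j := 1) = (\<lambda>_. 0)(j := 1)" "(\<lambda>i. x $ i)(j := 0) = (\<lambda>_. 0)(j := 0)" by (auto simp: x0)
    then show ?thesis unfolding gain_def by (simp only: outcome_mean_one) (simp add: outcome_def r_own)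
  qed
  have w0: "0 \<le> w $ j" for j using g1[of j] x0[of j] gain0[of j] by simp
  have z0: "0 \<le> z0" "0 \<le> z $ j" for j
    using LIMSEQ_le_const[OF lz0, of 0] LIMSEQ_le_const[OF lz[of j], of 0] D01 X01 t0(1) by (auto simp: less_imp_le)
  have zw: "z $ j * w $ j = 0" for j
  proof (cases "0 < z $ j")
    case True
    have "\<forall>\<^sub>F n in sequentially. 0 \<le> gain (X n) (W n) j"
      using order_tendstoD(1)[OF lz True]
    proof eventually_elim
      case (elim n)
      then have "0 < X n $ j" using t0(1)[of n] by (simp add: zero_less_divide_iff)
      then show ?case by (rule eqs(3))
    qed
    then have "0 \<le> gain x w j" by (intro tendsto_lowerbound[OF lG]) auto
    then show ?thesis using w0[of j] gain0[of j] by simp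
  qed (use z0(2)[of j] in simp)
  have zN: "z $ j = 0" if "j \<notin> punishable" for j
  proof (rule LIMSEQ_unique[OF lz])
    have "\<forall>\<^sub>F n in sequentially. X n $ j / t n = 0"
      using inactive[OF that x0] by eventually_elim simp
    then show "(\<lambda>n. X n $ j / t n) \<longlonglongrightarrow> 0" by (rule tendsto_eventually)
  qed
  have vec: "(z0 *\<^sub>R q + (\<Sum>i\<in>UNIV. (z $ i) *\<^sub>R solo i)) $ j = w $ j" for j
    by (simp add: w_eq solo_def)
  show ?thesis
    unfolding lcp_solvable_def lcp_solution_def lcp_value_def
    by (intro exI[of _ z0] exI[of _ "\<lambda>i. z $ i"]) (unfold vec, use z0 zN zsum w0 zw in blast)
qed

text \<open>The problem sees only the coordinates of \<open>q\<close> in \<open>punishable\<close>,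
  and scaling these by \<open>1 / c\<close> merely rescales \<open>z0\<close>.\<close>

lemma no_equilibrium_lcp:
  assumes \<epsilon>: "0 < \<epsilon>" and no_eq: "\<not> (\<exists>\<xi>. sunspot_eps_equilibrium r \<epsilon> \<xi>)"
  shows "lcp_solvable punishable q"
proof -
  define c where "c = 1 + (\<Sum>j\<in>UNIV. \<bar>q $ j\<bar>)"
  have c: "0 < c" "\<bar>q $ j\<bar> \<le> c" for j
  proof -
    have "\<bar>q $ j\<bar> \<le> (\<Sum>j\<in>UNIV. \<bar>q $ j\<bar>)" by (rule member_le_sum) auto
    then show "0 < c" "\<bar>q $ j\<bar> \<le> c" by (auto simp: c_def)
  qed
  define q' where "q' = (\<chi> j. if j \<in> punishable then q $ j / c else 1)"
  have "lcp_solvable punishable q'"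
  proof (rule no_equilibrium_lcp_normalized[OF \<epsilon> no_eq])
    fix j
    have "\<bar>q $ j / c\<bar> \<le> 1" using c by (simp add: abs_divide)
    then have "\<bar>q $ j / c\<bar> \<le> 2" by linarith
    then show "\<bar>q' $ j\<bar> \<le> 2" by (simp add: q'_def)
  qed (simp add: q'_def)
  then obtain z0 z where z: "0 \<le> z0" "\<And>i. 0 \<le> z i" "\<And>i. i \<notin> punishable \<Longrightarrow> z i = 0" "z0 + sum z UNIV = 1"
     "\<And>j. j \<in> punishable \<Longrightarrow> 0 \<le> lcp_value q' z0 z $ j"
     "\<And>j. j \<in> punishable \<Longrightarrow> z j * lcp_value q' z0 z $ j = 0"
    unfolding lcp_solvable_def lcp_solution_def by blast
  have eq: "lcp_value q (z0 / c) z $ j = lcp_value q' z0 z $ j"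
    if "j \<in> punishable" for j using that by (simp add: lcp_value_def q'_def)
  have "0 < z0 / c + sum z UNIV"
  proof (cases "z0 = 0")
    case False
    then have "0 < z0 / c" using z(1) c(1) by simp
    then show ?thesis using z(2) by (simp add: add_pos_nonneg sum_nonneg)
  qed (use z(4) in simp)
  then show ?thesis
    by (intro lcp_solvableI[of "z0 / c" z]) (use z c(1) in \<open>auto simp: eq\<close>)
qed

lemma normalized_equilibrium:
  assumes "0 < \<epsilon>" shows "\<exists>\<xi>. sunspot_eps_equilibrium r \<epsilon> \<xi>"
proof (cases "punishable = {}")
  case True
  then show ?thesis using all_continue_equilibrium assms by blast
next
  case False
  show ?thesis
  proof (rule ccontr)
    assume no: "\<not> ?thesis"
    obtain d where "(d, 0) \<in> reachable punishable"
      using reachable_zero_mass[OF False no_equilibrium_lcp[OF assms no]] by blast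
    then show False using reachable_zero_equilibrium[OF _ False assms] no by blast
  qed
qed

end

theorem theorem1:
  fixes r :: "'i::finite set \<Rightarrow> 'i \<Rightarrow> real" and \<epsilon> :: real
  assumes "\<forall>S i. \<bar>r S i\<bar> \<le> 1"
    and "\<epsilon> > 0"
  shows "\<exists>\<xi>. sunspot_eps_equilibrium r \<epsilon> \<xi>"
proof -
  have r: "\<bar>r S i\<bar> \<le> 1" for S i using assms(1) by blast
  \<comment> \<open>Subtracting the own solo payoff everywhere, also from the payoff of eternal
    continuation, shifts all expected payoffs of a player equally; the bound 1 becomes 2.\<close>
  define r' where "r' S i = r S i - r {i} i" for S i
  interpret normalized_game r'
  proof
    fix S j show "\<bar>r' S j\<bar> \<le> 2" using r[of S j] r[of "{j}" j] unfolding r'_def by linarith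
    show "r' {j} j = 0" by (simp add: r'_def)
  qed
  obtain \<xi> where \<xi>: "sunspot_eps_equilibrium r' \<epsilon> \<xi>" using normalized_equilibrium[OF assms(2)] by blast
  then have st: "is_strategy (\<xi> i)" for i by (simp add: sunspot_eps_equilibrium_def)
  have shift: "exp_payoff r' \<zeta> i = exp_payoff r \<zeta> i - r {i} i" if "\<And>i. is_strategy (\<zeta> i)" for \<zeta> i
    using exp_payoff_shift[of \<zeta> r i 1 "\<lambda>i. r {i} i", OF that r] by (simp add: r'_def[abs_def])
  have "exp_payoff r (\<xi>(i := \<xi>')) i - \<epsilon> \<le> exp_payoff r \<xi> i" if "is_strategy \<xi>'" for i \<xi>'
  proof -
    have "exp_payoff r' (\<xi>(i := \<xi>')) i - \<epsilon> \<le> exp_payoff r' \<xi> i"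
      using \<xi> that by (simp add: sunspot_eps_equilibrium_def)
    moreover have "is_strategy ((\<xi>(i := \<xi>')) k)" for k using st that by simp
    ultimately show ?thesis using shift[of \<xi> i, OF st] shift[of "\<xi>(i := \<xi>')" i] by simp
  qed
  then show ?thesis using st unfolding sunspot_eps_equilibrium_def by blast
qed

end
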